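(* The set of common hypercyclic vectors for $\{\sin(kD)\}_{k\in\mathbb{N}}$ (that is, of those $f\in H(\mathbb{C})$ that are hypercyclic for $\sin(kD)$ for every $k\in\mathbb{N}$) is densely strongly algebrable in $H(\mathbb{C})$. In general, any countable family of hypercyclic convolution operators $\{\Phi_n(D)\}_{n\in\mathbb{N}}$ on $H(\mathbb{C})$ has a densely strongly algebrable set of common hypercyclic vectors if for each $n\in\mathbb{N}$ the entire function $\Phi_n$ maps the origin into the open unit disc $\mathbb{D}$ and there is a non-trivial strictly convex arc $\Gamma_n\subset\Phi_n^{-1}(\partial\mathbb{D})$ such that \[ \mathrm{conv}(\Gamma_n\cup\{0\})\setminus\Gamma_n\subset\Phi_n^{-1}(\mathbb{D}). \]
   Context: $H(\mathbb{C})$ is the algebra of entire functions with pointwise product and the compact-open topology. $\mathrm{conv}(A)$ is the convex hull of $A\subset\mathbb{C}$. An arc is non-trivial if it is not a single point; an arc $\mathcal{C}$ is strictly convex if each segment with both endpoints in $\mathcal{C}$ intersects $\mathcal{C}$ only at those endpoints. A convolution operator on $H(\mathbb{C})$ is an operator $\Phi(D)f=\sum_{n\ge0}a_nD^nf$, where $D$ is complex differentiation and $\Phi(z)=\sum_{n\ge0}a_nz^n$ is an entire function of exponential type, i.e. there are $M,R>0$ with $|a_n|\le MR^n/n!$ for all $n\geq 0$. In particular $\sin(kD)=\Phi(D)$ with $\Phi(z)=\sin(kz)$. A vector $f$ is hypercyclic for an operator $T$ (continuous linear self-map) on $X$ if $\{f,Tf,T^2f,\dots\}$ is dense in $X$;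 $T$ is hypercyclic if it has a hypercyclic vector. A common hypercyclic vector for a family of operators is a vector that is hypercyclic for each of them. A subset $Y\subset X$ of a commutative algebra over a field $\mathbb{K}$ is algebraically independent if for any pairwise distinct $y_1,\dots,y_n\in Y$ and any nonzero polynomial $P\in\mathbb{K}[t_1,\dots,t_n]$ with $P(0)=0$ one has $P(y_1,\dots,y_n)\ne0$. The subalgebra generated by $Y$ is $A(Y)=\{P(y_1,\dots,y_n): n\in\mathbb{N},\ y_i\in Y,\ P\in\mathbb{K}[t_1,\dots,t_n],\ P(0)=0\}$ (subalgebras are not required to contain the unit); it is freely generated by $Y$ if $Y$ is algebraically independent. A subset $E$ of a commutative topological algebra $X$ is densely strongly algebrable if $E\cup\{0\}$ contains a dense subalgebra of $X$ freely generated by an infinite set. Here $\mathbb{K}=\mathbb{C}$. *)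

theory Defs
  imports "HOL-Complex_Analysis.Complex_Analysis" "HOL-Library.Poly_Mapping"
begin

definition entire :: "(complex \<Rightarrow> complex) set" where
  "entire = {f. f holomorphic_on UNIV}"

definition entire_topology :: "(complex \<Rightarrow> complex) topology" where
  "entire_topology =
     topology_generated_by {{f \<in> entire. f ` K \<subseteq> U} |K U. compact K \<and> open U}"

lemma topspace_entire_topology: "topspace entire_topology = entire"
proof -
  have "entire = {f \<in> entire. f ` {} \<subseteq> (UNIV :: complex set)}"
    by simp
  then have "entire \<in> {{f \<in> entire. f ` K \<subseteq> U} |K U. compact K \<and> open U}"
    by blast
  then show ?thesis
    unfolding entire_topology_def topology_generated_by_topspace by blast
qed

definition dense_in :: "'a topology \<Rightarrow> 'a set \<Rightarrow> bool" where
  "dense_in X A \<longleftrightarrow> A \<subseteq> topspace X \<and> X closure_of A = topspace X"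

definition hypercyclic_vector :: "'a topology \<Rightarrow> ('a \<Rightarrow> 'a) \<Rightarrow> 'a \<Rightarrow> bool" where
  "hypercyclic_vector X T f \<longleftrightarrow> f \<in> topspace X \<and> dense_in X {(T ^^ n) f |n. True}"

definition hypercyclic :: "'a topology \<Rightarrow> ('a \<Rightarrow> 'a) \<Rightarrow> bool" where
  "hypercyclic X T \<longleftrightarrow> (\<exists>f. hypercyclic_vector X T f)"

definition common_hypercyclic_vectors :: "'a topology \<Rightarrow> ('a \<Rightarrow> 'a) set \<Rightarrow> 'a set" where
  "common_hypercyclic_vectors X F = {f \<in> topspace X. \<forall>T\<in>F. hypercyclic_vector X T f}"

definition taylor_coeff :: "(complex \<Rightarrow> complex) \<Rightarrow> nat \<Rightarrow> complex" where
  "taylor_coeff \<Phi> n = (deriv ^^ n) \<Phi> 0 / fact n"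

definition exponential_type :: "(complex \<Rightarrow> complex) \<Rightarrow> bool" where
  "exponential_type \<Phi> \<longleftrightarrow> \<Phi> \<in> entire \<and>
     (\<exists>M>0. \<exists>R>0. \<forall>n. norm (taylor_coeff \<Phi> n) \<le> M * R ^ n / fact n)"

text \<open>The operator \<open>\<Phi>(D)\<close>. For \<open>\<Phi>\<close> of exponential type and \<open>f\<close> entire the series converges
  locally uniformly, so its sum in the compact-open topology is the pointwise sum used here.\<close>

definition conv_op :: "(complex \<Rightarrow> complex) \<Rightarrow> (complex \<Rightarrow> complex) \<Rightarrow> complex \<Rightarrow> complex" where
  "conv_op \<Phi> f = (\<lambda>z. suminf (\<lambda>n. taylor_coeff \<Phi> n * (deriv ^^ n) f z))"

text \<open>Polynomials in the indeterminates \<open>t\<^sub>0, t\<^sub>1, \<dots>\<close> are finitely supported maps from exponent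
  vectors to coefficients; \<open>mpolys n\<close> consists of those in \<open>t\<^sub>i\<close> with \<open>i < n\<close> only.\<close>

type_synonym mpoly = "(nat \<Rightarrow>\<^sub>0 nat) \<Rightarrow>\<^sub>0 complex"

definition mpolys :: "nat \<Rightarrow> mpoly set" where
  "mpolys n = {P. \<forall>m \<in> Poly_Mapping.keys P. Poly_Mapping.keys m \<subseteq> {..<n}}"

definition mpoly_eval :: "mpoly \<Rightarrow> (nat \<Rightarrow> complex) \<Rightarrow> complex" where
  "mpoly_eval P x = (\<Sum>m\<in>Poly_Mapping.keys P. Poly_Mapping.lookup P m * (\<Prod>i\<in>Poly_Mapping.keys m. x i ^ Poly_Mapping.lookup m i))"

text \<open>Evaluation at functions, with respect to the pointwise algebra operations.\<close>

definition mpoly_eval_fun :: "mpoly \<Rightarrow> (nat \<Rightarrow> 'a \<Rightarrow> complex) \<Rightarrow> 'a \<Rightarrow> complex" where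
  "mpoly_eval_fun P y = (\<lambda>z. mpoly_eval P (\<lambda>i. y i z))"

definition algebraically_independent :: "('a \<Rightarrow> complex) set \<Rightarrow> bool" where
  "algebraically_independent Y \<longleftrightarrow>
     (\<forall>n y. \<forall>P \<in> mpolys n. y ` {..<n} \<subseteq> Y \<and> inj_on y {..<n} \<and> P \<noteq> 0 \<and> mpoly_eval P (\<lambda>_. 0) = 0
        \<longrightarrow> mpoly_eval_fun P y \<noteq> (\<lambda>_. 0))"

definition generated_subalgebra :: "('a \<Rightarrow> complex) set \<Rightarrow> ('a \<Rightarrow> complex) set" where
  "generated_subalgebra Y =
     {mpoly_eval_fun P y |P y n. P \<in> mpolys n \<and> y ` {..<n} \<subseteq> Y \<and> mpoly_eval P (\<lambda>_. 0) = 0}"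

definition densely_strongly_algebrable ::
    "('a \<Rightarrow> complex) topology \<Rightarrow> ('a \<Rightarrow> complex) set \<Rightarrow> bool" where
  "densely_strongly_algebrable X E \<longleftrightarrow>
     (\<exists>Y \<subseteq> topspace X. infinite Y \<and> algebraically_independent Y \<and>
        generated_subalgebra Y \<subseteq> E \<union> {\<lambda>_. 0} \<and> dense_in X (generated_subalgebra Y))"

text \<open>An \<open>arc\<close> path is injective on the unit interval, so its image is never a single point.\<close>

definition nontrivial_arc :: "complex set \<Rightarrow> bool" where
  "nontrivial_arc C \<longleftrightarrow> (\<exists>g. arc g \<and> path_image g = C)"

definition strictly_convex_arc :: "complex set \<Rightarrow> bool" where
  "strictly_convex_arc C \<longleftrightarrow> (\<forall>x\<in>C. \<forall>y\<in>C. closed_segment x y \<inter> C = {x, y})"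

end

theory Submission
  imports Defs
begin

text \<open>
  Write \<open>T = \<Phi>(D)\<close>. Every exponential \<open>e\<^sup>\<mu>\<^sup>z\<close> is an eigenvector of \<open>T\<close> with eigenvalue \<open>\<Phi>(\<mu>)\<close>, and a
  product of exponentials is the exponential of the sum of the frequencies. Powers of \<open>T\<close> applied to
  products of exponential sums are therefore governed by the size of \<open>\<Phi>\<close> at sums of frequencies, and
  the arc \<open>\<Gamma>\<close> provides frequencies for which these sizes can be controlled.

  \<^emph>\<open>The geometry.\<close> By the maximum principle \<open>\<Gamma>\<close> lies in the boundary of \<open>conv(\<Gamma> \<union> {0})\<close>. A supporting
  line at a point of \<open>\<Gamma>\<close> meets \<open>\<Gamma>\<close> at most twice, by strict convexity, so an average of points of \<open>\<Gamma>\<close>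
  that are not all equal is not in \<open>\<Gamma>\<close>, and \<open>|\<Phi>| < 1\<close> there. Some \<open>\<gamma> \<in> \<Gamma>\<close> has \<open>|\<Phi>| < 1\<close> on the whole
  half-open segment from \<open>0\<close> to \<open>\<gamma>\<close>. By the maximum principle again, points of \<open>\<Gamma>\<close> near \<open>\<gamma>\<close> can be moved
  slightly so that \<open>|\<Phi>| > 1\<close> at the points while \<open>|\<Phi>| < 1\<close> persists at finitely many averages. The
  exponentials with frequencies in \<open>\<Gamma>\<close> near \<open>\<gamma>\<close> span a dense subspace, since \<open>\<gamma>\<close> is a limit point of \<open>\<Gamma>\<close>.

  \<^emph>\<open>Singling out one monomial.\<close> Give the \<open>i\<close>-th generator a weight \<open>w\<^sub>i > 0\<close>, and let a monomial \<open>f\<^sup>\<beta>\<close>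
  have weight \<open>W = \<Sum> \<beta>\<^sub>i w\<^sub>i\<close>. Given any functions \<open>F\<^sub>i\<close>, approximate each by an exponential sum with
  frequencies near \<open>0\<close>, and add a small multiple of an exponential of frequency \<open>(w\<^sub>i/W) \<gamma>\<close>. In one
  generator \<open>i\<^sub>0\<close> that occurs in \<open>f\<^sup>\<beta>\<close>, add instead a sum \<open>\<Sum> c\<^sub>\<kappa> e\<^sup>\<nu>\<^sup>z\<close> over frequencies \<open>\<nu> = \<nu>(\<kappa>)\<close> near
  \<open>(w\<^bsub>i\<^sub>0\<^esub>/W) \<gamma>\<close>, chosen so that the pure \<open>\<beta>\<^bsub>i\<^sub>0\<^esub>\<close>-th powers produce in \<open>f\<^sup>\<beta>\<close> the expanding frequencies \<open>\<kappa>\<close>.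
  With \<open>c\<^sub>\<kappa>\<close> of the size \<open>|\<Phi>(\<kappa>)|\<close> to the power \<open>- q / \<beta>\<^bsub>i\<^sub>0\<^esub>\<close> the pure terms are taken by \<open>T\<^sup>q\<close> to a
  prescribed sum \<open>\<Sum> b\<^sub>\<kappa> e\<^sup>\<kappa>\<^sup>z\<close>. The mixed terms have averages of the \<open>\<kappa>\<close> as frequencies and tend to \<open>0\<close>.
  All other terms of \<open>f\<^sup>\<beta>\<close>, and all terms of monomials of weight below \<open>W\<close>, have frequencies near
  \<open>(s/W) \<gamma>\<close> with an integer \<open>s < W\<close> and tend to \<open>0\<close> as well. This is \<open>simultaneous_transitivity\<close>.

  \<^emph>\<open>A generic sequence.\<close> The weights \<open>w\<^sub>i = N\<^sup>i\<close> separate all monomials in \<open>N\<close> variables with exponents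
  below \<open>N\<close>. Since each requirement of the previous paragraph is open and dense, a Baire category
  argument on sequences of entire functions yields one sequence \<open>(F\<^sub>i)\<close>, dense in the space, such that for
  each operator of the family some power of it takes \<open>F\<^sup>\<beta>\<close> close to any target and all monomials of
  smaller weight close to \<open>0\<close>. A polynomial in the \<open>F\<^sub>i\<close> without constant term is a combination of
  monomials, and the one of largest weight decides: unless all coefficients vanish, the combination is
  hypercyclic for every operator of the family, and in particular it is not \<open>0\<close>. So \<open>{F\<^sub>i}\<close> freely
  generates the required algebra, which is dense because the \<open>F\<^sub>i\<close> are.

  For \<open>\<Phi>(z) = sin(kz)\<close> one has \<open>|sin(x + iy)|\<^sup>2 = sin\<^sup>2 x + sinh\<^sup>2 y\<close>, so an arc of the curve
  \<open>sinh y = cos x\<close>, scaled by \<open>1/k\<close>, satisfies the hypotheses.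
\<close>

section \<open>Entire functions in the compact-open topology\<close>

type_synonym cfun = "complex \<Rightarrow> complex"

abbreviation close_on :: "real \<Rightarrow> real \<Rightarrow> cfun \<Rightarrow> cfun \<Rightarrow> bool" where
  "close_on R e f g \<equiv> \<forall>z. norm z \<le> R \<longrightarrow> norm (f z - g z) < e"

abbreviation small_on :: "real \<Rightarrow> real \<Rightarrow> cfun \<Rightarrow> bool" where
  "small_on R e f \<equiv> \<forall>z. norm z \<le> R \<longrightarrow> norm (f z) < e"

abbreviation entire_seq :: "(nat \<Rightarrow> cfun) \<Rightarrow> bool" where
  "entire_seq F \<equiv> \<forall>i. F i \<in> entire"

abbreviation exp_sum :: "complex set \<Rightarrow> cfun \<Rightarrow> cfun \<Rightarrow> complex \<Rightarrow> complex" where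
  "exp_sum K c k z \<equiv> \<Sum>\<kappa>\<in>K. c \<kappa> * exp (k \<kappa> * z)"

lemma entire_const: "(\<lambda>_. c) \<in> entire"
  by (simp add: entire_def)

lemma entire_add: "f \<in> entire \<Longrightarrow> g \<in> entire \<Longrightarrow> (\<lambda>z. f z + g z) \<in> entire"
  by (simp add: entire_def holomorphic_on_add)

lemma entire_mult: "f \<in> entire \<Longrightarrow> g \<in> entire \<Longrightarrow> (\<lambda>z. f z * g z) \<in> entire"
  by (simp add: entire_def holomorphic_on_mult)

lemma entire_power: "f \<in> entire \<Longrightarrow> (\<lambda>z. f z ^ n) \<in> entire"
  by (simp add: entire_def holomorphic_on_power)

lemma entire_diff: "f \<in> entire \<Longrightarrow> g \<in> entire \<Longrightarrow> (\<lambda>z. f z - g z) \<in> entire"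
  by (simp add: entire_def holomorphic_on_diff)

lemma entire_sum: "(\<And>i. i \<in> I \<Longrightarrow> f i \<in> entire) \<Longrightarrow> (\<lambda>z. \<Sum>i\<in>I. f i z) \<in> entire"
  by (simp add: entire_def holomorphic_on_sum)

lemma entire_prod: "(\<And>i. i \<in> I \<Longrightarrow> f i \<in> entire) \<Longrightarrow> (\<lambda>z. \<Prod>i\<in>I. f i z) \<in> entire"
  by (simp add: entire_def holomorphic_on_prod)

lemma entire_exp: "(\<lambda>z. exp (\<mu> * z)) \<in> entire"
  by (auto simp: entire_def intro!: holomorphic_intros)

lemmas entire_intros = entire_const entire_add entire_mult entire_power entire_diff
  entire_sum entire_prod entire_exp

lemma entire_bounded_on_cball:
  assumes "f \<in> entire"
  obtains B where "B \<ge> 1" "\<And>z. norm z \<le> R \<Longrightarrow> norm (f z) \<le> B"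
proof -
  have "compact (f ` cball 0 R)"
    using assms by (intro compact_continuous_image)
      (auto simp: entire_def intro: holomorphic_on_imp_continuous_on holomorphic_on_subset)
  then obtain B where "\<And>z. z \<in> cball 0 R \<Longrightarrow> norm (f z) \<le> B"
    using compact_imp_bounded bounded_iff by (metis imageI)
  then show ?thesis
    using that[of "max 1 B"] by (force simp: le_max_iff_disj)
qed

text \<open>Compact-open neighbourhoods contain balls of uniform convergence on discs, because a compact image
  \<open>f(K)\<close> has positive distance to the complement of an open set around it. Density in the
  compact-open topology thus reduces to approximation in sup norms on discs.\<close>

lemma openin_entire_topology_ball:
  assumes "openin entire_topology O'" "f \<in> O'"
  shows "\<exists>R e. e > 0 \<and> (\<forall>g\<in>entire. close_on R e g f \<longrightarrow> g \<in> O')"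
proof -
  have "generate_topology_on {{f \<in> entire. f ` K \<subseteq> U} |K U. compact K \<and> open U} O'"
    using assms(1) by (simp add: entire_topology_def openin_topology_generated_by_iff)
  then show ?thesis
    using assms(2)
  proof (induction arbitrary: f)
    case Empty
    then show ?case by simp
  next
    case (Int a b)
    obtain R1 e1 where 1: "e1 > 0" "\<forall>g\<in>entire. close_on R1 e1 g f \<longrightarrow> g \<in> a"
      using Int by blast
    obtain R2 e2 where 2: "e2 > 0" "\<forall>g\<in>entire. close_on R2 e2 g f \<longrightarrow> g \<in> b"
      using Int by blast
    show ?case
      by (rule exI[of _ "max R1 R2"], rule exI[of _ "min e1 e2"]) (use 1 2 in auto)
  next
    case (UN K)
    then obtain k where k: "k \<in> K" "f \<in> k" by blast
    with UN.IH[OF k] show ?case by blast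
  next
    case (Basis s)
    then obtain K U where s: "s = {f \<in> entire. f ` K \<subseteq> U}" and KU: "compact K" "open U"
      by blast
    have fK: "compact (f ` K)" "f ` K \<subseteq> U"
      using Basis(2) KU unfolding s
      by (auto simp: entire_def intro!: compact_continuous_image holomorphic_on_imp_continuous_on
            intro: holomorphic_on_subset)
    obtain e where e: "e > 0" "(\<Union>x\<in>f ` K. ball x e) \<subseteq> U"
      using compact_subset_open_imp_ball_epsilon_subset[OF fK(1) KU(2) fK(2)] by blast
    obtain R where R: "\<And>z. z \<in> K \<Longrightarrow> norm z \<le> R"
      using KU(1) compact_imp_bounded bounded_iff by metis
    have "g \<in> s" if "g \<in> entire" "close_on R e g f" for g
    proof -
      have "g z \<in> U" if "z \<in> K" for z
        using \<open>\<forall>z. norm z \<le> R \<longrightarrow> _\<close> R[OF that] e(2) that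
        by (force simp: dist_norm norm_minus_commute)
      then show ?thesis using that(1) by (auto simp: s)
    qed
    then show ?case using e(1) by blast
  qed
qed

lemma dense_in_entire_topologyI:
  assumes "A \<subseteq> entire"
    and "\<And>f R e. f \<in> entire \<Longrightarrow> e > 0 \<Longrightarrow> \<exists>g\<in>A. close_on R e g f"
  shows "dense_in entire_topology A"
proof -
  have "f \<in> entire_topology closure_of A" if f: "f \<in> entire" for f
    unfolding in_closure_of
  proof (intro conjI allI impI)
    show "f \<in> topspace entire_topology" using f by (simp add: topspace_entire_topology)
    fix T assume T: "f \<in> T \<and> openin entire_topology T"
    then obtain R e where "e > 0" "\<forall>g\<in>entire. close_on R e g f \<longrightarrow> g \<in> T"
      using openin_entire_topology_ball by blast
    then show "\<exists>y. y \<in> A \<and> y \<in> T"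
      using assms(2)[OF f] assms(1) by blast
  qed
  then show ?thesis
    using assms(1) closure_of_subset_topspace[of entire_topology A]
    unfolding dense_in_def topspace_entire_topology by blast
qed

text \<open>The quantitative form of continuity: the value of \<open>T f\<close> at a point is controlled by \<open>f\<close> on a disc of
  fixed radius around it. Unlike continuity with respect to one disc, this form is visibly stable under
  composition, hence under the iteration of \<open>T\<close>.\<close>

definition local_operator :: "(cfun \<Rightarrow> complex \<Rightarrow> complex) \<Rightarrow> bool" where
  "local_operator T \<longleftrightarrow>
     (\<forall>f\<in>entire. T f \<in> entire) \<and>
     (\<forall>f\<in>entire. \<forall>g\<in>entire. T (\<lambda>z. f z + g z) = (\<lambda>z. T f z + T g z)) \<and>
     (\<forall>f\<in>entire. \<forall>c. T (\<lambda>z. c * f z) = (\<lambda>z. c * T f z)) \<and>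
     (\<exists>M>0. \<exists>\<rho>\<ge>0. \<forall>f\<in>entire. \<forall>z B. (\<forall>w\<in>cball z \<rho>. norm (f w) \<le> B) \<longrightarrow> norm (T f z) \<le> M * B)"

lemma local_operator_bound:
  "local_operator T \<Longrightarrow> \<exists>M>0. \<exists>\<rho>\<ge>0. \<forall>f\<in>entire. \<forall>z B.
     (\<forall>w\<in>cball z \<rho>. norm (f w) \<le> B) \<longrightarrow> norm (T f z) \<le> M * B"
  by (simp only: local_operator_def)

lemma local_operator_id: "local_operator id"
proof -
  have "\<exists>M>0. \<exists>\<rho>\<ge>0. \<forall>f\<in>entire. \<forall>z B. (\<forall>w\<in>cball z \<rho>. norm (f w) \<le> B) \<longrightarrow> norm (id f z) \<le> M * B"
    by (rule exI[of _ 1], simp, rule exI[of _ 0]) simp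
  then show ?thesis unfolding local_operator_def by simp
qed

lemma local_operator_comp:
  assumes S: "local_operator S" and T: "local_operator T"
  shows "local_operator (S \<circ> T)"
proof -
  obtain M1 \<rho>1 where 1: "M1 > 0" "\<rho>1 \<ge> 0"
    "\<forall>f\<in>entire. \<forall>z B. (\<forall>w\<in>cball z \<rho>1. norm (f w) \<le> B) \<longrightarrow> norm (S f z) \<le> M1 * B"
    using local_operator_bound[OF S] by (elim exE conjE)
  obtain M2 \<rho>2 where 2: "M2 > 0" "\<rho>2 \<ge> 0"
    "\<forall>f\<in>entire. \<forall>z B. (\<forall>w\<in>cball z \<rho>2. norm (f w) \<le> B) \<longrightarrow> norm (T f z) \<le> M2 * B"
    using local_operator_bound[OF T] by (elim exE conjE)
  have T_entire: "T f \<in> entire" if "f \<in> entire" for f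
    using that T unfolding local_operator_def by blast
  have "norm (S (T f) z) \<le> (M1 * M2) * B"
    if f: "f \<in> entire" and B: "\<forall>w\<in>cball z (\<rho>1 + \<rho>2). norm (f w) \<le> B" for f z B
  proof -
    have "norm (T f w) \<le> M2 * B" if "w \<in> cball z \<rho>1" for w
    proof (rule 2(3)[rule_format, OF f])
      fix v assume "v \<in> cball w \<rho>2"
      then have "dist z v \<le> \<rho>1 + \<rho>2"
        using that dist_triangle[of z v w] by auto
      then show "norm (f v) \<le> B" using B by auto
    qed
    then have "norm (S (T f) z) \<le> M1 * (M2 * B)"
      by (intro 1(3)[rule_format] T_entire f) auto
    then show ?thesis by (simp add: mult.assoc)
  qed
  moreover have "M1 * M2 > 0" "\<rho>1 + \<rho>2 \<ge> 0" using 1 2 by auto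
  ultimately have "\<exists>M>0. \<exists>\<rho>\<ge>0. \<forall>f\<in>entire. \<forall>z B. (\<forall>w\<in>cball z \<rho>. norm (f w) \<le> B)
      \<longrightarrow> norm ((S \<circ> T) f z) \<le> M * B"
    by (intro exI[of _ "M1 * M2"] exI[of _ "\<rho>1 + \<rho>2"] conjI ballI allI impI) simp_all
  then show ?thesis
    using S T unfolding local_operator_def by simp
qed

lemma local_operator_funpow: "local_operator T \<Longrightarrow> local_operator (T ^^ q)"
  by (induction q) (auto simp: local_operator_id[unfolded id_def] id_def intro: local_operator_comp)

lemma local_operator_entire: "local_operator T \<Longrightarrow> f \<in> entire \<Longrightarrow> T f \<in> entire"
  by (simp add: local_operator_def)

lemma local_operator_add:
  "local_operator T \<Longrightarrow> f \<in> entire \<Longrightarrow> g \<in> entire \<Longrightarrow> T (\<lambda>z. f z + g z) = (\<lambda>z. T f z + T g z)"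
  by (simp add: local_operator_def)

lemma local_operator_scale:
  "local_operator T \<Longrightarrow> f \<in> entire \<Longrightarrow> T (\<lambda>z. c * f z) = (\<lambda>z. c * T f z)"
  by (simp add: local_operator_def)

lemma local_operator_diff:
  assumes "local_operator T" "f \<in> entire" "g \<in> entire"
  shows "T (\<lambda>z. f z - g z) = (\<lambda>z. T f z - T g z)"
  using local_operator_add[OF assms(1,2) entire_mult[OF entire_const[of "-1"] assms(3)]]
    local_operator_scale[OF assms(1,3), of "-1"] by simp

lemma local_operator_zero: "local_operator T \<Longrightarrow> T (\<lambda>_. 0) = (\<lambda>_. 0)"
  using local_operator_scale[of T "\<lambda>_. 0" 0] entire_const[of 0] by simp

lemma local_operator_sum:
  assumes T: "local_operator T" and "finite I" "\<And>i. i \<in> I \<Longrightarrow> f i \<in> entire"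
  shows "T (\<lambda>z. \<Sum>i\<in>I. c i * f i z) = (\<lambda>z. \<Sum>i\<in>I. c i * T (f i) z)"
  using assms(2,3)
proof (induction I)
  case empty
  then show ?case using local_operator_zero[OF T] by simp
next
  case (insert i I)
  have "T (\<lambda>z. c i * f i z + (\<Sum>i\<in>I. c i * f i z)) = (\<lambda>z. T (\<lambda>z. c i * f i z) z + T (\<lambda>z. \<Sum>i\<in>I. c i * f i z) z)"
    using insert by (intro local_operator_add[OF T] entire_intros) auto
  then show ?case
    using insert local_operator_scale[OF T, of "f i" "c i"] by simp
qed

lemma local_operator_continuous:
  assumes T: "local_operator T" and "e > 0"
  shows "\<exists>R' d. d > 0 \<and> (\<forall>f\<in>entire. \<forall>g\<in>entire.
     close_on R' d g f \<longrightarrow> close_on R e (T g) (T f))"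
proof -
  obtain M \<rho> where M: "M > 0" "\<rho> \<ge> 0"
    "\<forall>f\<in>entire. \<forall>z B. (\<forall>w\<in>cball z \<rho>. norm (f w) \<le> B) \<longrightarrow> norm (T f z) \<le> M * B"
    using local_operator_bound[OF T] by (elim exE conjE)
  show ?thesis
  proof (rule exI[of _ "R + \<rho>"], rule exI[of _ "e / (2 * M)"], intro conjI ballI impI)
    show "e / (2 * M) > 0" using \<open>e > 0\<close> M by simp
    fix f g assume fg: "f \<in> entire" "g \<in> entire"
      and close: "close_on (R + \<rho>) (e / (2 * M)) g f"
    show "close_on R e (T g) (T f)"
    proof (intro allI impI)
      fix z :: complex assume z: "norm z \<le> R"
      have "norm (w :: complex) \<le> R + \<rho>" if "w \<in> cball z \<rho>" for w
        using that z norm_triangle_sub[of w z] by (simp add: dist_norm norm_minus_commute)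
      then have "norm (T (\<lambda>z. g z - f z) z) \<le> M * (e / (2 * M))"
        using close by (intro M(3)[rule_format] entire_diff fg) (auto intro: less_imp_le)
      also have "\<dots> < e" using M \<open>e > 0\<close> by simp
      finally show "norm (T g z - T f z) < e"
        using local_operator_diff[OF T fg(2,1)] by simp
    qed
  qed
qed

text \<open>Cauchy's inequality on a disc of radius \<open>2R\<close>, where \<open>|a\<^sub>n| \<le> M R\<^sup>n / n!\<close>, bounds the \<open>n\<close>-th term of the
  series of \<open>\<Phi>(D) f\<close> by \<open>M B / 2\<^sup>n\<close> if \<open>|f| \<le> B\<close> on that disc.\<close>

lemma exponential_type_local_operator:
  assumes "exponential_type \<Phi>"
  shows "local_operator (conv_op \<Phi>)"
proof -
  obtain M R where M: "M > 0" "R > 0" and coeff: "\<And>n. norm (taylor_coeff \<Phi> n) \<le> M * R ^ n / fact n"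
    using assms unfolding exponential_type_def by blast
  have term_bound: "norm (taylor_coeff \<Phi> n * (deriv ^^ n) f z) \<le> M * B * (1/2) ^ n"
    if f: "f \<in> entire" and B: "\<forall>w\<in>cball z (2*R). norm (f w) \<le> B" for f z B n
  proof -
    have "norm ((deriv ^^ n) f z) \<le> fact n * B / (2*R) ^ n"
      using f B M unfolding entire_def
      by (intro Cauchy_inequality) (auto simp: dist_norm intro: holomorphic_on_subset
            holomorphic_on_imp_continuous_on)
    then have "norm (taylor_coeff \<Phi> n * (deriv ^^ n) f z) \<le> (M * R ^ n / fact n) * (fact n * B / (2*R) ^ n)"
      unfolding norm_mult using coeff[of n] M by (intro mult_mono) auto
    also have "\<dots> = M * B * (1/2) ^ n"
      using M by (simp add: power_mult_distrib power_divide)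
    finally show ?thesis .
  qed
  have summ: "summable (\<lambda>n. norm (taylor_coeff \<Phi> n * (deriv ^^ n) f z))" if f: "f \<in> entire" for f z
  proof -
    obtain B where B: "\<And>w. norm w \<le> norm z + 2*R \<Longrightarrow> norm (f w) \<le> B"
      using entire_bounded_on_cball[OF f] by blast
    have "\<forall>w\<in>cball z (2*R). norm (f w) \<le> B"
    proof
      fix w assume "w \<in> cball z (2*R)"
      then show "norm (f w) \<le> B"
        using norm_triangle_sub[of w z] by (intro B) (simp add: dist_norm norm_minus_commute)
    qed
    note bound = term_bound[OF f this]
    have "summable (\<lambda>n. M * B * (1/2) ^ n)"
      by (intro summable_mult summable_geometric) simp
    then show ?thesis
      by (rule summable_comparison_test'[where N = 0]) (simp add: bound)
  qed
  have "conv_op \<Phi> f \<in> entire" if f: "f \<in> entire" for f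
    unfolding entire_def mem_Collect_eq
  proof (rule holomorphic_uniform_sequence[of _ "\<lambda>N z. \<Sum>n<N. taylor_coeff \<Phi> n * (deriv ^^ n) f z"])
    show "(\<lambda>z. \<Sum>n<N. taylor_coeff \<Phi> n * (deriv ^^ n) f z) holomorphic_on UNIV" for N
      using f unfolding entire_def
      by (intro holomorphic_on_sum holomorphic_on_mult holomorphic_on_const holomorphic_higher_deriv) simp_all
    fix x :: complex
    obtain B where B: "\<And>w. norm w \<le> norm x + 1 + 2*R \<Longrightarrow> norm (f w) \<le> B"
      using entire_bounded_on_cball[OF f] by blast
    have "\<forall>w\<in>cball z (2*R). norm (f w) \<le> B" if "z \<in> cball x 1" for z
    proof
      fix w assume "w \<in> cball z (2*R)"
      then show "norm (f w) \<le> B"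
        using norm_triangle_sub[of w z] norm_triangle_sub[of z x] that
        by (intro B) (simp add: dist_norm norm_minus_commute)
    qed
    from term_bound[OF f this]
    have "uniform_limit (cball x 1) (\<lambda>N z. \<Sum>n<N. taylor_coeff \<Phi> n * (deriv ^^ n) f z)
        (conv_op \<Phi> f) sequentially"
      unfolding conv_op_def
      by (intro Weierstrass_m_test[where M = "\<lambda>n. M * B * (1/2) ^ n"] summable_mult summable_geometric) simp_all
    then show "\<exists>d>0. cball x d \<subseteq> UNIV \<and> uniform_limit (cball x d)
        (\<lambda>N z. \<Sum>n<N. taylor_coeff \<Phi> n * (deriv ^^ n) f z) (conv_op \<Phi> f) sequentially"
      by (intro exI[of _ 1]) auto
  qed auto
  moreover have "conv_op \<Phi> (\<lambda>z. f z + g z) = (\<lambda>z. conv_op \<Phi> f z + conv_op \<Phi> g z)"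
    if fg: "f \<in> entire" "g \<in> entire" for f g
  proof
    fix z
    have "(deriv ^^ n) (\<lambda>z. f z + g z) z = (deriv ^^ n) f z + (deriv ^^ n) g z" for n
      using fg unfolding entire_def by (intro higher_deriv_add[of _ UNIV]) auto
    then show "conv_op \<Phi> (\<lambda>z. f z + g z) z = conv_op \<Phi> f z + conv_op \<Phi> g z"
      using suminf_add[OF summable_norm_cancel[OF summ[OF fg(1)]] summable_norm_cancel[OF summ[OF fg(2)]], of z z]
      by (simp add: conv_op_def algebra_simps)
  qed
  moreover have "conv_op \<Phi> (\<lambda>z. c * f z) = (\<lambda>z. c * conv_op \<Phi> f z)" if f: "f \<in> entire" for f c
  proof
    fix z
    have "(deriv ^^ n) (\<lambda>z. c * f z) z = c * (deriv ^^ n) f z" for n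
      using f unfolding entire_def by (intro higher_deriv_cmult[of _ UNIV]) auto
    then show "conv_op \<Phi> (\<lambda>z. c * f z) z = c * conv_op \<Phi> f z"
      using suminf_mult[OF summable_norm_cancel[OF summ[OF f]], of c z]
      by (simp add: conv_op_def mult_ac)
  qed
  moreover have "norm (conv_op \<Phi> f z) \<le> (2 * M) * B"
    if f: "f \<in> entire" and B: "\<forall>w\<in>cball z (2*R). norm (f w) \<le> B" for f z B
  proof -
    have geo: "summable (\<lambda>n. M * B * (1/2) ^ n)"
      by (intro summable_mult summable_geometric) simp
    have "norm (conv_op \<Phi> f z) \<le> suminf (\<lambda>n. norm (taylor_coeff \<Phi> n * (deriv ^^ n) f z))"
      unfolding conv_op_def by (rule summable_norm[OF summ[OF f]])
    also have "\<dots> \<le> suminf (\<lambda>n. M * B * (1/2) ^ n)"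
      by (rule suminf_le[OF term_bound[OF f B] summ[OF f] geo])
    also have "\<dots> = (2 * M) * B"
      using suminf_mult[OF summable_geometric[of "1/2::real"], of "M * B"]
      by (simp add: suminf_geometric)
    finally show ?thesis .
  qed
  moreover have "2 * M > 0" "2 * R \<ge> 0" using M by auto
  ultimately show ?thesis
    unfolding local_operator_def
    by (intro conjI ballI allI exI[of _ "2 * M"] exI[of _ "2 * R"] impI) simp_all
qed

lemma higher_deriv_exp: "(deriv ^^ n) (\<lambda>z. exp (\<mu> * z)) = (\<lambda>z. \<mu> ^ n * exp (\<mu> * z))"
proof (induction n)
  case (Suc n)
  have "deriv (\<lambda>z. \<mu> ^ n * exp (\<mu> * z)) z = \<mu> ^ Suc n * exp (\<mu> * z)" for z
    by (rule DERIV_imp_deriv) (auto intro!: derivative_eq_intros)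
  then show ?case using Suc by auto
qed simp

text \<open>Differentiation multiplies the exponential by \<open>\<mu>\<close>, so the operator series becomes the Taylor series of
  \<open>\<Phi>\<close> at \<open>\<mu>\<close>.\<close>

lemma conv_op_exp:
  assumes "\<Phi> \<in> entire"
  shows "conv_op \<Phi> (\<lambda>z. exp (\<mu> * z)) = (\<lambda>z. \<Phi> \<mu> * exp (\<mu> * z))"
proof
  fix z
  have "(\<lambda>n. (deriv ^^ n) \<Phi> 0 / fact n * (\<mu> - 0) ^ n) sums \<Phi> \<mu>"
    by (rule holomorphic_power_series[of _ _ "norm \<mu> + 1"])
       (use assms in \<open>auto simp: entire_def intro: holomorphic_on_subset\<close>)
  then have "(\<lambda>n. taylor_coeff \<Phi> n * \<mu> ^ n * exp (\<mu> * z)) sums (\<Phi> \<mu> * exp (\<mu> * z))"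
    unfolding taylor_coeff_def by (intro sums_mult2) auto
  then show "conv_op \<Phi> (\<lambda>z. exp (\<mu> * z)) z = \<Phi> \<mu> * exp (\<mu> * z)"
    by (simp add: conv_op_def higher_deriv_exp sums_iff mult.assoc)
qed

lemma conv_op_funpow_exp:
  assumes "exponential_type \<Phi>"
  shows "(conv_op \<Phi> ^^ q) (\<lambda>z. exp (\<mu> * z)) = (\<lambda>z. \<Phi> \<mu> ^ q * exp (\<mu> * z))"
proof (induction q)
  case (Suc q)
  have "\<Phi> \<in> entire" using assms by (simp add: exponential_type_def)
  then show ?case
    using Suc local_operator_scale[OF exponential_type_local_operator[OF assms] entire_exp, of "\<Phi> \<mu> ^ q" \<mu>]
    by (simp add: conv_op_exp[OF \<open>\<Phi> \<in> entire\<close>] mult.assoc[symmetric] power_commutes)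
qed simp

section \<open>Density of exponentials\<close>

lemma entire_poly_approx:
  assumes f: "f \<in> entire" and "e > 0"
  obtains n :: nat and t :: "nat \<Rightarrow> complex"
    where "\<And>z. norm z \<le> R \<Longrightarrow> norm (f z - (\<Sum>k<n. t k * z ^ k)) < e"
proof -
  define t where "t = (\<lambda>n. (deriv ^^ n) f 0 / fact n)"
  have sums: "(\<lambda>n. t n * z ^ n) sums f z" for z
    using holomorphic_power_series[of f 0 "norm z + 1" z] f
    by (auto simp: entire_def t_def intro: holomorphic_on_subset)
  define R' where "R' = \<bar>R\<bar>"
  have "summable (\<lambda>n. norm (t n * of_real R' ^ n))"
    by (rule powser_insidea[OF sums_summable[OF sums[of "of_real (R' + 1)"]]]) (simp add: R'_def)
  then have "uniform_limit (cball 0 R') (\<lambda>n z. \<Sum>k<n. t k * z ^ k) (\<lambda>z. suminf (\<lambda>k. t k * z ^ k)) sequentially"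
    by (rule Weierstrass_m_test[rotated])
       (auto simp: norm_mult norm_power R'_def intro!: mult_left_mono power_mono)
  also have "(\<lambda>z. suminf (\<lambda>k. t k * z ^ k)) = f"
    using sums by (auto simp: sums_iff)
  finally have "\<forall>\<^sub>F n in sequentially. \<forall>z\<in>cball 0 R'. dist (\<Sum>k<n. t k * z ^ k) (f z) < e"
    using \<open>e > 0\<close> by (rule uniform_limitD)
  then obtain n where "\<forall>z\<in>cball 0 R'. dist (\<Sum>k<n. t k * z ^ k) (f z) < e"
    by (auto simp: eventually_sequentially)
  then show ?thesis
    by (intro that[of t n]) (auto simp: R'_def dist_norm norm_minus_commute)
qed

text \<open>The left-hand side is the error in recovering \<open>z\<^sup>n / n!\<close> from \<open>e\<^sup>w\<^sup>z\<close> and the lower powers of \<open>z\<close>. It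
  is of order \<open>|w|\<close> on a disc, so the error disappears when \<open>w\<close> tends to \<open>0\<close>.\<close>

lemma exp_remainder_bound:
  fixes w :: complex
  assumes "norm w \<le> 1" "norm z \<le> R" "w \<noteq> 0"
  shows "norm ((exp (w * z) - (\<Sum>k<n. (w * z) ^ k / fact k)) / w ^ n - z ^ n / fact n)
           \<le> exp R * R ^ Suc n * norm w"
proof -
  have R: "R \<ge> 0" using assms norm_ge_zero[of z] by linarith
  have "(exp (w * z) - (\<Sum>k<n. (w * z) ^ k / fact k)) / w ^ n - z ^ n / fact n
      = (exp (w * z) - (\<Sum>k\<le>n. (w * z) ^ k / fact k)) / w ^ n"
    using assms(3) by (simp add: lessThan_Suc_atMost[symmetric] field_simps)
  also have "norm \<dots> \<le> (exp \<bar>Re (w * z)\<bar> * norm (w * z) ^ Suc n / fact n) / norm w ^ n"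
    unfolding norm_divide norm_power by (intro divide_right_mono Taylor_exp) auto
  also have "\<dots> = exp \<bar>Re (w * z)\<bar> * norm z ^ Suc n * norm w / fact n"
    using assms(3) by (simp add: norm_mult power_mult_distrib field_simps)
  also have "\<dots> \<le> exp \<bar>Re (w * z)\<bar> * norm z ^ Suc n * norm w"
  proof -
    let ?x = "exp \<bar>Re (w * z)\<bar> * norm z ^ Suc n * norm w"
    have "?x / fact n \<le> ?x / 1" by (intro divide_left_mono) (auto intro: fact_ge_1)
    then show ?thesis by simp
  qed
  also have "\<dots> \<le> exp R * R ^ Suc n * norm w"
  proof -
    have "\<bar>Re (w * z)\<bar> \<le> norm w * norm z" using abs_Re_le_cmod[of "w * z"] by (simp add: norm_mult)
    also have "\<dots> \<le> 1 * R" using assms R by (intro mult_mono) auto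
    finally have "\<bar>Re (w * z)\<bar> \<le> R" by simp
    then show ?thesis
      using assms R by (intro mult_mono power_mono) auto
  qed
  finally show ?thesis .
qed

abbreviation exp_approximable :: "complex set \<Rightarrow> real \<Rightarrow> real \<Rightarrow> cfun \<Rightarrow> bool" where
  "exp_approximable S R e f \<equiv>
     \<exists>K c. finite K \<and> K \<subseteq> S \<and> close_on R e f (exp_sum K c (\<lambda>\<kappa>. \<kappa>))"

definition exp_span_closure :: "complex set \<Rightarrow> cfun set" where
  "exp_span_closure S = {f. \<forall>R. \<forall>e>0. exp_approximable S R e f}"

lemma exp_span_closure_exp: "\<kappa> \<in> S \<Longrightarrow> (\<lambda>z. exp (\<kappa> * z)) \<in> exp_span_closure S"
  unfolding exp_span_closure_def
  by (auto intro!: exI[of _ "{\<kappa>}"] exI[of _ "\<lambda>_. 1"])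

lemma exp_span_closure_0: "(\<lambda>_. 0) \<in> exp_span_closure S"
  unfolding exp_span_closure_def by (auto intro!: exI[of _ "{}"])

lemma exp_span_closure_add:
  assumes "f \<in> exp_span_closure S" "g \<in> exp_span_closure S"
  shows "(\<lambda>z. f z + g z) \<in> exp_span_closure S"
  unfolding exp_span_closure_def mem_Collect_eq
proof (intro allI impI)
  fix R e :: real assume "e > 0"
  then have e2: "e / 2 > 0" by simp
  obtain K c where K: "finite K" "K \<subseteq> S"
    "\<And>z. norm z \<le> R \<Longrightarrow> norm (f z - exp_sum K c (\<lambda>\<kappa>. \<kappa>) z) < e / 2"
    using assms(1) e2 unfolding exp_span_closure_def by blast
  obtain L d where L: "finite L" "L \<subseteq> S"
    "\<And>z. norm z \<le> R \<Longrightarrow> norm (g z - exp_sum L d (\<lambda>\<kappa>. \<kappa>) z) < e / 2"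
    using assms(2) e2 unfolding exp_span_closure_def by blast
  define b where "b = (\<lambda>\<kappa>. (if \<kappa> \<in> K then c \<kappa> else 0) + (if \<kappa> \<in> L then d \<kappa> else 0))"
  have b: "(\<Sum>\<kappa>\<in>K \<union> L. b \<kappa> * exp (\<kappa> * z)) = exp_sum K c (\<lambda>\<kappa>. \<kappa>) z + exp_sum L d (\<lambda>\<kappa>. \<kappa>) z" for z
  proof -
    have "exp_sum K c (\<lambda>\<kappa>. \<kappa>) z = (\<Sum>\<kappa>\<in>K \<union> L. (if \<kappa> \<in> K then c \<kappa> else 0) * exp (\<kappa> * z))"
      using K(1) L(1) by (intro sum.mono_neutral_cong_left) auto
    moreover have "exp_sum L d (\<lambda>\<kappa>. \<kappa>) z = (\<Sum>\<kappa>\<in>K \<union> L. (if \<kappa> \<in> L then d \<kappa> else 0) * exp (\<kappa> * z))"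
      using K(1) L(1) by (intro sum.mono_neutral_cong_left) auto
    ultimately show ?thesis by (simp add: b_def ring_distribs sum.distrib)
  qed
  have "norm (f z + g z - (\<Sum>\<kappa>\<in>K \<union> L. b \<kappa> * exp (\<kappa> * z))) < e" if "norm z \<le> R" for z
    using norm_diff_triangle_ineq[of "f z" "g z" "exp_sum K c (\<lambda>\<kappa>. \<kappa>) z" "exp_sum L d (\<lambda>\<kappa>. \<kappa>) z"]
      K(3)[OF that] L(3)[OF that] unfolding b by linarith
  then show "exp_approximable S R e (\<lambda>z. f z + g z)"
    using K L by (intro exI[of _ "K \<union> L"] exI[of _ b]) auto
qed

lemma exp_span_closure_scale:
  assumes "f \<in> exp_span_closure S"
  shows "(\<lambda>z. a * f z) \<in> exp_span_closure S"
  unfolding exp_span_closure_def mem_Collect_eq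
proof (intro allI impI)
  fix R e :: real assume "e > 0"
  have pos: "norm a + 1 > 0" using norm_ge_zero[of a] by linarith
  then have "e / (norm a + 1) > 0" using \<open>e > 0\<close> by simp
  then obtain K c where K: "finite K" "K \<subseteq> S"
    "\<And>z. norm z \<le> R \<Longrightarrow> norm (f z - exp_sum K c (\<lambda>\<kappa>. \<kappa>) z) < e / (norm a + 1)"
    using assms unfolding exp_span_closure_def by blast
  have "norm (a * f z - (\<Sum>\<kappa>\<in>K. (a * c \<kappa>) * exp (\<kappa> * z))) < e" if "norm z \<le> R" for z
  proof -
    have "a * f z - (\<Sum>\<kappa>\<in>K. (a * c \<kappa>) * exp (\<kappa> * z)) = a * (f z - exp_sum K c (\<lambda>\<kappa>. \<kappa>) z)"
      by (simp add: sum_distrib_left right_diff_distrib mult.assoc)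
    also have "norm \<dots> \<le> norm a * (e / (norm a + 1))"
      unfolding norm_mult using K(3)[OF that] by (intro mult_left_mono) auto
    also have "\<dots> < e" using pos \<open>e > 0\<close> by (simp add: field_simps)
    finally show ?thesis .
  qed
  then show "exp_approximable S R e (\<lambda>z. a * f z)"
    using K by (intro exI[of _ K] exI[of _ "\<lambda>\<kappa>. a * c \<kappa>"]) auto
qed

lemma exp_span_closure_sum:
  "finite I \<Longrightarrow> (\<And>i. i \<in> I \<Longrightarrow> f i \<in> exp_span_closure S)
    \<Longrightarrow> (\<lambda>z. \<Sum>i\<in>I. c i * f i z) \<in> exp_span_closure S"
  by (induction I rule: finite_induct)
     (simp_all add: exp_span_closure_0 exp_span_closure_add exp_span_closure_scale)

lemma exp_span_closure_closed:
  assumes "\<And>R e. e > 0 \<Longrightarrow> \<exists>g\<in>exp_span_closure S. close_on R e f g"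
  shows "f \<in> exp_span_closure S"
  unfolding exp_span_closure_def mem_Collect_eq
proof (intro allI impI)
  fix R e :: real assume "e > 0"
  then have e2: "e / 2 > 0" by simp
  then obtain g where g: "g \<in> exp_span_closure S" "\<And>z. norm z \<le> R \<Longrightarrow> norm (f z - g z) < e / 2"
    using assms by blast
  obtain K c where K: "finite K" "K \<subseteq> S"
    "\<And>z. norm z \<le> R \<Longrightarrow> norm (g z - exp_sum K c (\<lambda>\<kappa>. \<kappa>) z) < e / 2"
    using g(1) e2 unfolding exp_span_closure_def by blast
  have "norm (f z - exp_sum K c (\<lambda>\<kappa>. \<kappa>) z) < e" if "norm z \<le> R" for z
    using g(2)[OF that] K(3)[OF that]
      norm_triangle_ineq[of "f z - g z" "g z - exp_sum K c (\<lambda>\<kappa>. \<kappa>) z"]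
    by simp
  then show "exp_approximable S R e f"
    using K by blast
qed

text \<open>By induction on \<open>n\<close>: the functions \<open>z\<^sup>k e\<^sup>a\<^sup>z\<close> with \<open>k < n\<close> are in the closed span, hence so is the
  \<open>n\<close>-th normalised Taylor remainder in \<open>\<kappa> - a\<close> of \<open>e\<^sup>\<kappa>\<^sup>z\<close>, and it tends to \<open>z\<^sup>n e\<^sup>a\<^sup>z / n!\<close> as
  \<open>\<kappa>\<close> tends to the limit point \<open>a\<close>.\<close>

lemma exp_span_closure_monomial:
  assumes a: "a islimpt S"
  shows "(\<lambda>z. z ^ n / fact n * exp (a * z)) \<in> exp_span_closure S"
proof (induction n rule: less_induct)
  case (less n)
  show ?case
  proof (rule exp_span_closure_closed)
    fix R e :: real assume "e > 0"
    define R' where "R' = \<bar>R\<bar>"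
    define C where "C = exp (norm a * R') * (exp R' * R' ^ Suc n) + 1"
    have "C > 0" unfolding C_def R'_def by (intro add_nonneg_pos) auto
    then have pos: "min 1 (e / C) > 0" using \<open>e > 0\<close> by simp
    have "\<exists>\<kappa>\<in>S. \<kappa> \<noteq> a \<and> dist \<kappa> a < min 1 (e / C)"
      using a pos unfolding islimpt_approachable by (elim allE impE)
    then obtain \<kappa> where \<kappa>: "\<kappa> \<in> S" "\<kappa> \<noteq> a" "dist \<kappa> a < min 1 (e / C)"
      by (elim bexE conjE)
    define w where "w = \<kappa> - a"
    have w: "w \<noteq> 0" "norm w < 1" "norm w < e / C"
      using \<kappa> by (auto simp: w_def dist_norm)
    define h where "h = (\<lambda>z. inverse (w ^ n) * (exp (\<kappa> * z) +
        (\<Sum>k<n. (- (w ^ k)) * (z ^ k / fact k * exp (a * z)))))"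
    have "h \<in> exp_span_closure S"
    proof -
      have "(\<lambda>z. \<Sum>k<n. (- (w ^ k)) * (z ^ k / fact k * exp (a * z))) \<in> exp_span_closure S"
        by (rule exp_span_closure_sum[where f = "\<lambda>k z. z ^ k / fact k * exp (a * z)"])
           (use less.IH in simp_all)
      then show ?thesis
        unfolding h_def
        by (rule exp_span_closure_scale[OF exp_span_closure_add[OF exp_span_closure_exp[OF \<kappa>(1)]]])
    qed
    moreover have "norm (z ^ n / fact n * exp (a * z) - h z) < e" if z: "norm z \<le> R" for z
    proof -
      have z': "norm z \<le> R'" using z by (simp add: R'_def)
      have *: "exp (\<kappa> * z) = exp (a * z) * exp (w * z)"
        by (simp add: w_def exp_add[symmetric] algebra_simps)
      have "h z = exp (a * z) * ((exp (w * z) - (\<Sum>k<n. (w * z) ^ k / fact k)) / w ^ n)"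
      proof -
        have "(\<Sum>k<n. (- (w ^ k)) * (z ^ k / fact k * exp (a * z))) = - (exp (a * z) * (\<Sum>k<n. (w * z) ^ k / fact k))"
          unfolding sum_distrib_left sum_negf[symmetric]
          by (intro sum.cong refl) (simp add: power_mult_distrib mult_ac)
        then show ?thesis
          unfolding h_def * by (simp add: divide_inverse algebra_simps)
      qed
      then have "norm (z ^ n / fact n * exp (a * z) - h z) = norm (exp (a * z)) *
          norm ((exp (w * z) - (\<Sum>k<n. (w * z) ^ k / fact k)) / w ^ n - z ^ n / fact n)"
        unfolding norm_mult[symmetric]
        by (subst norm_minus_commute) (simp add: right_diff_distrib mult.commute)
      also have "\<dots> \<le> exp (norm a * R') * (exp R' * R' ^ Suc n * norm w)"
      proof (intro mult_mono exp_remainder_bound)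
        have "norm (exp (a * z)) \<le> exp (norm (a * z))" by (rule norm_exp)
        also have "\<dots> \<le> exp (norm a * R')" using z' by (simp add: norm_mult mult_left_mono)
        finally show "norm (exp (a * z)) \<le> exp (norm a * R')" .
      qed (use w z' in auto)
      also have "\<dots> \<le> C * norm w" by (simp add: C_def algebra_simps)
      also have "\<dots> < C * (e / C)" using w(3) \<open>C > 0\<close> by (intro mult_strict_left_mono)
      also have "\<dots> = e" using \<open>C > 0\<close> by simp
      finally show ?thesis .
    qed
    ultimately show "\<exists>g\<in>exp_span_closure S. close_on R e (\<lambda>z. z ^ n / fact n * exp (a * z)) g"
      by blast
  qed
qed

text \<open>The closed span contains all \<open>p(z) e\<^sup>a\<^sup>z\<close> with a polynomial \<open>p\<close>, and \<open>f(z) e\<^sup>-\<^sup>a\<^sup>z\<close> can be approximated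
  by polynomials.\<close>

lemma exponentials_dense:
  assumes a: "a islimpt S" and f: "f \<in> entire" and "e > 0"
  obtains K c where "finite K" "K \<subseteq> S"
    "\<And>z. norm z \<le> R \<Longrightarrow> norm (f z - exp_sum K c (\<lambda>\<kappa>. \<kappa>) z) < e"
proof -
  have "f \<in> exp_span_closure S"
  proof (rule exp_span_closure_closed)
    fix R e :: real assume "e > 0"
    obtain B where B: "B \<ge> 1" "\<And>z. norm z \<le> R \<Longrightarrow> norm (exp (a * z)) \<le> B"
      using entire_bounded_on_cball[OF entire_exp[of a]] by blast
    have "e / B > 0" using \<open>e > 0\<close> B(1) by simp
    moreover have "(\<lambda>z. f z * exp ((- a) * z)) \<in> entire" by (intro entire_intros f)
    ultimately obtain n t where nt:
      "\<And>z. norm z \<le> R \<Longrightarrow> norm (f z * exp ((- a) * z) - (\<Sum>k<n. t k * z ^ k)) < e / B"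
      using entire_poly_approx by blast
    define g where "g = (\<lambda>z. \<Sum>k<n. (t k * fact k) * (z ^ k / fact k * exp (a * z)))"
    have "g \<in> exp_span_closure S"
      unfolding g_def
      by (rule exp_span_closure_sum[where f = "\<lambda>k z. z ^ k / fact k * exp (a * z)"])
         (rule finite_lessThan, rule exp_span_closure_monomial[OF a])
    moreover have "norm (f z - g z) < e" if z: "norm z \<le> R" for z
    proof -
      have "f z - g z = exp (a * z) * (f z * exp ((- a) * z) - (\<Sum>k<n. t k * z ^ k))"
      proof -
        have "g z = exp (a * z) * (\<Sum>k<n. t k * z ^ k)"
          unfolding g_def sum_distrib_left by (intro sum.cong refl) (simp add: mult_ac)
        moreover have "exp (a * z) * (f z * exp ((- a) * z)) = f z"
          by (simp add: exp_minus)
        ultimately show ?thesis by (simp add: right_diff_distrib)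
      qed
      also have "norm \<dots> \<le> B * norm (f z * exp ((- a) * z) - (\<Sum>k<n. t k * z ^ k))"
        unfolding norm_mult using B(2)[OF z] by (intro mult_right_mono) auto
      also have "\<dots> < B * (e / B)" using nt[OF z] B(1) by (intro mult_strict_left_mono) auto
      also have "\<dots> = e" using B(1) by simp
      finally show ?thesis .
    qed
    ultimately show "\<exists>g\<in>exp_span_closure S. close_on R e f g" by blast
  qed
  then show ?thesis
    using \<open>e > 0\<close> that unfolding exp_span_closure_def by blast
qed

section \<open>Geometry of strictly convex unimodular arcs\<close>

text \<open>In the plane, the orthogonal complement of \<open>a \<noteq> 0\<close> is the line spanned by \<open>\<i> a\<close>.\<close>

lemma orthogonal_to_same_imp_collinear:
  fixes a x y z :: complex
  assumes "a \<noteq> 0" "a \<bullet> x = a \<bullet> z" "a \<bullet> y = a \<bullet> z"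
  shows "collinear {x, y, z}"
proof -
  define c where "c = (\<lambda>v. (v \<bullet> (\<i> * a)) / (norm a)\<^sup>2)"
  have n: "(Re a)\<^sup>2 + (Im a)\<^sup>2 \<noteq> 0"
    using assms(1) by (simp add: complex_eq_iff sum_power2_eq_zero_iff)
  have *: "v = c v *\<^sub>R (\<i> * a)" if "a \<bullet> v = 0" for v
  proof -
    have z: "Re a * Re v + Im a * Im v = 0" using that by (simp add: inner_complex_def)
    have "Re v * ((Re a)\<^sup>2 + (Im a)\<^sup>2) = - (Re v * - Im a + Im v * Re a) * Im a + Re a * (Re a * Re v + Im a * Im v)"
      "Im v * ((Re a)\<^sup>2 + (Im a)\<^sup>2) = (Re v * - Im a + Im v * Re a) * Re a + Im a * (Re a * Re v + Im a * Im v)"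
      by (simp_all add: power2_eq_square algebra_simps)
    then show ?thesis
      using n unfolding z by (simp add: c_def complex_eq_iff inner_complex_def cmod_power2 field_simps)
  qed
  show ?thesis
    unfolding collinear_def
  proof (intro exI ballI)
    fix u v assume "u \<in> {x, y, z}" "v \<in> {x, y, z}"
    then have "a \<bullet> (u - v) = 0" using assms by (auto simp: inner_diff_right)
    from *[OF this] show "u - v = c (u - v) *\<^sub>R (\<i> * a)" .
  qed
qed

text \<open>Of three distinct collinear points one lies strictly between the others.\<close>

lemma strictly_convex_arc_no_three_collinear:
  assumes "strictly_convex_arc \<Gamma>" "x \<in> \<Gamma>" "y \<in> \<Gamma>" "z \<in> \<Gamma>" "collinear {x, y, z}"
  shows "x = y \<or> y = z \<or> x = z"
proof -
  have *: "u = v \<or> u = w" if "between (v, w) u" "u \<in> \<Gamma>" "v \<in> \<Gamma>" "w \<in> \<Gamma>" for u v w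
    using that assms(1) unfolding strictly_convex_arc_def between_mem_segment by blast
  show ?thesis
    using assms(5) *[of y z x] *[of z x y] *[of x y z] assms(2-4)
    unfolding collinear_between_cases by blast
qed

lemma sum_inner_nonneg_eq_0:
  fixes f :: "nat \<Rightarrow> complex"
  assumes "(\<Sum>l<m. f l) = 0" "\<And>l. l < m \<Longrightarrow> a \<bullet> f l \<ge> 0" "l < m"
  shows "a \<bullet> f l = 0"
proof -
  have "(\<Sum>l<m. a \<bullet> f l) = 0" using assms(1) by (simp add: inner_sum_right[symmetric])
  then show ?thesis using assms(2,3) by (subst (asm) sum_nonneg_eq_0_iff) auto
qed

text \<open>The conditions on one symbol \<open>\<Phi>\<close> of the family.\<close>

locale unimodular_arc =
  fixes \<Phi> :: "complex \<Rightarrow> complex" and \<Gamma> :: "complex set"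
  assumes entire: "\<Phi> \<in> entire"
    and origin: "norm (\<Phi> 0) < 1"
    and arc: "nontrivial_arc \<Gamma>"
    and strict: "strictly_convex_arc \<Gamma>"
    and on_arc: "\<And>z. z \<in> \<Gamma> \<Longrightarrow> norm (\<Phi> z) = 1"
    and off_arc: "\<And>z. z \<in> convex hull (\<Gamma> \<union> {0}) \<Longrightarrow> z \<notin> \<Gamma> \<Longrightarrow> norm (\<Phi> z) < 1"
begin

lemma arc_nonempty: "\<Gamma> \<noteq> {}"
  using arc unfolding nontrivial_arc_def by auto

lemma nonconstant: "\<not> \<Phi> constant_on UNIV"
proof
  assume "\<Phi> constant_on UNIV"
  then obtain c where "\<And>z. \<Phi> z = c" unfolding constant_on_def by auto
  then show False using origin on_arc arc_nonempty by fastforce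
qed

lemma norm_le_1_on_hull: "z \<in> convex hull (\<Gamma> \<union> {0}) \<Longrightarrow> norm (\<Phi> z) \<le> 1"
  using on_arc[of z] off_arc[of z] by (cases "z \<in> \<Gamma>") auto

text \<open>If \<open>p\<close> were an interior point of the hull, \<open>|\<Phi>|\<close> would attain its maximum over the hull in the interior,
  and \<open>\<Phi>\<close> would be constant.\<close>

lemma supporting_line:
  assumes p: "p \<in> \<Gamma>"
  obtains a where "a \<noteq> 0" "\<And>x. x \<in> convex hull (\<Gamma> \<union> {0}) \<Longrightarrow> a \<bullet> p \<le> a \<bullet> x"
proof -
  let ?K = "convex hull (\<Gamma> \<union> {0})"
  have pK: "p \<in> ?K" using p by (simp add: hull_inc)
  have int: "p \<notin> interior ?K"
  proof
    assume "p \<in> interior ?K"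
    then have "\<Phi> constant_on UNIV"
      using entire on_arc[OF p] norm_le_1_on_hull interior_subset[of ?K]
      by (intro maximum_modulus_principle[of \<Phi> UNIV "interior ?K" p]) (auto simp: entire_def)
    then show False using nonconstant by simp
  qed
  show ?thesis
  proof (cases "interior ?K = {}")
    case True
    obtain a b where "a \<noteq> 0" "?K \<subseteq> {x. a \<bullet> x = b}"
      using empty_interior_subset_hyperplane[OF convex_convex_hull True] by blast
    moreover from this(2) pK have "a \<bullet> x = a \<bullet> p" if "x \<in> ?K" for x using that by blast
    ultimately show ?thesis by (intro that[of a]) simp_all
  next
    case False
    then have "rel_interior ?K = interior ?K" by (rule rel_interior_nonempty_interior)
    with int have "p \<notin> rel_interior ?K" by simp
    from supporting_hyperplane_rel_boundary[OF convex_convex_hull pK this]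
    show ?thesis using that by metis
  qed
qed

text \<open>If the average \<open>p\<close> were in \<open>\<Gamma>\<close>, the supporting line at \<open>p\<close> would contain all the points \<open>g l\<close>, since
  the functional is minimal at their average. At most two points of \<open>\<Gamma>\<close> lie on that line, so apart from
  \<open>p\<close> the \<open>g l\<close> take a single value; but then \<open>p\<close> is not their average.\<close>

lemma average_in_disc:
  fixes g :: "nat \<Rightarrow> complex"
  assumes g: "\<And>l. l < m \<Longrightarrow> g l \<in> \<Gamma>" and l12: "l1 < m" "l2 < m" "g l1 \<noteq> g l2"
  shows "norm (\<Phi> ((\<Sum>l<m. g l) / of_nat m)) < 1"
proof -
  define p where "p = (\<Sum>l<m. g l) / of_nat m"
  have m: "m > 0" using l12 by simp
  have "(\<Sum>l\<in>{..<m}. (1 / real m) *\<^sub>R g l) \<in> convex hull (\<Gamma> \<union> {0})"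
    using m g by (intro convex_sum convex_convex_hull) (auto simp: hull_inc)
  also have "(\<Sum>l\<in>{..<m}. (1 / real m) *\<^sub>R g l) = p"
    by (simp add: p_def scaleR_sum_right[symmetric] scaleR_conv_of_real sum_divide_distrib)
  finally have p_hull: "p \<in> convex hull (\<Gamma> \<union> {0})" .
  have sum0: "(\<Sum>l<m. g l - p) = 0"
    using m by (simp add: sum_subtractf p_def)
  have "p \<notin> \<Gamma>"
  proof
    assume p: "p \<in> \<Gamma>"
    then obtain a where a: "a \<noteq> 0" "\<And>x. x \<in> convex hull (\<Gamma> \<union> {0}) \<Longrightarrow> a \<bullet> p \<le> a \<bullet> x"
      by (rule supporting_line) blast
    have "a \<bullet> (g l - p) = 0" if "l < m" for l
      using a(2)[of "g _"] g by (intro sum_inner_nonneg_eq_0[OF sum0 _ that]) (auto simp: inner_diff_right hull_inc)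
    then have line: "a \<bullet> g l = a \<bullet> p" if "l < m" for l using that by (simp add: inner_diff_right)
    have at_most_two: "x = y \<or> y = p \<or> x = p" if "x \<in> g ` {..<m}" "y \<in> g ` {..<m}" for x y
      using that a(1) line g p
      by (intro strictly_convex_arc_no_three_collinear[OF strict] orthogonal_to_same_imp_collinear[of a]) auto
    obtain l0 where l0: "l0 < m" "g l0 \<noteq> p" using l12 by metis
    have "g l = p \<or> g l = g l0" if "l < m" for l
      using at_most_two[of "g l" "g l0"] l0 that by blast
    then have "(g l0 - p) \<bullet> (g l - p) \<ge> 0" if "l < m" for l using that by fastforce
    then have "(g l0 - p) \<bullet> (g l0 - p) = 0"
      by (intro sum_inner_nonneg_eq_0[OF sum0 _ l0(1)])
    then show False using l0 by simp
  qed
  then show ?thesis using off_arc[OF p_hull] by (simp add: p_def)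
qed

text \<open>A line through \<open>0\<close> contains at most two points of \<open>\<Gamma>\<close>. If \<open>\<delta> \<in> \<Gamma>\<close> is not the point of \<open>\<Gamma>\<close> closest to
  \<open>0\<close> on its ray, then the other point of \<open>\<Gamma>\<close> on this ray is.\<close>

lemma base_point:
  obtains \<gamma> where "\<gamma> \<in> \<Gamma>" "\<gamma> islimpt \<Gamma>" "\<And>s. 0 \<le> s \<Longrightarrow> s < 1 \<Longrightarrow> norm (\<Phi> (of_real s * \<gamma>)) < 1"
proof -
  have zero: "0 \<notin> \<Gamma>" using origin on_arc[of 0] by auto
  obtain \<gamma> where \<gamma>: "\<gamma> \<in> \<Gamma>" "\<And>s. 0 \<le> s \<Longrightarrow> s < 1 \<Longrightarrow> of_real s * \<gamma> \<notin> \<Gamma>"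
  proof -
    obtain \<delta> where \<delta>: "\<delta> \<in> \<Gamma>" using arc_nonempty by blast
    show ?thesis
    proof (cases "\<exists>t. 0 \<le> t \<and> t < 1 \<and> of_real t * \<delta> \<in> \<Gamma>")
      case False
      then show ?thesis using that[of \<delta>] \<delta> by blast
    next
      case True
      then obtain t where t: "0 \<le> t" "t < 1" "of_real t * \<delta> \<in> \<Gamma>" by blast
      have t0: "t \<noteq> 0" "\<delta> \<noteq> 0" using t zero \<delta> by auto
      show ?thesis
      proof (rule that[of "of_real t * \<delta>"])
        fix s :: real assume s: "0 \<le> s" "s < 1"
        show "of_real s * (of_real t * \<delta>) \<notin> \<Gamma>"
        proof
          assume in_arc: "of_real s * (of_real t * \<delta>) \<in> \<Gamma>"
          have "collinear {\<delta>, of_real t * \<delta>, of_real s * (of_real t * \<delta>)}"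
            unfolding collinear_alt
            by (rule exI[of _ 0], rule exI[of _ \<delta>])
               (auto simp: scaleR_conv_of_real intro: exI[of _ 1] exI[of _ t] exI[of _ "s * t"])
          from strictly_convex_arc_no_three_collinear[OF strict \<delta> t(3) in_arc this]
          moreover have "s * t < 1 * 1" using s t t0 by (intro mult_strict_mono) auto
          ultimately show False
            using s t t0 by (auto simp: mult.assoc[symmetric] simp flip: of_real_mult)
        qed
      qed (rule t(3))
    qed
  qed
  obtain g where g: "arc g" "path_image g = \<Gamma>" using arc unfolding nontrivial_arc_def by blast
  have "connected \<Gamma>" using g by (metis arc_imp_path connected_path_image)
  moreover have "\<Gamma> \<noteq> {x}" for x
  proof
    assume "\<Gamma> = {x}"
    then have "g 0 = g 1"
      using g(2) pathstart_in_path_image[of g] pathfinish_in_path_image[of g]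
      by (auto simp: pathstart_def pathfinish_def)
    then show False using g(1) by (auto simp: arc_def dest: inj_onD)
  qed
  ultimately have "\<gamma> islimpt \<Gamma>" using \<gamma>(1) by (intro connected_imp_perfect)
  moreover have "norm (\<Phi> (of_real s * \<gamma>)) < 1" if "0 \<le> s" "s < 1" for s
  proof (rule off_arc[OF _ \<gamma>(2)[OF that]])
    have "(1 - s) *\<^sub>R 0 + s *\<^sub>R \<gamma> \<in> convex hull (\<Gamma> \<union> {0})"
      using that \<gamma>(1) by (intro convexD[OF convex_convex_hull]) (auto simp: hull_inc)
    then show "of_real s * \<gamma> \<in> convex hull (\<Gamma> \<union> {0})" by (simp add: scaleR_conv_of_real)
  qed
  ultimately show ?thesis using that \<gamma>(1) by blast
qed

lemma expanding_near:
  assumes "open U" "z \<in> \<Gamma>" "z \<in> U"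
  obtains w where "w \<in> U" "norm (\<Phi> w) > 1"
proof -
  have "\<not> (\<forall>w\<in>U. norm (\<Phi> w) \<le> norm (\<Phi> z))"
    using maximum_modulus_principle[of \<Phi> UNIV U z] assms entire nonconstant by (auto simp: entire_def)
  then show ?thesis using that on_arc[OF assms(2)] by force
qed

end

section \<open>Families of exponential sums\<close>

text \<open>Locally uniform convergence to \<open>0\<close> as \<open>q\<close> tends to infinity.\<close>

definition vanishing :: "(nat \<Rightarrow> cfun) \<Rightarrow> bool" where
  "vanishing u \<longleftrightarrow> (\<forall>R. \<forall>e>0. \<forall>\<^sub>F q in sequentially. small_on R e (u q))"

lemma vanishingD:
  "vanishing u \<Longrightarrow> e > 0 \<Longrightarrow> \<forall>\<^sub>F q in sequentially. small_on R e (u q)"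
  by (simp add: vanishing_def)

lemma vanishing_0: "vanishing (\<lambda>q z. 0)"
  by (simp add: vanishing_def)

lemma vanishing_add:
  assumes "vanishing u" "vanishing v"
  shows "vanishing (\<lambda>q z. u q z + v q z)"
  unfolding vanishing_def
proof (intro allI impI)
  fix R e :: real assume "e > 0"
  then have e: "e / 2 > 0" by simp
  show "\<forall>\<^sub>F q in sequentially. \<forall>z. norm z \<le> R \<longrightarrow> norm (u q z + v q z) < e"
    using vanishingD[OF assms(1) e, of R] vanishingD[OF assms(2) e, of R]
  proof eventually_elim
    case (elim q)
    show ?case
    proof (intro allI impI)
      fix z :: complex assume "norm z \<le> R"
      with elim have "norm (u q z) < e / 2" "norm (v q z) < e / 2" by auto
      then show "norm (u q z + v q z) < e" using norm_triangle_ineq[of "u q z" "v q z"] by linarith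
    qed
  qed
qed

lemma vanishing_exp:
  assumes "a \<longlonglongrightarrow> 0"
  shows "vanishing (\<lambda>q z. a q * exp (\<mu> * z))"
  unfolding vanishing_def
proof (intro allI impI)
  fix R e :: real assume "e > 0"
  obtain B where B: "B \<ge> 1" "\<And>z. norm z \<le> R \<Longrightarrow> norm (exp (\<mu> * z)) \<le> B"
    using entire_bounded_on_cball[OF entire_exp[of \<mu>]] by blast
  have "e / B > 0" using \<open>e > 0\<close> B(1) by simp
  then have "\<forall>\<^sub>F q in sequentially. norm (a q) < e / B"
    using assms unfolding tendsto_iff by simp
  then show "\<forall>\<^sub>F q in sequentially. \<forall>z. norm z \<le> R \<longrightarrow> norm (a q * exp (\<mu> * z)) < e"
  proof eventually_elim
    case (elim q)
    show ?case
    proof (intro allI impI)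
      fix z :: complex assume "norm z \<le> R"
      then have "norm (a q * exp (\<mu> * z)) \<le> norm (a q) * B"
        unfolding norm_mult by (intro mult_left_mono B(2)) auto
      also have "\<dots> < e" using elim B(1) by (simp add: pos_less_divide_eq)
      finally show "norm (a q * exp (\<mu> * z)) < e" .
    qed
  qed
qed

text \<open>The families \<open>u\<^sub>q(z) = \<Sum> a(q) e\<^sup>\<mu>\<^sup>z\<close> with finitely many frequencies \<open>\<mu>\<close> that do not depend on \<open>q\<close>. The
  predicate \<open>P\<close> constrains each pair of a coefficient sequence \<open>a\<close> and its frequency \<open>\<mu>\<close>, so that the
  growth of \<open>T\<^sup>q u\<^sub>q\<close> can be read off term by term.\<close>

inductive exp_family :: "((nat \<Rightarrow> complex) \<Rightarrow> complex \<Rightarrow> bool) \<Rightarrow> (nat \<Rightarrow> cfun) \<Rightarrow> bool"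
  for P where
  zero: "exp_family P (\<lambda>q z. 0)"
| step: "P a \<mu> \<Longrightarrow> exp_family P u \<Longrightarrow> exp_family P (\<lambda>q z. a q * exp (\<mu> * z) + u q z)"

lemma exp_family_mono:
  assumes "exp_family P u" "\<And>a \<mu>. P a \<mu> \<Longrightarrow> Q a \<mu>"
  shows "exp_family Q u"
  using assms(1) by induction (auto intro: exp_family.intros assms(2))

lemma exp_family_atom: "P a \<mu> \<Longrightarrow> exp_family P (\<lambda>q z. a q * exp (\<mu> * z))"
  using exp_family.step[OF _ exp_family.zero, of P a \<mu>] by simp

lemma exp_family_add:
  assumes "exp_family P u" "exp_family P v"
  shows "exp_family P (\<lambda>q z. u q z + v q z)"
  using assms(1)
proof induction
  case (step a \<mu> u)
  then show ?case
    using exp_family.step[OF step(1) step.IH] by (simp add: add.assoc)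
qed (use assms(2) in simp)

lemma exp_family_sum:
  "finite I \<Longrightarrow> (\<And>i. i \<in> I \<Longrightarrow> exp_family P (u i)) \<Longrightarrow> exp_family P (\<lambda>q z. \<Sum>i\<in>I. u i q z)"
  by (induction I rule: finite_induct) (simp_all add: exp_family.zero exp_family_add)

lemma exp_family_mult:
  assumes u: "exp_family P u" and v: "exp_family Q v"
    and PQ: "\<And>a b \<mu> \<nu>. P a \<mu> \<Longrightarrow> Q b \<nu> \<Longrightarrow> S (\<lambda>q. a q * b q) (\<mu> + \<nu>)"
  shows "exp_family S (\<lambda>q z. u q z * v q z)"
  using u
proof induction
  case zero
  then show ?case by (simp add: exp_family.zero)
next
  case (step a \<mu> u)
  have "exp_family S (\<lambda>q z. (a q * exp (\<mu> * z)) * v q z)"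
    using v
  proof induction
    case zero
    then show ?case by (simp add: exp_family.zero)
  next
    case (step b \<nu> v)
    have "(a q * exp (\<mu> * z)) * (b q * exp (\<nu> * z) + v q z) =
      (a q * b q) * exp ((\<mu> + \<nu>) * z) + (a q * exp (\<mu> * z)) * v q z" for q z
      by (simp add: distrib_left distrib_right exp_add mult_ac)
    then show ?case
      using exp_family.step[of S, OF PQ[OF \<open>P a \<mu>\<close> step(1)] step.IH] by simp
  qed
  from exp_family_add[OF this step.IH] show ?case by (simp add: distrib_right)
qed

lemma exp_family_entire: "exp_family P u \<Longrightarrow> u q \<in> entire"
  by (induction rule: exp_family.induct) (auto intro!: entire_intros)

lemma exp_family_vanishing:
  assumes "exp_family P u" "\<And>a \<mu>. P a \<mu> \<Longrightarrow> a \<longlonglongrightarrow> 0"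
  shows "vanishing u"
  using assms(1)
proof induction
  case (step a \<mu> u)
  show ?case by (rule vanishing_add[OF vanishing_exp[OF assms(2)[OF step(1)]] step.IH])
qed (rule vanishing_0)

text \<open>Applying the \<open>q\<close>-th power of \<open>\<Phi>(D)\<close> to the \<open>q\<close>-th member only multiplies the coefficient sequences
  by \<open>\<Phi>(\<mu>)\<^sup>q\<close>.\<close>

lemma exp_family_conv_op:
  assumes "exponential_type \<Phi>" and "exp_family P u"
    and Q: "\<And>a \<mu>. P a \<mu> \<Longrightarrow> Q (\<lambda>q. a q * \<Phi> \<mu> ^ q) \<mu>"
  shows "exp_family Q (\<lambda>q. (conv_op \<Phi> ^^ q) (u q))"
  using assms(2)
proof induction
  note T = local_operator_funpow[OF exponential_type_local_operator[OF assms(1)]]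
  case zero
  then show ?case using local_operator_zero[OF T] by (simp add: exp_family.zero)
next
  note T = local_operator_funpow[OF exponential_type_local_operator[OF assms(1)]]
  case (step a \<mu> u)
  have "(conv_op \<Phi> ^^ q) (\<lambda>z. a q * exp (\<mu> * z) + u q z)
      = (\<lambda>z. (a q * \<Phi> \<mu> ^ q) * exp (\<mu> * z) + (conv_op \<Phi> ^^ q) (u q) z)" for q
    using local_operator_add[OF T entire_mult[OF entire_const entire_exp] exp_family_entire[OF step(2)], of q "a q" \<mu> q]
      local_operator_scale[OF T entire_exp, of q "a q" \<mu>]
    by (simp add: conv_op_funpow_exp[OF assms(1)] mult.assoc)
  then show ?case
    using exp_family.step[of Q, OF Q[OF step(1)] step.IH] by simp
qed

text \<open>The frequency is a multiple \<open>s b\<close> with \<open>s \<in> D\<close>, up to an error that grows with the number \<open>k\<close> of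
  factors; under products both \<open>s\<close> and \<open>k\<close> add up.\<close>

definition near_multiples :: "complex \<Rightarrow> real \<Rightarrow> nat set \<Rightarrow> nat \<Rightarrow> (nat \<Rightarrow> complex) \<Rightarrow> complex \<Rightarrow> bool" where
  "near_multiples b \<delta> D k a \<mu> \<longleftrightarrow> Bseq a \<and> (\<exists>s\<in>D. norm (\<mu> - of_nat s * b) \<le> real k * \<delta>)"

lemma near_multiples_mult:
  assumes "near_multiples b \<delta> D k a \<mu>" "near_multiples b \<delta> D' k' a' \<mu>'"
    and D: "\<And>s s'. s \<in> D \<Longrightarrow> s' \<in> D' \<Longrightarrow> s + s' \<in> D''"
  shows "near_multiples b \<delta> D'' (k + k') (\<lambda>q. a q * a' q) (\<mu> + \<mu>')"
proof -
  obtain s s' where s: "s \<in> D" "norm (\<mu> - of_nat s * b) \<le> real k * \<delta>"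
    "s' \<in> D'" "norm (\<mu>' - of_nat s' * b) \<le> real k' * \<delta>"
    using assms(1,2) unfolding near_multiples_def by blast
  have "norm ((\<mu> + \<mu>') - of_nat (s + s') * b) \<le> real (k + k') * \<delta>"
    using norm_triangle_ineq[of "\<mu> - of_nat s * b" "\<mu>' - of_nat s' * b"] s
    by (simp add: algebra_simps)
  moreover have "Bseq (\<lambda>q. a q * a' q)"
    using assms(1,2) unfolding near_multiples_def by (intro Bseq_mult) simp_all
  ultimately show ?thesis
    unfolding near_multiples_def by (intro conjI bexI[of _ "s + s'"] D s)
qed

text \<open>The family \<open>t\<close> is the part of \<open>u\<close> of top weight \<open>d\<close>: the terms of \<open>u - t\<close> have frequencies near strictly
  smaller multiples of \<open>b\<close>.\<close>

definition leading :: "complex \<Rightarrow> real \<Rightarrow> nat \<Rightarrow> nat \<Rightarrow> (nat \<Rightarrow> cfun) \<Rightarrow> (nat \<Rightarrow> cfun) \<Rightarrow> bool" where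
  "leading b \<delta> d k u t \<longleftrightarrow> exp_family (near_multiples b \<delta> {..d} k) t \<and>
     exp_family (near_multiples b \<delta> {..<d} k) (\<lambda>q z. u q z - t q z)"

lemma leading_1: "leading b \<delta> 0 0 (\<lambda>q z. 1) (\<lambda>q z. 1)"
  unfolding leading_def
  using exp_family_atom[of "near_multiples b \<delta> {..0} 0" "\<lambda>_. 1" 0]
  by (simp add: exp_family.zero near_multiples_def)

text \<open>As for leading terms of polynomials:
  \<open>u u' - t t' = t (u' - t') + (u - t) t' + (u - t) (u' - t')\<close>, where each summand has a factor of lower
  weight.\<close>

lemma leading_mult:
  assumes "leading b \<delta> d k u t" "leading b \<delta> d' k' u' t'"
  shows "leading b \<delta> (d + d') (k + k') (\<lambda>q z. u q z * u' q z) (\<lambda>q z. t q z * t' q z)"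
proof -
  let ?P = "near_multiples b \<delta>"
  have t: "exp_family (?P {..d} k) t" "exp_family (?P {..<d} k) (\<lambda>q z. u q z - t q z)"
    "exp_family (?P {..d'} k') t'" "exp_family (?P {..<d'} k') (\<lambda>q z. u' q z - t' q z)"
    using assms unfolding leading_def by auto
  have "exp_family (?P {..d + d'} (k + k')) (\<lambda>q z. t q z * t' q z)"
    by (rule exp_family_mult[OF t(1,3)]) (auto intro: near_multiples_mult)
  moreover have "exp_family (?P {..<d + d'} (k + k'))
      (\<lambda>q z. t q z * (u' q z - t' q z) + ((u q z - t q z) * t' q z + (u q z - t q z) * (u' q z - t' q z)))"
    by (intro exp_family_add exp_family_mult[OF t(1,4)] exp_family_mult[OF t(2,3)] exp_family_mult[OF t(2,4)])
       (erule (1) near_multiples_mult, simp)+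
  ultimately show ?thesis
    unfolding leading_def by (simp add: algebra_simps)
qed

lemma leading_power:
  "leading b \<delta> d k u t \<Longrightarrow> leading b \<delta> (n * d) (n * k) (\<lambda>q z. u q z ^ n) (\<lambda>q z. t q z ^ n)"
  by (induction n) (simp_all add: leading_1 leading_mult)

lemma leading_prod:
  "finite I \<Longrightarrow> (\<And>i. i \<in> I \<Longrightarrow> leading b \<delta> (d i) (k i) (u i) (t i))
    \<Longrightarrow> leading b \<delta> (\<Sum>i\<in>I. d i) (\<Sum>i\<in>I. k i) (\<lambda>q z. \<Prod>i\<in>I. u i q z) (\<lambda>q z. \<Prod>i\<in>I. t i q z)"
  by (induction I rule: finite_induct) (simp_all add: leading_1 leading_mult)

lemma bounded_times_null:
  fixes a :: "nat \<Rightarrow> complex"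
  assumes "Bseq a" "norm c < 1"
  shows "(\<lambda>q. a q * c ^ q) \<longlonglongrightarrow> 0"
proof -
  obtain B where B: "\<And>q. norm (a q) \<le> B" using assms(1) by (auto simp: Bseq_def)
  have null: "(\<lambda>q. c ^ q) \<longlonglongrightarrow> 0" using assms(2) by (rule LIMSEQ_power_zero)
  have "norm (a q * c ^ q) \<le> norm (c ^ q) * B" for q
    unfolding norm_mult by (subst mult.commute) (intro mult_left_mono B norm_ge_zero)
  then show ?thesis
    by (intro tendsto_0_le[OF null always_eventually] allI)
qed

lemma finite_uniform_radius:
  fixes c :: "'a \<Rightarrow> complex"
  assumes "finite S" "\<And>s. s \<in> S \<Longrightarrow> \<exists>d>0. \<forall>w. dist w (c s) < d \<longrightarrow> Q s w"
  shows "\<exists>d>0. \<forall>s\<in>S. \<forall>w. dist w (c s) < d \<longrightarrow> Q s w"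
  using assms
proof (induction S rule: finite_induct)
  case empty
  then show ?case by (auto intro: exI[of _ 1])
next
  case (insert s S)
  obtain d where "d > 0" "\<forall>s\<in>S. \<forall>w. dist w (c s) < d \<longrightarrow> Q s w"
    using insert by blast
  moreover obtain d' where "d' > 0" "\<forall>w. dist w (c s) < d' \<longrightarrow> Q s w"
    using insert by blast
  ultimately show ?case by (intro exI[of _ "min d d'"]) auto
qed

lemma exp_frequency_continuous:
  fixes c \<kappa> :: complex
  assumes "e > 0"
  shows "\<exists>d>0. \<forall>w. dist w \<kappa> < d \<longrightarrow> close_on R e (\<lambda>z. c * exp (w * z)) (\<lambda>z. c * exp (\<kappa> * z))"
proof -
  obtain B where B: "B \<ge> 1" "\<And>z. norm z \<le> R \<Longrightarrow> norm (c * exp (\<kappa> * z)) \<le> B"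
    using entire_bounded_on_cball[OF entire_mult[OF entire_const[of c] entire_exp[of \<kappa>]]] by blast
  have "isCont exp (0::complex)" by simp
  moreover have "e / B > 0" using assms B(1) by simp
  ultimately obtain d where d: "d > 0" "\<And>x::complex. norm x < d \<Longrightarrow> norm (exp x - 1) < e / B"
    unfolding continuous_at_eps_delta by (auto simp: dist_norm)
  show ?thesis
  proof (intro exI[of _ "d / (\<bar>R\<bar> + 1)"] conjI allI impI)
    show "d / (\<bar>R\<bar> + 1) > 0" using d(1) by simp
    fix w z :: complex assume w: "dist w \<kappa> < d / (\<bar>R\<bar> + 1)" and z: "norm z \<le> R"
    have "norm ((w - \<kappa>) * z) \<le> norm (w - \<kappa>) * (\<bar>R\<bar> + 1)"
      unfolding norm_mult using z by (intro mult_left_mono) auto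
    also have "\<dots> < d" using w by (simp add: dist_norm pos_less_divide_eq)
    finally have *: "norm (exp ((w - \<kappa>) * z) - 1) < e / B" by (rule d(2))
    have "c * exp (w * z) - c * exp (\<kappa> * z) = (c * exp (\<kappa> * z)) * (exp ((w - \<kappa>) * z) - 1)"
      by (simp add: algebra_simps exp_add[symmetric])
    also have "norm \<dots> \<le> B * norm (exp ((w - \<kappa>) * z) - 1)"
      unfolding norm_mult[of "c * exp (\<kappa> * z)"] using B(2)[OF z] by (intro mult_right_mono) auto
    also have "\<dots> < B * (e / B)" using * B(1) by (intro mult_strict_left_mono) auto
    also have "\<dots> = e" using B(1) by simp
    finally show "norm (c * exp (w * z) - c * exp (\<kappa> * z)) < e" .
  qed
qed

definition monomial :: "nat \<Rightarrow> (nat \<Rightarrow> nat) \<Rightarrow> (nat \<Rightarrow> cfun) \<Rightarrow> complex \<Rightarrow> complex" where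
  "monomial N \<alpha> F = (\<lambda>z. \<Prod>i<N. F i z ^ \<alpha> i)"

lemma monomial_entire: "(\<And>i. i < N \<Longrightarrow> F i \<in> entire) \<Longrightarrow> monomial N \<alpha> F \<in> entire"
  unfolding monomial_def by (intro entire_intros) auto

section \<open>Expanding frequencies with contracting averages\<close>

context unimodular_arc
begin

lemma contracting_open:
  assumes lt: "norm (\<Phi> x) < 1"
  shows "\<exists>d>0. \<forall>w. dist w x < d \<longrightarrow> norm (\<Phi> w) < 1"
proof -
  have "continuous_on UNIV \<Phi>" using entire by (simp add: entire_def holomorphic_on_imp_continuous_on)
  then have "isCont (\<lambda>w. norm (\<Phi> w)) x"
    by (intro continuous_norm) (simp add: continuous_on_eq_continuous_at)
  from order_tendstoD(2)[OF this[unfolded isCont_def] lt]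
  obtain d where d: "d > 0" "\<forall>w. w \<noteq> x \<and> dist w x < d \<longrightarrow> norm (\<Phi> w) < 1"
    unfolding eventually_at by auto
  have "norm (\<Phi> w) < 1" if "dist w x < d" for w
    using lt d(2) that by (cases "w = x") auto
  then show ?thesis using d(1) by blast
qed

text \<open>First the target is approximated with frequencies \<open>\<kappa>\<close> on the arc itself, near \<open>\<gamma>\<close>; proper averages of
  these are contracted by \<open>average_in_disc\<close>. Then each \<open>\<kappa>\<close> is moved to \<open>k \<kappa>\<close> where \<open>|\<Phi>| > 1\<close>, so little
  that neither the approximation nor the finitely many inequalities for averages are lost.\<close>

lemma expanding_frequencies:
  assumes lim: "\<gamma> islimpt \<Gamma>" and "\<delta> > 0" "\<epsilon> > 0" and p: "p \<in> entire"
  obtains J :: "complex set" and k c :: "complex \<Rightarrow> complex" where "finite J"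
    "\<forall>\<kappa>\<in>J. norm (k \<kappa> - \<gamma>) < \<delta>" "\<forall>\<kappa>\<in>J. norm (\<Phi> (k \<kappa>)) > 1"
    "\<forall>g \<in> {..<m} \<rightarrow>\<^sub>E J. \<forall>l1<m. \<forall>l2<m. g l1 \<noteq> g l2 \<longrightarrow>
       norm (\<Phi> ((\<Sum>l<m. k (g l)) / of_nat m)) < 1"
    "close_on R \<epsilon> p (exp_sum J c k)"
proof -
  define S where "S = \<Gamma> \<inter> ball \<gamma> \<delta>"
  have S_lim: "\<gamma> islimpt S"
    unfolding islimpt_approachable
  proof (intro allI impI)
    fix e :: real assume "e > 0"
    then have "min e \<delta> > 0" using \<open>\<delta> > 0\<close> by simp
    with lim obtain x where "x \<in> \<Gamma>" "x \<noteq> \<gamma>" "dist x \<gamma> < min e \<delta>"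
      unfolding islimpt_approachable by metis
    then show "\<exists>x'\<in>S. x' \<noteq> \<gamma> \<and> dist x' \<gamma> < e"
      by (intro bexI[of _ x]) (auto simp: S_def dist_commute)
  qed
  have half: "\<epsilon> / 2 > 0" using \<open>\<epsilon> > 0\<close> by simp
  obtain J c where J: "finite J" "J \<subseteq> S"
    and c: "\<And>z. norm z \<le> R \<Longrightarrow> norm (p z - exp_sum J c (\<lambda>\<kappa>. \<kappa>) z) < \<epsilon> / 2"
    by (rule exponentials_dense[OF S_lim p half, where R = R]) blast
  define \<epsilon>' where "\<epsilon>' = \<epsilon> / (2 * (real (card J) + 1))"
  have "\<epsilon>' > 0" using \<open>\<epsilon> > 0\<close> by (simp add: \<epsilon>'_def)
  obtain d1 where d1: "d1 > 0" "\<forall>\<kappa>\<in>J. \<forall>w. dist w \<kappa> < d1 \<longrightarrow>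
      close_on R \<epsilon>' (\<lambda>z. c \<kappa> * exp (w * z)) (\<lambda>z. c \<kappa> * exp (\<kappa> * z))"
    using finite_uniform_radius[where c = "\<lambda>\<kappa>. \<kappa>" and Q = "\<lambda>\<kappa> w. close_on R \<epsilon>' (\<lambda>z. c \<kappa> * exp (w * z)) (\<lambda>z. c \<kappa> * exp (\<kappa> * z))", OF J(1) exp_frequency_continuous[OF \<open>\<epsilon>' > 0\<close>]]
    by blast
  obtain d2 where d2: "d2 > 0" "\<forall>\<kappa>\<in>J. \<forall>w. dist w \<kappa> < d2 \<longrightarrow> dist w \<gamma> < \<delta>"
  proof -
    have "\<exists>d>0. \<forall>w. dist w \<kappa> < d \<longrightarrow> dist w \<gamma> < \<delta>" if "\<kappa> \<in> J" for \<kappa>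
    proof (intro exI[of _ "\<delta> - dist \<kappa> \<gamma>"] conjI allI impI)
      show "\<delta> - dist \<kappa> \<gamma> > 0" using J that by (auto simp: S_def dist_commute)
      show "dist w \<kappa> < \<delta> - dist \<kappa> \<gamma> \<Longrightarrow> dist w \<gamma> < \<delta>" for w
        using dist_triangle[of w \<gamma> \<kappa>] by linarith
    qed
    from finite_uniform_radius[where c = "\<lambda>\<kappa>. \<kappa>" and Q = "\<lambda>_ w. dist w \<gamma> < \<delta>", OF J(1) this]
    show ?thesis using that by blast
  qed
  define \<G> where "\<G> = {g \<in> {..<m} \<rightarrow>\<^sub>E J. \<exists>l1<m. \<exists>l2<m. g l1 \<noteq> g l2}"
  have "finite \<G>" unfolding \<G>_def
    by (rule finite_subset[OF _ finite_PiE[of "{..<m}" "\<lambda>_. J"]]) (use J(1) in auto)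
  obtain d3 where d3: "d3 > 0" "\<forall>g\<in>\<G>. \<forall>w. dist w ((\<Sum>l<m. g l) / of_nat m) < d3 \<longrightarrow> norm (\<Phi> w) < 1"
  proof -
    have "\<exists>d>0. \<forall>w. dist w ((\<Sum>l<m. g l) / of_nat m) < d \<longrightarrow> norm (\<Phi> w) < 1" if g: "g \<in> \<G>" for g
    proof (rule contracting_open)
      obtain l1 l2 where "l1 < m" "l2 < m" "g l1 \<noteq> g l2" using g by (auto simp: \<G>_def)
      then show "norm (\<Phi> ((\<Sum>l<m. g l) / of_nat m)) < 1"
        using g J(2) by (intro average_in_disc[of m g l1 l2]) (auto simp: \<G>_def S_def PiE_iff)
    qed
    from finite_uniform_radius[where c = "\<lambda>g. (\<Sum>l<m. g l) / of_nat m"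
        and Q = "\<lambda>_ w. norm (\<Phi> w) < 1", OF \<open>finite \<G>\<close> this]
    show ?thesis using that by blast
  qed
  define d where "d = Min {d1, d2, d3}"
  have d: "d > 0" "d \<le> d1" "d \<le> d2" "d \<le> d3" using d1 d2 d3 by (auto simp: d_def)
  have "\<exists>w. dist w \<kappa> < d \<and> norm (\<Phi> w) > 1" if "\<kappa> \<in> J" for \<kappa>
  proof -
    have "\<kappa> \<in> \<Gamma>" using that J(2) by (auto simp: S_def)
    then obtain w where "w \<in> ball \<kappa> d" "norm (\<Phi> w) > 1"
      using expanding_near[of "ball \<kappa> d" \<kappa>] d(1) by auto
    then show ?thesis by (auto simp: dist_commute)
  qed
  then obtain k where k: "\<And>\<kappa>. \<kappa> \<in> J \<Longrightarrow> dist (k \<kappa>) \<kappa> < d" "\<And>\<kappa>. \<kappa> \<in> J \<Longrightarrow> norm (\<Phi> (k \<kappa>)) > 1"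
    by metis
  show ?thesis
  proof (rule that[of J k c])
    show "finite J" by fact
    show "\<forall>\<kappa>\<in>J. norm (k \<kappa> - \<gamma>) < \<delta>"
    proof
      fix \<kappa> assume "\<kappa> \<in> J"
      then show "norm (k \<kappa> - \<gamma>) < \<delta>"
        using d2(2) k(1)[of \<kappa>] d by (force simp: dist_norm)
    qed
    show "\<forall>\<kappa>\<in>J. norm (\<Phi> (k \<kappa>)) > 1" using k(2) by blast
  next
    show "\<forall>g \<in> {..<m} \<rightarrow>\<^sub>E J. \<forall>l1<m. \<forall>l2<m. g l1 \<noteq> g l2 \<longrightarrow>
       norm (\<Phi> ((\<Sum>l<m. k (g l)) / of_nat m)) < 1"
    proof (intro ballI allI impI)
      fix g l1 l2 assume g: "g \<in> {..<m} \<rightarrow>\<^sub>E J" "l1 < m" "l2 < m" "g l1 \<noteq> g l2"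
      then have "g \<in> \<G>" by (auto simp: \<G>_def)
      moreover have "dist ((\<Sum>l<m. k (g l)) / of_nat m) ((\<Sum>l<m. g l) / of_nat m) < d3"
      proof -
        have "(\<Sum>l<m. k (g l)) / of_nat m - (\<Sum>l<m. g l) / of_nat m = (\<Sum>l<m. k (g l) - g l) / of_nat m"
          by (simp add: sum_subtractf diff_divide_distrib)
        also have "norm \<dots> = norm (\<Sum>l<m. k (g l) - g l) / real m" by (simp add: norm_divide)
        also have "norm (\<Sum>l<m. k (g l) - g l) < (\<Sum>l<m. d)"
        proof (rule order.strict_trans1[OF norm_sum], rule sum_strict_mono)
          show "norm (k (g l) - g l) < d" if "l \<in> {..<m}" for l
            using k(1)[of "g l"] g(1) that by (auto simp: dist_norm PiE_iff)
        qed (use g in auto)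
        then have "norm (\<Sum>l<m. k (g l) - g l) / real m < d"
          using g(2) by (simp add: field_simps)
        finally show ?thesis using d(4) by (simp add: dist_norm)
      qed
      ultimately show "norm (\<Phi> ((\<Sum>l<m. k (g l)) / of_nat m)) < 1" using d3(2) by blast
    qed
  next
    show "close_on R \<epsilon> p (exp_sum J c k)"
    proof (intro allI impI)
      fix z :: complex assume z: "norm z \<le> R"
      have "norm (exp_sum J c k z - exp_sum J c (\<lambda>\<kappa>. \<kappa>) z) \<le> (\<Sum>\<kappa>\<in>J. \<epsilon>')"
        unfolding sum_subtractf[symmetric]
      proof (rule order.trans[OF norm_sum], rule sum_mono)
        fix \<kappa> assume "\<kappa> \<in> J"
        then show "norm (c \<kappa> * exp (k \<kappa> * z) - c \<kappa> * exp (\<kappa> * z)) \<le> \<epsilon>'"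
          using d1(2) k(1)[of \<kappa>] d(2) z by (meson less_imp_le order.strict_trans2)
      qed
      also have "\<dots> \<le> \<epsilon> / 2"
        using \<open>\<epsilon> > 0\<close> by (simp add: \<epsilon>'_def field_simps)
      finally show "norm (p z - exp_sum J c k z) < \<epsilon>"
        using c[OF z] norm_triangle_ineq4[of "p z - exp_sum J c (\<lambda>\<kappa>. \<kappa>) z"
          "exp_sum J c k z - exp_sum J c (\<lambda>\<kappa>. \<kappa>) z"]
        by simp
    qed
  qed
qed

end

lemma vanishing_sum:
  "finite I \<Longrightarrow> (\<And>i. i \<in> I \<Longrightarrow> vanishing (u i)) \<Longrightarrow> vanishing (\<lambda>q z. \<Sum>i\<in>I. u i q z)"
  by (induction I rule: finite_induct) (simp_all add: vanishing_0 vanishing_add)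

text \<open>Expanding the \<open>m\<close>-th power gives one term for each map \<open>g\<close> from the \<open>m\<close> factors to \<open>J\<close>, with frequency
  the average of the \<open>k (g l)\<close>. The coefficients \<open>a \<kappa> q = e \<kappa> / \<phi> \<kappa> ^ q\<close> are normalised by \<open>m\<close>-th roots
  so that the constant maps give exactly the terms \<open>c \<kappa> * exp (k \<kappa> * z)\<close>; for every other map the contraction
  at the average beats the coefficients. The factor \<open>D e\<^sup>\<tau>\<^sup>z\<close> stands for the contribution of the other
  generators to the monomial.\<close>

lemma power_of_exp_sum_escapes:
  fixes k c :: "complex \<Rightarrow> complex" and D \<tau> :: complex
  assumes \<Phi>: "exponential_type \<Phi>" and J: "finite J" and m: "m > 0" and D: "D \<noteq> 0"
    and expand: "\<And>\<kappa>. \<kappa> \<in> J \<Longrightarrow> norm (\<Phi> (k \<kappa>)) > 1"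
    and contract: "\<And>g l1 l2. g \<in> {..<m} \<rightarrow>\<^sub>E J \<Longrightarrow> l1 < m \<Longrightarrow> l2 < m \<Longrightarrow> g l1 \<noteq> g l2 \<Longrightarrow>
       norm (\<Phi> ((\<Sum>l<m. k (g l)) / of_nat m)) < 1"
  obtains a v where "\<forall>\<kappa>\<in>J. a \<kappa> \<longlonglongrightarrow> 0" "vanishing v"
    "\<forall>q z. (conv_op \<Phi> ^^ q) (\<lambda>z. D * exp (\<tau> * z) * (\<Sum>\<kappa>\<in>J. a \<kappa> q * exp ((k \<kappa> - \<tau>) / of_nat m * z)) ^ m) z
       = exp_sum J c k z + v q z"
proof -
  have root: "\<exists>w. w ^ m = x" for x :: complex
  proof -
    have "m \<noteq> 0" using m by simp
    then obtain w where "x = w ^ m" by (rule exists_complex_root)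
    then show ?thesis by auto
  qed
  have "\<exists>e. e ^ m = c \<kappa> / D" for \<kappa> by (rule root)
  then obtain e where e: "\<And>\<kappa>. e \<kappa> ^ m = c \<kappa> / D" by metis
  have "\<exists>\<phi>. \<phi> ^ m = \<Phi> (k \<kappa>)" for \<kappa> by (rule root)
  then obtain \<phi> where \<phi>: "\<And>\<kappa>. \<phi> \<kappa> ^ m = \<Phi> (k \<kappa>)" by metis
  have \<phi>1: "norm (\<phi> \<kappa>) > 1" if "\<kappa> \<in> J" for \<kappa>
  proof (rule ccontr)
    assume "\<not> norm (\<phi> \<kappa>) > 1"
    then have "norm (\<phi> \<kappa>) ^ m \<le> 1" by (intro power_le_one) auto
    then show False using expand[OF that] by (simp add: norm_power[symmetric] \<phi>)
  qed
  define a where "a = (\<lambda>\<kappa> q. e \<kappa> / \<phi> \<kappa> ^ q)"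
  define A where "A = (\<lambda>g q. D * (\<Prod>l<m. a (g l) q))"
  define \<mu> where "\<mu> = (\<lambda>g. (\<Sum>l<m. k (g l)) / of_nat m)"
  define \<G> where "\<G> = ({..<m} \<rightarrow>\<^sub>E J)"
  define const where "const = (\<lambda>\<kappa>. \<lambda>l\<in>{..<m}. \<kappa> :: complex)"
  have fin: "finite \<G>" using J by (auto simp: \<G>_def intro: finite_PiE)
  have a_null: "a \<kappa> \<longlonglongrightarrow> 0" if "\<kappa> \<in> J" for \<kappa>
  proof -
    have "(\<lambda>q. e \<kappa> * inverse (\<phi> \<kappa>) ^ q) \<longlonglongrightarrow> 0"
    proof (rule bounded_times_null)
      show "norm (inverse (\<phi> \<kappa>)) < 1" using \<phi>1[OF that] by (simp add: norm_inverse inverse_less_1_iff)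
    qed simp
    then show ?thesis by (simp add: a_def divide_inverse power_inverse)
  qed
  have expansion: "D * exp (\<tau> * z) * (\<Sum>\<kappa>\<in>J. a \<kappa> q * exp ((k \<kappa> - \<tau>) / of_nat m * z)) ^ m
      = (\<Sum>g\<in>\<G>. A g q * exp (\<mu> g * z))" for q z
  proof -
    have "(\<Sum>\<kappa>\<in>J. a \<kappa> q * exp ((k \<kappa> - \<tau>) / of_nat m * z)) ^ m
        = (\<Prod>l<m. \<Sum>\<kappa>\<in>J. a \<kappa> q * exp ((k \<kappa> - \<tau>) / of_nat m * z))" by simp
    also have "\<dots> = (\<Sum>g\<in>\<G>. \<Prod>l<m. a (g l) q * exp ((k (g l) - \<tau>) / of_nat m * z))"
      unfolding \<G>_def by (rule prod_sum_PiE) (use J in auto)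
    also have "\<dots> = (\<Sum>g\<in>\<G>. (\<Prod>l<m. a (g l) q) * exp ((\<mu> g - \<tau>) * z))"
    proof (intro sum.cong refl)
      fix g
      have "(\<Sum>l<m. (k (g l) - \<tau>) / of_nat m * z) = (\<Sum>l<m. k (g l) - \<tau>) / of_nat m * z"
        by (simp add: sum_distrib_right sum_divide_distrib)
      also have "\<dots> = (\<mu> g - \<tau>) * z"
        using m by (simp add: \<mu>_def sum_subtractf diff_divide_distrib)
      finally show "(\<Prod>l<m. a (g l) q * exp ((k (g l) - \<tau>) / of_nat m * z))
          = (\<Prod>l<m. a (g l) q) * exp ((\<mu> g - \<tau>) * z)"
        by (simp add: prod.distrib exp_sum[symmetric])
    qed
    finally have power: "(\<Sum>\<kappa>\<in>J. a \<kappa> q * exp ((k \<kappa> - \<tau>) / of_nat m * z)) ^ m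
        = (\<Sum>g\<in>\<G>. (\<Prod>l<m. a (g l) q) * exp ((\<mu> g - \<tau>) * z))" .
    show ?thesis
      unfolding A_def power sum_distrib_left
    proof (intro sum.cong refl)
      fix g
      have "exp (\<mu> g * z) = exp (\<tau> * z) * exp ((\<mu> g - \<tau>) * z)"
        by (simp add: exp_add[symmetric] algebra_simps)
      then show "D * exp (\<tau> * z) * ((\<Prod>l<m. a (g l) q) * exp ((\<mu> g - \<tau>) * z))
          = D * (\<Prod>l<m. a (g l) q) * exp (\<mu> g * z)" by simp
    qed
  qed
  have T: "local_operator (conv_op \<Phi> ^^ q)" for q
    by (intro local_operator_funpow exponential_type_local_operator \<Phi>)
  have image: "(conv_op \<Phi> ^^ q) (\<lambda>z. \<Sum>g\<in>\<G>. A g q * exp (\<mu> g * z))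
      = (\<lambda>z. \<Sum>g\<in>\<G>. A g q * \<Phi> (\<mu> g) ^ q * exp (\<mu> g * z))" for q
    using local_operator_sum[OF T fin entire_exp, of q "\<lambda>g. A g q" \<mu>]
    by (simp add: conv_op_funpow_exp[OF \<Phi>] mult.assoc)
  have const_in: "const ` J \<subseteq> \<G>" by (auto simp: const_def \<G>_def PiE_iff extensional_def split: if_splits)
  have inj: "inj_on const J"
    by (rule inj_onI) (use m in \<open>auto simp: const_def fun_eq_iff restrict_def split: if_splits\<close>)
  define v where "v = (\<lambda>q z. \<Sum>g\<in>\<G> - const ` J. (A g q * \<Phi> (\<mu> g) ^ q) * exp (\<mu> g * z))"
  have diagonal: "A (const \<kappa>) q * \<Phi> (\<mu> (const \<kappa>)) ^ q * exp (\<mu> (const \<kappa>) * z) = c \<kappa> * exp (k \<kappa> * z)"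
    if "\<kappa> \<in> J" for \<kappa> q z
  proof -
    have "\<mu> (const \<kappa>) = k \<kappa>" using m by (simp add: \<mu>_def const_def)
    moreover have "A (const \<kappa>) q = D * (e \<kappa> ^ m / (\<phi> \<kappa> ^ m) ^ q)"
      by (simp add: A_def const_def a_def power_divide power_mult[symmetric] mult.commute)
    moreover have "\<Phi> (k \<kappa>) \<noteq> 0" using expand[OF that] by auto
    ultimately show ?thesis using D by (simp add: e \<phi>)
  qed
  have "vanishing v"
    unfolding v_def
  proof (intro vanishing_sum vanishing_exp)
    show "finite (\<G> - const ` J)" using fin by simp
    fix g assume g: "g \<in> \<G> - const ` J"
    have "\<exists>l1<m. \<exists>l2<m. g l1 \<noteq> g l2"
    proof (rule ccontr)
      assume "\<not> ?thesis"
      then have eq: "g l = g 0" if "l < m" for l using m that by blast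
      have "g l = const (g 0) l" for l
      proof (cases "l < m")
        case True
        then show ?thesis using eq[OF True] by (simp add: const_def)
      next
        case False
        then show ?thesis using g by (simp add: const_def \<G>_def PiE_iff extensional_def)
      qed
      then have "g = const (g 0)" by (rule ext)
      moreover have "g 0 \<in> J" using g m by (auto simp: \<G>_def PiE_iff)
      ultimately show False using g by blast
    qed
    then have small: "norm (\<Phi> (\<mu> g)) < 1"
      using contract[of g] g by (auto simp: \<G>_def \<mu>_def)
    have P1: "norm (\<Prod>l<m. \<phi> (g l)) \<ge> 1"
      unfolding prod_norm[symmetric]
      using g \<phi>1 by (intro prod_ge_1) (force simp: \<G>_def PiE_iff)
    have "(\<lambda>q. (D * (\<Prod>l<m. e (g l))) * (\<Phi> (\<mu> g) / (\<Prod>l<m. \<phi> (g l))) ^ q) \<longlonglongrightarrow> 0"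
    proof (rule bounded_times_null)
      have "norm (\<Phi> (\<mu> g)) < norm (\<Prod>l<m. \<phi> (g l))" using small P1 by linarith
      then show "norm (\<Phi> (\<mu> g) / (\<Prod>l<m. \<phi> (g l))) < 1"
        unfolding norm_divide by (subst divide_less_eq_1_pos) (use P1 in linarith)+
    qed simp
    then show "(\<lambda>q. A g q * \<Phi> (\<mu> g) ^ q) \<longlonglongrightarrow> 0"
      by (simp add: A_def a_def prod_dividef power_divide prod_power_distrib mult.assoc)
  qed
  moreover have "(\<Sum>g\<in>\<G>. A g q * \<Phi> (\<mu> g) ^ q * exp (\<mu> g * z)) = exp_sum J c k z + v q z" for q z
  proof -
    have "(\<Sum>g\<in>\<G>. A g q * \<Phi> (\<mu> g) ^ q * exp (\<mu> g * z))
      = (\<Sum>g\<in>const ` J. A g q * \<Phi> (\<mu> g) ^ q * exp (\<mu> g * z)) + v q z"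
      unfolding v_def using sum.subset_diff[OF const_in fin] by (simp add: add.commute)
    also have "(\<Sum>g\<in>const ` J. A g q * \<Phi> (\<mu> g) ^ q * exp (\<mu> g * z)) = exp_sum J c k z"
      unfolding sum.reindex[OF inj] comp_def by (intro sum.cong refl diagonal)
    finally show ?thesis .
  qed
  ultimately show ?thesis
    using a_null by (intro that[of a v] ballI allI) (simp_all only: expansion image)
qed

section \<open>Simultaneous transitivity of monomials\<close>

lemma near_multiples_mono:
  "near_multiples b \<delta> D k a \<mu> \<Longrightarrow> D \<subseteq> D' \<Longrightarrow> near_multiples b \<delta> D' k a \<mu>"
  unfolding near_multiples_def by blast

context unimodular_arc
begin

text \<open>The perturbation described at the beginning. The frequencies of the perturbing terms are near
  \<open>w i \<cdot> b\<close> with \<open>b = \<gamma> / W\<close>, where \<open>W\<close> is the weight of \<open>\<beta>\<close>, and those of the approximations to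
  the \<open>F i\<close> are near \<open>0\<close>, a multiple of \<open>b\<close> by less than \<open>w i\<close>. So monomials of weight below \<open>W\<close>, and everything in \<open>\<beta>\<close>
  except its leading part, only involve frequencies near multiples \<open>s b\<close> with \<open>s < W\<close>, where \<open>|\<Phi>| < 1\<close>.\<close>

lemma simultaneous_transitivity:
  fixes F :: "nat \<Rightarrow> cfun" and w \<beta> :: "nat \<Rightarrow> nat"
  assumes \<Phi>: "exponential_type \<Phi>"
    and F: "\<And>i. F i \<in> entire"
    and w: "\<And>i. i < N \<Longrightarrow> w i > 0"
    and i0: "i0 < N" "\<beta> i0 > 0"
    and A: "finite A" "\<And>\<alpha>. \<alpha> \<in> A \<Longrightarrow> (\<Sum>i<N. \<alpha> i * w i) < (\<Sum>i<N. \<beta> i * w i)"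
    and "r > 0" "\<epsilon> > 0" and p: "p \<in> entire"
  obtains G q where "\<And>i. G i \<in> entire" "\<And>i z. norm z \<le> \<rho> \<Longrightarrow> norm (G i z - F i z) < r"
    "\<And>z. norm z \<le> R \<Longrightarrow> norm ((conv_op \<Phi> ^^ q) (monomial N \<beta> G) z - p z) < \<epsilon>"
    "\<And>\<alpha> z. \<alpha> \<in> A \<Longrightarrow> norm z \<le> R \<Longrightarrow> norm ((conv_op \<Phi> ^^ q) (monomial N \<alpha> G) z) < \<epsilon>"
proof -
  let ?T = "\<lambda>q. conv_op \<Phi> ^^ q"
  obtain \<gamma> where \<gamma>: "\<gamma> islimpt \<Gamma>" "\<And>s. 0 \<le> s \<Longrightarrow> s < 1 \<Longrightarrow> norm (\<Phi> (of_real s * \<gamma>)) < 1"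
    by (rule base_point) blast
  define W where "W = (\<Sum>i<N. \<beta> i * w i)"
  define b where "b = \<gamma> / of_nat W"
  have "\<beta> i0 * w i0 \<le> W" unfolding W_def using i0(1) by (intro member_le_sum) auto
  moreover have "\<beta> i0 * w i0 > 0" using i0 w by simp
  ultimately have W: "W > 0" by linarith
  then have Wb: "of_nat W * b = \<gamma>" by (simp add: b_def)
  have "norm (\<Phi> (of_nat s * b)) < 1" if "s < W" for s
  proof -
    have "of_nat s * b = of_real (real s / real W) * \<gamma>" by (simp add: b_def)
    then show ?thesis using \<gamma>(2)[of "real s / real W"] that by simp
  qed
  then have "\<exists>d>0. \<forall>s\<in>{..<W}. \<forall>\<mu>. dist \<mu> (of_nat s * b) < d \<longrightarrow> norm (\<Phi> \<mu>) < 1"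
    by (intro finite_uniform_radius contracting_open) auto
  then obtain \<delta>0 where \<delta>0: "\<delta>0 > 0"
    "\<And>s \<mu>. s < W \<Longrightarrow> dist \<mu> (of_nat s * b) < \<delta>0 \<Longrightarrow> norm (\<Phi> \<mu>) < 1" by auto
  \<comment> \<open>\<open>K\<close> bounds the number of factors in all the monomials, so errors \<open>\<delta>\<close> in the single frequencies add
    up to less than \<open>\<delta>0\<close>.\<close>
  define K where "K = (\<Sum>\<alpha>\<in>insert \<beta> A. \<Sum>i<N. \<alpha> i)"
  define \<delta> where "\<delta> = \<delta>0 / (real K + 1)"
  have \<delta>: "\<delta> > 0" using \<delta>0(1) by (simp add: \<delta>_def)
  let ?near = "near_multiples b \<delta>"
  have K: "(\<Sum>i<N. \<alpha> i) \<le> K" if "\<alpha> \<in> insert \<beta> A" for \<alpha>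
    unfolding K_def using that A(1) by (intro member_le_sum) auto
  have decay: "(\<lambda>q. a q * \<Phi> \<mu> ^ q) \<longlonglongrightarrow> 0" if P: "?near {..<W} j a \<mu>" and j: "j \<le> K" for j a \<mu>
  proof -
    obtain s where s: "s < W" "norm (\<mu> - of_nat s * b) \<le> real j * \<delta>"
      using P by (auto simp: near_multiples_def)
    have "real j * \<delta> \<le> real K * \<delta>" using j \<delta> by (intro mult_right_mono) auto
    also have "\<dots> < \<delta>0" using \<delta>0(1) by (simp add: \<delta>_def field_simps)
    finally have "norm (\<Phi> \<mu>) < 1" using s by (intro \<delta>0(2)[of s]) (auto simp: dist_norm)
    then show ?thesis using P by (intro bounded_times_null) (auto simp: near_multiples_def)
  qed
  \<comment> \<open>\<open>\<tau>\<close> is the frequency that the generators other than \<open>i0\<close> contribute to the leading part of \<open>\<beta>\<close>. By the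
    choice of \<open>b\<close> the frequencies \<open>(k \<kappa> - \<tau>) / m\<close> are near \<open>w i0 \<cdot> b\<close> when \<open>k \<kappa>\<close> is near \<open>\<gamma>\<close>.\<close>
  define m where "m = \<beta> i0"
  define \<tau> where "\<tau> = (\<Sum>i\<in>{..<N} - {i0}. of_nat (\<beta> i * w i) * b)"
  have \<tau>: "\<tau> + of_nat m * (of_nat (w i0) * b) = \<gamma>"
  proof -
    have "\<gamma> = (\<Sum>i<N. of_nat (\<beta> i * w i) * b)"
      unfolding Wb[symmetric] by (simp add: W_def sum_distrib_right)
    also have "\<dots> = of_nat (\<beta> i0 * w i0) * b + \<tau>"
      unfolding \<tau>_def using i0(1) by (intro sum.remove) auto
    finally show ?thesis by (simp add: m_def mult.assoc)
  qed
  have r2: "r / 2 > 0" using \<open>r > 0\<close> by simp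
  have "\<exists>g. exp_family (?near {0} 1) (\<lambda>q. g) \<and> close_on \<rho> (r / 2) (F i) g" for i
  proof -
    have "(0::complex) islimpt ball 0 \<delta>" using \<delta> by (intro interior_limit_point) auto
    then obtain J c where J: "finite J" "J \<subseteq> ball 0 \<delta>"
      "\<And>z. norm z \<le> \<rho> \<Longrightarrow> norm (F i z - exp_sum J c (\<lambda>\<kappa>. \<kappa>) z) < r / 2"
      by (rule exponentials_dense[OF _ F[of i] r2, where R = \<rho>]) blast
    have "exp_family (?near {0} 1) (\<lambda>q z. exp_sum J c (\<lambda>\<kappa>. \<kappa>) z)"
    proof (intro exp_family_sum J(1))
      fix \<kappa> assume "\<kappa> \<in> J"
      then have "?near {0} 1 (\<lambda>_. c \<kappa>) \<kappa>"
        using J(2) by (auto simp: near_multiples_def less_imp_le)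
      from exp_family_atom[of "?near {0} 1", OF this]
      show "exp_family (?near {0} 1) (\<lambda>q z. c \<kappa> * exp (\<kappa> * z))" .
    qed
    then show ?thesis using J(3) by blast
  qed
  then obtain g where g: "\<And>i. exp_family (?near {0} 1) (\<lambda>q. g i)"
    "\<And>i z. norm z \<le> \<rho> \<Longrightarrow> norm (F i z - g i z) < r / 2" by metis
  have "\<exists>d. d \<noteq> 0 \<and> (\<forall>z. norm z \<le> \<rho> \<longrightarrow> norm (d * exp (of_nat (w i) * b * z)) < r / 2)" for i
  proof -
    obtain B where B: "B \<ge> 1" "\<And>z. norm z \<le> \<rho> \<Longrightarrow> norm (exp (of_nat (w i) * b * z)) \<le> B"
      using entire_bounded_on_cball[OF entire_exp[of "of_nat (w i) * b"]] by blast
    show ?thesis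
    proof (intro exI[of _ "of_real (r / (4 * B))"] conjI allI impI)
      show "complex_of_real (r / (4 * B)) \<noteq> 0" using B(1) \<open>r > 0\<close> by simp
      fix z :: complex assume "norm z \<le> \<rho>"
      from B(2)[OF this] have "norm (of_real (r / (4 * B)) * exp (of_nat (w i) * b * z)) \<le> r / (4 * B) * B"
        using B(1) \<open>r > 0\<close> unfolding norm_mult norm_of_real by (intro mult_mono) auto
      also have "\<dots> < r / 2" using B(1) \<open>r > 0\<close> by simp
      finally show "norm (of_real (r / (4 * B)) * exp (of_nat (w i) * b * z)) < r / 2" .
    qed
  qed
  then obtain d where d: "\<And>i. d i \<noteq> 0"
    "\<And>i z. norm z \<le> \<rho> \<Longrightarrow> norm (d i * exp (of_nat (w i) * b * z)) < r / 2" by metis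
  define D where "D = (\<Prod>i\<in>{..<N} - {i0}. d i ^ \<beta> i)"
  have D: "D \<noteq> 0" using d(1) by (simp add: D_def)
  have m: "m > 0" using i0 by (simp add: m_def)
  have half: "\<epsilon> / 2 > 0" using \<open>\<epsilon> > 0\<close> by simp
  obtain J :: "complex set" and k c :: "complex \<Rightarrow> complex" where J: "finite J"
    and k: "\<forall>\<kappa>\<in>J. norm (k \<kappa> - \<gamma>) < \<delta>" "\<forall>\<kappa>\<in>J. norm (\<Phi> (k \<kappa>)) > 1"
    and avg: "\<forall>g \<in> {..<m} \<rightarrow>\<^sub>E J. \<forall>l1<m. \<forall>l2<m. g l1 \<noteq> g l2 \<longrightarrow>
       norm (\<Phi> ((\<Sum>l<m. k (g l)) / of_nat m)) < 1"
    and target: "close_on R (\<epsilon> / 2) p (exp_sum J c k)"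
    by (rule expanding_frequencies[OF \<gamma>(1) \<delta> half p, where m = m and R = R])
  have avg': "norm (\<Phi> ((\<Sum>l<m. k (g l)) / of_nat m)) < 1"
    if "g \<in> {..<m} \<rightarrow>\<^sub>E J" "l1 < m" "l2 < m" "g l1 \<noteq> g l2" for g l1 l2
    using avg that by blast
  obtain a v where a: "\<forall>\<kappa>\<in>J. a \<kappa> \<longlonglongrightarrow> 0" and v: "vanishing v"
    and escape: "\<forall>q z. ?T q (\<lambda>z. D * exp (\<tau> * z) * (\<Sum>\<kappa>\<in>J. a \<kappa> q * exp ((k \<kappa> - \<tau>) / of_nat m * z)) ^ m) z
       = exp_sum J c k z + v q z"
    by (rule power_of_exp_sum_escapes[OF \<Phi> J m D bspec[OF k(2)] avg', where \<tau> = \<tau> and c = c])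
  define h where "h = (\<lambda>q z. \<Sum>\<kappa>\<in>J. a \<kappa> q * exp ((k \<kappa> - \<tau>) / of_nat m * z))"
  have h: "vanishing h"
    unfolding h_def by (intro vanishing_sum J vanishing_exp) (use a in blast)
  \<comment> \<open>Only the coefficients of generator \<open>i0\<close> depend on \<open>q\<close>; \<open>t i\<close> is the leading part of \<open>u i\<close>.\<close>
  define t where "t = (\<lambda>i. if i = i0 then h else (\<lambda>q z. d i * exp (of_nat (w i) * b * z)))"
  define u where "u = (\<lambda>i q z. g i z + t i q z)"
  have t_family: "exp_family (?near {..w i} 1) (t i)" for i
  proof (cases "i = i0")
    case True
    have "exp_family (?near {..w i0} 1) h"
      unfolding h_def
    proof (intro exp_family_sum J exp_family_atom)
      fix \<kappa> assume \<kappa>: "\<kappa> \<in> J"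
      have "(k \<kappa> - \<tau>) / of_nat m - of_nat (w i0) * b = (k \<kappa> - \<gamma>) / of_nat m"
        using m unfolding \<tau>[symmetric] by (simp add: field_simps)
      also have "norm \<dots> \<le> norm (k \<kappa> - \<gamma>) / 1"
        unfolding norm_divide using m by (intro divide_left_mono) auto
      also have "\<dots> \<le> \<delta>" using k(1) \<kappa> by (simp add: less_imp_le)
      finally show "?near {..w i0} 1 (a \<kappa>) ((k \<kappa> - \<tau>) / of_nat m)"
        using a \<kappa> unfolding near_multiples_def
        by (auto intro!: bexI[of _ "w i0"] convergent_imp_Bseq convergentI)
    qed
    then show ?thesis using True by (simp add: t_def)
  next
    case False
    have "?near {..w i} 1 (\<lambda>_. d i) (of_nat (w i) * b)"
      using \<delta> by (auto simp: near_multiples_def intro!: bexI[of _ "w i"])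
    from exp_family_atom[of "?near {..w i} 1", OF this] show ?thesis using False by (simp add: t_def)
  qed
  have lead: "leading b \<delta> (w i) 1 (u i) (t i)" if "i < N" for i
    unfolding leading_def
  proof
    have "exp_family (?near {..<w i} 1) (\<lambda>q. g i)"
      by (rule exp_family_mono[OF g(1)]) (use w[OF that] in \<open>auto simp: near_multiples_def intro!: bexI[of _ 0]\<close>)
    then show "exp_family (?near {..<w i} 1) (\<lambda>q z. u i q z - t i q z)"
      by (simp add: u_def)
  qed (rule t_family)
  have lead_monomial: "leading b \<delta> (\<Sum>i<N. \<alpha> i * w i) (\<Sum>i<N. \<alpha> i)
      (\<lambda>q. monomial N \<alpha> (\<lambda>i. u i q)) (\<lambda>q. monomial N \<alpha> (\<lambda>i. t i q))" for \<alpha>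
    unfolding monomial_def
    using leading_prod[of "{..<N}" b \<delta> "\<lambda>i. \<alpha> i * w i" "\<lambda>i. \<alpha> i * 1" "\<lambda>i q z. u i q z ^ \<alpha> i" "\<lambda>i q z. t i q z ^ \<alpha> i"]
      leading_power[OF lead] by simp
  have vanishing_low: "vanishing (\<lambda>q. ?T q (s q))"
    if "exp_family (?near {..<W} j) s" "j \<le> K" for s j
    using exp_family_vanishing[where P = "\<lambda>a \<mu>. a \<longlonglongrightarrow> 0"] decay[OF _ that(2)]
      exp_family_conv_op[OF \<Phi> that(1), where Q = "\<lambda>a \<mu>. a \<longlonglongrightarrow> 0"] by blast
  have A_vanishing: "vanishing (\<lambda>q. ?T q (monomial N \<alpha> (\<lambda>i. u i q)))" if "\<alpha> \<in> A" for \<alpha>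
  proof (rule vanishing_low)
    show "(\<Sum>i<N. \<alpha> i) \<le> K" using K that by blast
    let ?P = "?near {..<W} (\<Sum>i<N. \<alpha> i)"
    have "exp_family ?P (\<lambda>q. monomial N \<alpha> (\<lambda>i. t i q))"
      "exp_family ?P (\<lambda>q z. monomial N \<alpha> (\<lambda>i. u i q) z - monomial N \<alpha> (\<lambda>i. t i q) z)"
      using lead_monomial[of \<alpha>] A(2)[OF that] unfolding leading_def W_def[symmetric]
      by (auto elim!: exp_family_mono near_multiples_mono)
    from exp_family_add[OF this] show "exp_family ?P (\<lambda>q. monomial N \<alpha> (\<lambda>i. u i q))" by simp
  qed
  define s where "s = (\<lambda>q z. monomial N \<beta> (\<lambda>i. u i q) z - monomial N \<beta> (\<lambda>i. t i q) z)"
  have s_family: "exp_family (?near {..<W} (\<Sum>i<N. \<beta> i)) s"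
    using lead_monomial[of \<beta>] unfolding leading_def W_def s_def by simp
  then have s_vanishing: "vanishing (\<lambda>q. ?T q (s q))"
    by (rule vanishing_low) (use K in blast)
  have top: "monomial N \<beta> (\<lambda>i. t i q) = (\<lambda>z. D * exp (\<tau> * z) * h q z ^ m)" for q
  proof
    fix z
    have "monomial N \<beta> (\<lambda>i. t i q) z = h q z ^ m * (\<Prod>i\<in>{..<N} - {i0}. (d i * exp (of_nat (w i) * b * z)) ^ \<beta> i)"
      unfolding monomial_def using i0(1) by (subst prod.remove[of _ i0]) (auto simp: t_def m_def intro!: prod.cong)
    also have "(\<Prod>i\<in>{..<N} - {i0}. (d i * exp (of_nat (w i) * b * z)) ^ \<beta> i)
        = D * (\<Prod>i\<in>{..<N} - {i0}. exp (of_nat (\<beta> i * w i) * b * z))"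
      unfolding D_def prod.distrib[symmetric]
      by (intro prod.cong refl) (simp add: power_mult_distrib exp_of_nat_mult[symmetric] mult.assoc)
    also have "(\<Prod>i\<in>{..<N} - {i0}. exp (of_nat (\<beta> i * w i) * b * z)) = exp (\<tau> * z)"
      by (simp add: \<tau>_def sum_distrib_right exp_sum)
    finally show "monomial N \<beta> (\<lambda>i. t i q) z = D * exp (\<tau> * z) * h q z ^ m" by (simp add: mult_ac)
  qed
  have u_entire: "u i q \<in> entire" for i q
    unfolding u_def using exp_family_entire[OF g(1)] exp_family_entire[OF t_family] by (intro entire_add)
  have t_entire: "t i q \<in> entire" for i q by (rule exp_family_entire[OF t_family])
  have main: "?T q (monomial N \<beta> (\<lambda>i. u i q)) z
      = ?T q (s q) z + (exp_sum J c k z + v q z)" for q z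
  proof -
    have "?T q (\<lambda>z. s q z + monomial N \<beta> (\<lambda>i. t i q) z)
        = (\<lambda>z. ?T q (s q) z + ?T q (monomial N \<beta> (\<lambda>i. t i q)) z)"
      by (intro local_operator_add local_operator_funpow exponential_type_local_operator \<Phi>
            exp_family_entire[OF s_family] monomial_entire t_entire)
    moreover have "(\<lambda>z. s q z + monomial N \<beta> (\<lambda>i. t i q) z) = monomial N \<beta> (\<lambda>i. u i q)"
      by (simp add: s_def)
    ultimately show ?thesis using escape[rule_format, of q z] by (simp add: top h_def)
  qed
  have e4: "\<epsilon> / 4 > 0" using \<open>\<epsilon> > 0\<close> by simp
  have "\<forall>\<^sub>F q in sequentially. \<forall>\<alpha>\<in>A. small_on R \<epsilon> (?T q (monomial N \<alpha> (\<lambda>i. u i q)))"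
    using A(1) vanishingD[OF A_vanishing \<open>\<epsilon> > 0\<close>] by (intro eventually_ball_finite) auto
  then have "\<forall>\<^sub>F q in sequentially.
      (\<forall>\<alpha>\<in>A. small_on R \<epsilon> (?T q (monomial N \<alpha> (\<lambda>i. u i q)))) \<and>
      small_on \<rho> (r / 2) (h q) \<and>
      small_on R (\<epsilon> / 4) (?T q (s q)) \<and>
      small_on R (\<epsilon> / 4) (v q)"
    by (intro eventually_conj vanishingD[OF h r2] vanishingD[OF s_vanishing e4] vanishingD[OF v e4])
  then obtain q where q:
      "\<And>\<alpha> z. \<alpha> \<in> A \<Longrightarrow> norm z \<le> R \<Longrightarrow> norm (?T q (monomial N \<alpha> (\<lambda>i. u i q)) z) < \<epsilon>"
      "\<And>z. norm z \<le> \<rho> \<Longrightarrow> norm (h q z) < r / 2"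
      "\<And>z. norm z \<le> R \<Longrightarrow> norm (?T q (s q) z) < \<epsilon> / 4"
      "\<And>z. norm z \<le> R \<Longrightarrow> norm (v q z) < \<epsilon> / 4"
    using eventually_happens'[OF sequentially_bot] by blast
  define G where "G = (\<lambda>i. if i < N then u i q else F i)"
  have G: "monomial N \<alpha> G = monomial N \<alpha> (\<lambda>i. u i q)" for \<alpha>
    by (auto simp: monomial_def G_def intro!: prod.cong)
  show ?thesis
  proof (rule that[of G q])
    show "G i \<in> entire" for i using F u_entire by (simp add: G_def)
    show "norm (G i z - F i z) < r" if z: "norm z \<le> \<rho>" for i z
    proof -
      have "norm (t i q z) < r / 2" using q(2)[OF z] d(2)[OF z] by (simp add: t_def)
      then show ?thesis
        using g(2)[OF z, of i] norm_triangle_ineq4[of "t i q z" "F i z - g i z"] \<open>r > 0\<close>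
        by (simp add: G_def u_def algebra_simps)
    qed
    show "norm (?T q (monomial N \<alpha> G) z) < \<epsilon>" if "\<alpha> \<in> A" "norm z \<le> R" for \<alpha> z
      unfolding G using q(1) that .
    show "norm (?T q (monomial N \<beta> G) z - p z) < \<epsilon>" if z: "norm z \<le> R" for z
    proof -
      let ?E = "exp_sum J c k z"
      have "?T q (monomial N \<beta> G) z - p z = ?T q (s q) z + v q z - (p z - ?E)"
        unfolding G main by simp
      moreover have "norm (?T q (s q) z + v q z - (p z - ?E)) < \<epsilon>"
        using q(3)[OF z] q(4)[OF z] target[rule_format, OF z]
          norm_triangle_ineq4[of "?T q (s q) z + v q z" "p z - ?E"]
          norm_triangle_ineq[of "?T q (s q) z" "v q z"] by linarith
      ultimately show ?thesis by (simp only:)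
    qed
  qed
qed

end

section \<open>Baire category for sequences of entire functions\<close>

text \<open>Basic neighbourhoods of the product topology on sequences of entire functions. One number \<open>n\<close> bounds
  both the coordinates and the radius of the disc.\<close>

definition seq_close :: "nat \<Rightarrow> real \<Rightarrow> (nat \<Rightarrow> cfun) \<Rightarrow> (nat \<Rightarrow> cfun) \<Rightarrow> bool" where
  "seq_close n r F G \<longleftrightarrow> (\<forall>i<n. close_on (real n) r (G i) (F i))"

lemma seq_close_mono: "seq_close n r F G \<Longrightarrow> n' \<le> n \<Longrightarrow> r \<le> r' \<Longrightarrow> seq_close n' r' F G"
  unfolding seq_close_def by (meson less_le_trans of_nat_le_iff order.trans)

text \<open>The nested ball construction behind Baire's theorem. The members of \<open>\<Q>\<close> are properties that hold on
  a dense open set of sequences. At stage \<open>s\<close> a closed ball, of radius at most \<open>2\<^sup>-\<^sup>s\<close> on at least \<open>s\<close>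
  coordinates and on the disc of radius \<open>s\<close>, is chosen inside the previous one such that the \<open>s\<close>-th
  property holds on it. The centres converge locally uniformly, and the limit lies in all the balls.\<close>

lemma baire_entire_sequences:
  fixes \<Q> :: "((nat \<Rightarrow> cfun) \<Rightarrow> bool) set"
  assumes "countable \<Q>"
    and dense: "\<And>Q F n r. Q \<in> \<Q> \<Longrightarrow> entire_seq F \<Longrightarrow> r > 0 \<Longrightarrow>
      \<exists>G n' r'. entire_seq G \<and> seq_close n r F G \<and> r' > 0 \<and>
        (\<forall>H. entire_seq H \<longrightarrow> seq_close n' r' G H \<longrightarrow> Q H)"
  obtains F where "entire_seq F" "\<forall>Q\<in>\<Q>. Q F"
proof (cases "\<Q> = {}")
  case True
  then show ?thesis using that[of "\<lambda>_ _. 0"] entire_const by simp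
next
  case False
  define Q where "Q = from_nat_into \<Q>"
  have Q: "Q s \<in> \<Q>" for s unfolding Q_def by (rule from_nat_into[OF False])
  define C :: "(nat \<Rightarrow> cfun) \<times> nat \<times> real \<Rightarrow> (nat \<Rightarrow> cfun) \<Rightarrow> bool" where
    "C = (\<lambda>(F, n, r) H. \<forall>i<n. \<forall>z. norm z \<le> real n \<longrightarrow> norm (H i z - F i z) \<le> r)"
  define P :: "nat \<Rightarrow> (nat \<Rightarrow> cfun) \<times> nat \<times> real \<Rightarrow> bool" where
    "P = (\<lambda>s (F, n, r). entire_seq F \<and> 0 < r \<and> r \<le> (1/2) ^ s \<and> s \<le> n)"
  have "\<exists>x. \<forall>s. P s (x s) \<and> (\<forall>H. entire_seq H \<longrightarrow> C (x (Suc s)) H \<longrightarrow> Q s H \<and> C (x s) H)"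
  proof (rule dependent_nat_choice)
    show "\<exists>x. P 0 x"
      by (rule exI[of _ "(\<lambda>_ _. 0, 0, 1)"]) (simp add: P_def entire_const)
    fix x s assume "P s x"
    then obtain F n r where x: "x = (F, n, r)" "entire_seq F" "r > 0"
      by (cases x) (auto simp: P_def)
    have "r / 2 > 0" using x by simp
    from dense[OF Q x(2) this] obtain G n1 r1 where G: "entire_seq G" "seq_close n (r / 2) F G" "r1 > 0"
      "\<And>H. entire_seq H \<Longrightarrow> seq_close n1 r1 G H \<Longrightarrow> Q s H" by metis
    define n' where "n' = max (max n n1) (Suc s)"
    define r' where "r' = min (r1 / 2) (min (r / 2) ((1/2) ^ Suc s))"
    have n': "n \<le> n'" "n1 \<le> n'" "Suc s \<le> n'" by (auto simp: n'_def)
    have r': "r' > 0" "r' \<le> r1 / 2" "r' \<le> r / 2" "r' \<le> (1/2) ^ Suc s"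
      using G(3) x(3) by (auto simp: r'_def)
    have "Q s H \<and> C x H" if H: "entire_seq H" "C (G, n', r') H" for H
    proof
      have close: "norm (H i z - G i z) \<le> r'" if "i < n'" "norm z \<le> real n'" for i z
        using H(2) that by (simp add: C_def)
      show "Q s H"
      proof (rule G(4)[OF H(1)])
        have "norm (H i z - G i z) < r1" if "i < n1" "norm z \<le> real n1" for i z
          using close[of i z] that n'(2) r'(2) G(3) by simp
        then show "seq_close n1 r1 G H" by (simp add: seq_close_def)
      qed
      have "norm (H i z - F i z) \<le> r" if "i < n" "norm z \<le> real n" for i z
      proof -
        have "norm (G i z - F i z) < r / 2" using G(2) that by (simp add: seq_close_def)
        moreover have "norm (H i z - G i z) \<le> r'" using close[of i z] that n'(1) by simp
        ultimately show ?thesis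
          using norm_triangle_ineq[of "H i z - G i z" "G i z - F i z"] r'(3) by simp
      qed
      then show "C x H" by (simp add: C_def x(1))
    qed
    moreover have "P (Suc s) (G, n', r')" using G(1) n' r' by (simp add: P_def)
    ultimately show "\<exists>y. P (Suc s) y \<and> (\<forall>H. entire_seq H \<longrightarrow> C y H \<longrightarrow> Q s H \<and> C x H)"
      by (intro exI[of _ "(G, n', r')"]) simp
  qed
  then obtain x where x: "\<And>s. P s (x s)"
    "\<And>s H. entire_seq H \<Longrightarrow> C (x (Suc s)) H \<Longrightarrow> Q s H \<and> C (x s) H" by blast
  define F where "F = (\<lambda>s. fst (x s))"
  define n where "n = (\<lambda>s. fst (snd (x s)))"
  define r where "r = (\<lambda>s. snd (snd (x s)))"
  have x_eq: "x s = (F s, n s, r s)" for s by (simp add: F_def n_def r_def)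
  have F: "\<forall>i. F s i \<in> entire" and r: "0 < r s" "r s \<le> (1/2) ^ s" and n: "s \<le> n s" for s
    using x(1)[of s] unfolding x_eq P_def by auto
  have nested: "C (x s) H" if "s \<le> t" "entire_seq H" "C (x t) H" for s t H
    using that by (induction rule: dec_induct) (auto dest: x(2))
  have self: "C (x t) (F t)" for t using r(1)[of t] by (simp add: C_def x_eq less_imp_le)
  have close: "norm (F t i z - F s i z) \<le> r s" if "s \<le> t" "i < n s" "norm z \<le> real (n s)" for s t i z
    using nested[OF that(1) F self] that(2,3) by (simp add: C_def x_eq)
  define L where "L = (\<lambda>i z. lim (\<lambda>t. F t i z))"
  have conv: "(\<lambda>t. F t i z) \<longlonglongrightarrow> L i z" for i z
  proof -
    have "Cauchy (\<lambda>t. F t i z)"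
    proof (rule metric_CauchyI)
      fix e :: real assume "e > 0"
      then obtain s0 where s0: "(1/2 :: real) ^ s0 < e / 2" using real_arch_pow_inv[of "e / 2" "1/2"] by auto
      define s where "s = max s0 (max (Suc i) (nat \<lceil>norm z\<rceil>))"
      have "r s \<le> (1/2) ^ s" by (rule r)
      also have "\<dots> \<le> (1/2) ^ s0" by (intro power_decreasing) (auto simp: s_def)
      finally have rs: "r s < e / 2" using s0 by linarith
      have i: "i < n s" using n[of s] unfolding s_def by linarith
      have z: "norm z \<le> real (n s)" using n[of s] unfolding s_def by linarith
      have near: "dist (F t i z) (F s i z) < e / 2" if "t \<ge> s" for t
        using close[OF that i z] rs by (simp add: dist_norm)
      have "dist (F t i z) (F t' i z) < e" if "t \<ge> s" "t' \<ge> s" for t t'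
        using near[OF that(1)] near[OF that(2)] dist_triangle2[of "F t i z" "F t' i z" "F s i z"] by linarith
      then show "\<exists>M. \<forall>m\<ge>M. \<forall>k\<ge>M. dist (F m i z) (F k i z) < e" by blast
    qed
    then show ?thesis by (simp add: L_def Cauchy_convergent_iff convergent_LIMSEQ_iff)
  qed
  have L_close: "norm (L i z - F s i z) \<le> r s" if "i < n s" "norm z \<le> real (n s)" for s i z
  proof (rule Lim_norm_ubound[of sequentially])
    show "(\<lambda>t. F t i z - F s i z) \<longlonglongrightarrow> L i z - F s i z" by (intro tendsto_intros conv)
    show "\<forall>\<^sub>F t in sequentially. norm (F t i z - F s i z) \<le> r s"
      unfolding eventually_sequentially using close that by (intro exI[of _ s]) simp
  qed simp
  have L_entire: "entire_seq L"
  proof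
    fix i
    show "L i \<in> entire"
      unfolding entire_def mem_Collect_eq
    proof (rule holomorphic_uniform_sequence[of _ "\<lambda>t. F t i"])
      show "F t i holomorphic_on UNIV" for t using F by (simp add: entire_def)
      fix y :: complex
      have "uniform_limit (cball y 1) (\<lambda>t. F t i) (L i) sequentially"
      proof (rule uniform_limitI)
        fix e :: real assume "e > 0"
        then obtain s0 where s0: "(1/2 :: real) ^ s0 < e" using real_arch_pow_inv[of e "1/2"] by auto
        define s where "s = max s0 (max (Suc i) (nat \<lceil>norm y + 1\<rceil>))"
        have "dist (F t i z) (L i z) < e" if "t \<ge> s" "z \<in> cball y 1" for t z
        proof -
          have "norm z \<le> norm y + 1"
            using that(2) norm_triangle_sub[of z y] by (simp add: dist_norm norm_minus_commute)
          also have "\<dots> \<le> real s" unfolding s_def by linarith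
          also have "\<dots> \<le> real (n t)" using that(1) n[of t] by simp
          finally have z: "norm z \<le> real (n t)" .
          have "i < s" unfolding s_def by linarith
          then have "i < n t" using that(1) n[of t] by linarith
          from L_close[OF this z] have "dist (F t i z) (L i z) \<le> r t" by (simp add: dist_norm norm_minus_commute)
          also have "\<dots> \<le> (1/2) ^ t" by (rule r)
          also have "\<dots> \<le> (1/2) ^ s0" using that(1) by (intro power_decreasing) (auto simp: s_def)
          finally show ?thesis using s0 by simp
        qed
        then show "\<forall>\<^sub>F t in sequentially. \<forall>z\<in>cball y 1. dist (F t i z) (L i z) < e"
          unfolding eventually_sequentially by blast
      qed
      then show "\<exists>d>0. cball y d \<subseteq> UNIV \<and> uniform_limit (cball y d) (\<lambda>t. F t i) (L i) sequentially"
        by (intro exI[of _ 1]) auto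
    qed auto
  qed
  have "C (x s) L" for s using L_close by (simp add: C_def x_eq)
  then have "Q s L" for s using x(2)[OF L_entire] by blast
  then have "Q' L" if "Q' \<in> \<Q>" for Q'
    using from_nat_into_surj[OF assms(1) that] unfolding Q_def by metis
  then show ?thesis using that[of L] L_entire by blast
qed

definition seq_continuous_at ::
    "(nat \<Rightarrow> cfun) \<Rightarrow> ((nat \<Rightarrow> cfun) \<Rightarrow> complex \<Rightarrow> complex) \<Rightarrow> bool" where
  "seq_continuous_at F L \<longleftrightarrow> (\<forall>R. \<forall>e>0. \<exists>n r. r > 0 \<and>
     (\<forall>H. entire_seq H \<longrightarrow> seq_close n r F H \<longrightarrow> close_on R e (L H) (L F)))"

lemma seq_continuous_atD:
  assumes "seq_continuous_at F L" "e > 0"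
  shows "\<exists>n r. r > 0 \<and>
    (\<forall>H. entire_seq H \<longrightarrow> seq_close n r F H \<longrightarrow> close_on R e (L H) (L F))"
  using assms unfolding seq_continuous_at_def by simp

lemma seq_continuous_at_const: "seq_continuous_at F (\<lambda>H. f)"
  unfolding seq_continuous_at_def
  by (intro allI impI, rule exI[of _ 0], rule exI[of _ 1]) simp

lemma seq_continuous_at_coordinate: "seq_continuous_at F (\<lambda>H. H i)"
  unfolding seq_continuous_at_def
proof (intro allI impI)
  fix R e :: real assume "e > 0"
  have "norm (H i z - F i z) < e"
    if close: "seq_close (max (Suc i) (nat \<lceil>R\<rceil>)) e F H" and z: "norm z \<le> R" for H z
  proof -
    have "norm z \<le> real (max (Suc i) (nat \<lceil>R\<rceil>))" using z by linarith
    moreover have "i < max (Suc i) (nat \<lceil>R\<rceil>)" by simp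
    ultimately show ?thesis using close unfolding seq_close_def by blast
  qed
  then show "\<exists>n r. r > 0 \<and> (\<forall>H. entire_seq H \<longrightarrow> seq_close n r F H \<longrightarrow>
      close_on R e (H i) (F i))"
    using \<open>e > 0\<close> by blast
qed

lemma seq_continuous_at_mult:
  assumes L: "seq_continuous_at F L" "L F \<in> entire"
    and M: "seq_continuous_at F M" "M F \<in> entire"
  shows "seq_continuous_at F (\<lambda>H z. L H z * M H z)"
  unfolding seq_continuous_at_def
proof (intro allI impI)
  fix R e :: real assume "e > 0"
  obtain B1 where B1: "B1 \<ge> 1" "\<And>z. norm z \<le> R \<Longrightarrow> norm (L F z) \<le> B1"
    using entire_bounded_on_cball[OF L(2)] by blast
  obtain B2 where B2: "B2 \<ge> 1" "\<And>z. norm z \<le> R \<Longrightarrow> norm (M F z) \<le> B2"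
    using entire_bounded_on_cball[OF M(2)] by blast
  \<comment> \<open>The error of the product is at most \<open>e'\<^sup>2 + e' B2 + B1 e'\<close>.\<close>
  define e' where "e' = min 1 (e / (B1 + B2 + 1))"
  have pos: "B1 + B2 + 1 > 0" using B1(1) B2(1) by linarith
  have e': "e' > 0" "e' \<le> 1" using \<open>e > 0\<close> pos by (auto simp: e'_def)
  have "e' \<le> e / (B1 + B2 + 1)" by (simp add: e'_def)
  then have e'_le: "e' * (B1 + B2 + 1) \<le> e" using pos by (simp add: pos_le_divide_eq)
  obtain n1 r1 where 1: "r1 > 0"
    "\<forall>H. entire_seq H \<longrightarrow> seq_close n1 r1 F H \<longrightarrow> close_on R e' (L H) (L F)"
    using seq_continuous_atD[OF L(1) e'(1), of R] by (elim exE conjE)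
  obtain n2 r2 where 2: "r2 > 0"
    "\<forall>H. entire_seq H \<longrightarrow> seq_close n2 r2 F H \<longrightarrow> close_on R e' (M H) (M F)"
    using seq_continuous_atD[OF M(1) e'(1), of R] by (elim exE conjE)
  have "norm (L H z * M H z - L F z * M F z) < e"
    if H: "entire_seq H" "seq_close (max n1 n2) (min r1 r2) F H" and z: "norm z \<le> R" for H z
  proof -
    have l: "norm (L H z - L F z) < e'"
      using 1(2)[rule_format, OF _ seq_close_mono[OF H(2)] z] H(1) by simp
    have m: "norm (M H z - M F z) < e'"
      using 2(2)[rule_format, OF _ seq_close_mono[OF H(2)] z] H(1) by simp
    define x where "x = L H z - L F z"
    define y where "y = M H z - M F z"
    have xy: "norm x < e'" "norm y < e'" using l m by (simp_all add: x_def y_def)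
    have "L H z * M H z - L F z * M F z = x * y + x * M F z + L F z * y"
      unfolding x_def y_def by (simp add: algebra_simps)
    then have "norm (L H z * M H z - L F z * M F z) \<le> norm (x * y) + norm (x * M F z) + norm (L F z * y)"
      using norm_triangle_ineq[of "x * y + x * M F z" "L F z * y"] norm_triangle_ineq[of "x * y" "x * M F z"]
      by simp
    moreover have "norm (x * y) \<le> norm x * 1"
      unfolding norm_mult using xy e' by (intro mult_left_mono) auto
    moreover have "norm (x * M F z) \<le> e' * B2"
      unfolding norm_mult using xy e' B2(1) B2(2)[OF z] by (intro mult_mono) auto
    moreover have "norm (L F z * y) \<le> B1 * e'"
      unfolding norm_mult using xy e' B1(1) B1(2)[OF z] by (intro mult_mono) auto
    ultimately have "norm (L H z * M H z - L F z * M F z) < e' + e' * B2 + B1 * e'"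
      using xy(1) by linarith
    also have "\<dots> \<le> e" using e'_le by (simp add: algebra_simps)
    finally show ?thesis .
  qed
  then show "\<exists>n r. r > 0 \<and> (\<forall>H. entire_seq H \<longrightarrow> seq_close n r F H \<longrightarrow>
      close_on R e (\<lambda>z. L H z * M H z) (\<lambda>z. L F z * M F z))"
    using 1(1) 2(1) by (intro exI[of _ "max n1 n2"] exI[of _ "min r1 r2"] conjI allI impI) simp_all
qed

lemma seq_continuous_at_power:
  assumes "seq_continuous_at F L" "L F \<in> entire"
  shows "seq_continuous_at F (\<lambda>H z. L H z ^ k)"
proof (induction k)
  case 0
  have "(\<lambda>H z. L H z ^ 0) = (\<lambda>H z. 1)" by (intro ext) simp
  then show ?case using seq_continuous_at_const[of F "\<lambda>z. 1"] by (simp only:)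
next
  case (Suc k)
  have "(\<lambda>z. L F z ^ k) \<in> entire" by (rule entire_power[OF assms(2)])
  then have "seq_continuous_at F (\<lambda>H z. L H z * L H z ^ k)"
    by (rule seq_continuous_at_mult[OF assms Suc])
  then show ?case by (simp only: power_Suc)
qed

lemma seq_continuous_at_monomial:
  assumes F: "\<And>i. F i \<in> entire"
  shows "seq_continuous_at F (monomial N \<alpha>)"
proof -
  have "seq_continuous_at F (\<lambda>H z. \<Prod>i<N. H i z ^ \<alpha> i)"
  proof (induction N)
    case (Suc N)
    have "seq_continuous_at F (\<lambda>H z. (\<Prod>i<N. H i z ^ \<alpha> i) * H N z ^ \<alpha> N)"
    proof (rule seq_continuous_at_mult[OF Suc])
      show "(\<lambda>z. \<Prod>i<N. F i z ^ \<alpha> i) \<in> entire" by (intro entire_prod entire_power F)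
      show "seq_continuous_at F (\<lambda>H z. H N z ^ \<alpha> N)"
        by (rule seq_continuous_at_power[OF seq_continuous_at_coordinate F])
      show "(\<lambda>z. F N z ^ \<alpha> N) \<in> entire" by (intro entire_power F)
    qed
    then show ?case by simp
  qed (simp add: seq_continuous_at_const)
  moreover have "monomial N \<alpha> = (\<lambda>H z. \<Prod>i<N. H i z ^ \<alpha> i)"
    by (intro ext) (simp add: monomial_def)
  ultimately show ?thesis by simp
qed

lemma seq_continuous_at_operator:
  assumes T: "local_operator T" and L: "seq_continuous_at F L"
    and L_entire: "\<And>H. entire_seq H \<Longrightarrow> L H \<in> entire" and F: "entire_seq F"
  shows "seq_continuous_at F (\<lambda>H. T (L H))"
  unfolding seq_continuous_at_def
proof (intro allI impI)
  fix R e :: real assume "e > 0"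
  obtain R' d where d: "d > 0" "\<forall>f\<in>entire. \<forall>g\<in>entire.
     close_on R' d g f \<longrightarrow> close_on R e (T g) (T f)"
    using local_operator_continuous[OF T \<open>e > 0\<close>, of R] by (elim exE conjE)
  obtain n r where nr: "r > 0"
    "\<forall>H. entire_seq H \<longrightarrow> seq_close n r F H \<longrightarrow> close_on R' d (L H) (L F)"
    using seq_continuous_atD[OF L d(1), of R'] by (elim exE conjE)
  show "\<exists>n r. r > 0 \<and> (\<forall>H. entire_seq H \<longrightarrow> seq_close n r F H \<longrightarrow>
      close_on R e (T (L H)) (T (L F)))"
  proof (rule exI[of _ n], rule exI[of _ r], rule conjI[OF nr(1)], intro allI impI)
    fix H and z :: complex assume H: "entire_seq H" "seq_close n r F H" and z: "norm z \<le> R"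
    show "norm (T (L H) z - T (L F) z) < e"
    proof (rule d(2)[rule_format, OF L_entire[OF F] L_entire[OF H(1)] _ z])
      show "norm (L H w - L F w) < d" if "norm w \<le> R'" for w
        by (rule nr(2)[rule_format, OF _ H(2) that]) (use H(1) in blast)
    qed
  qed
qed

section \<open>A generic sequence of generators\<close>

text \<open>Exponents of monomials in \<open>N\<close> variables, read as numbers with \<open>N\<close> digits in base \<open>N\<close>: with the weights
  \<open>N ^ i\<close> distinct monomials have distinct weights.\<close>

definition digits :: "nat \<Rightarrow> (nat \<Rightarrow> nat) set" where
  "digits N = {\<alpha>. \<forall>i. (i \<in> {..<N} \<longrightarrow> \<alpha> i \<in> {..<N}) \<and> (i \<notin> {..<N} \<longrightarrow> \<alpha> i = 0)}"

definition base_value :: "nat \<Rightarrow> (nat \<Rightarrow> nat) \<Rightarrow> nat" where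
  "base_value N \<alpha> = (\<Sum>i<N. \<alpha> i * N ^ i)"

abbreviation separates_monomials ::
    "(cfun \<Rightarrow> complex \<Rightarrow> complex) \<Rightarrow> nat \<Rightarrow> (nat \<Rightarrow> cfun) \<Rightarrow> bool" where
  "separates_monomials T N F \<equiv> \<forall>\<beta>\<in>digits N. \<beta> \<noteq> (\<lambda>_. 0) \<longrightarrow> (\<forall>f\<in>entire. \<forall>R. \<forall>e>0. \<exists>q.
     close_on R e ((T ^^ q) (monomial N \<beta> F)) f \<and>
     (\<forall>\<alpha>\<in>digits N. base_value N \<alpha> < base_value N \<beta> \<longrightarrow> small_on R e ((T ^^ q) (monomial N \<alpha> F))))"

lemma finite_digits: "finite (digits N)"
  unfolding digits_def by (rule finite_set_of_finite_funs) auto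

lemma digit_sum_less:
  fixes B :: nat
  assumes "\<And>i. i < n \<Longrightarrow> a i < B"
  shows "(\<Sum>i<n. a i * B ^ i) < B ^ n"
  using assms
proof (induction n)
  case (Suc n)
  have "(\<Sum>i<Suc n. a i * B ^ i) < B ^ n + a n * B ^ n" using Suc by simp
  also have "\<dots> = Suc (a n) * B ^ n" by simp
  also have "\<dots> \<le> B * B ^ n" using Suc.prems[of n] by (intro mult_right_mono) auto
  finally show ?case by simp
qed simp

lemma digit_sum_inj:
  fixes B :: nat
  assumes "\<And>i. i < n \<Longrightarrow> a i < B" "\<And>i. i < n \<Longrightarrow> b i < B"
    and "(\<Sum>i<n. a i * B ^ i) = (\<Sum>i<n. b i * B ^ i)" "i < n"
  shows "a i = b i"
  using assms
proof (induction n arbitrary: i)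
  case (Suc n)
  have B: "B > 0" using Suc.prems(1)[of n] by simp
  have less: "(\<Sum>i<n. a i * B ^ i) < B ^ n" "(\<Sum>i<n. b i * B ^ i) < B ^ n"
    using Suc.prems by (auto intro: digit_sum_less)
  have eq: "(\<Sum>i<n. a i * B ^ i) + a n * B ^ n = (\<Sum>i<n. b i * B ^ i) + b n * B ^ n"
    using Suc.prems(3) by simp
  have "a n = ((\<Sum>i<n. a i * B ^ i) + a n * B ^ n) div B ^ n" using less(1) B by simp
  also have "\<dots> = b n" unfolding eq using less(2) B by simp
  finally have n: "a n = b n" .
  show ?case
  proof (cases "i = n")
    case True
    then show ?thesis using n by simp
  next
    case False
    show ?thesis
    proof (rule Suc.IH)
      show "(\<Sum>i<n. a i * B ^ i) = (\<Sum>i<n. b i * B ^ i)" using eq n by simp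
      show "i < n" using False Suc.prems(4) by simp
    qed (use Suc.prems(1,2) in simp_all)
  qed
qed simp

lemma base_value_inj: "inj_on (base_value N) (digits N)"
proof (rule inj_onI, rule ext)
  fix \<alpha> \<beta> i assume \<alpha>\<beta>: "\<alpha> \<in> digits N" "\<beta> \<in> digits N" "base_value N \<alpha> = base_value N \<beta>"
  show "\<alpha> i = \<beta> i"
  proof (cases "i < N")
    case True
    then show ?thesis using \<alpha>\<beta> digit_sum_inj[of N \<alpha> N \<beta> i] by (simp add: digits_def base_value_def)
  next
    case False
    then show ?thesis using \<alpha>\<beta> by (simp add: digits_def)
  qed
qed

text \<open>Polynomials with coefficients in a countable dense set of complex numbers.\<close>

lemma countable_dense_entire:
  obtains \<P> where "countable \<P>" "\<P> \<subseteq> entire"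
    "\<forall>f\<in>entire. \<forall>R. \<forall>e>0. \<exists>p\<in>\<P>. close_on R e p f"
proof -
  obtain D :: "complex set" where D: "countable D" "\<And>X. open X \<Longrightarrow> X \<noteq> {} \<Longrightarrow> \<exists>d\<in>D. d \<in> X"
    by (rule countable_dense_setE) blast
  define \<P> where "\<P> = (\<lambda>cs z. \<Sum>k<length cs. cs ! k * z ^ k) ` lists D"
  have "\<exists>p\<in>\<P>. close_on R e p f" if f: "f \<in> entire" and "e > 0" for f R e
  proof -
    have "e / 2 > 0" using \<open>e > 0\<close> by simp
    then obtain n t where nt: "\<And>z. norm z \<le> R \<Longrightarrow> norm (f z - (\<Sum>k<n. t k * z ^ k)) < e / 2"
      by (rule entire_poly_approx[OF f]) blast
    define S where "S = max 1 \<bar>R\<bar>"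
    have S: "S \<ge> 1" by (simp add: S_def)
    define \<eta> where "\<eta> = e / (2 * (real n + 1) * S ^ n)"
    have den: "2 * (real n + 1) * S ^ n > 0" using S by simp
    have \<eta>: "\<eta> > 0" using \<open>e > 0\<close> den by (simp add: \<eta>_def)
    have "\<exists>d\<in>D. dist d (t k) < \<eta>" for k
      using D(2)[of "ball (t k) \<eta>"] \<eta> by (auto simp: dist_commute)
    then obtain d where d: "\<And>k. d k \<in> D" "\<And>k. dist (d k) (t k) < \<eta>" by metis
    let ?p = "\<lambda>z. \<Sum>k<n. d k * z ^ k"
    have p_in: "?p \<in> \<P>"
      unfolding \<P>_def
    proof (rule image_eqI[where x = "map d [0..<n]"])
      show "map d [0..<n] \<in> lists D" using d(1) by auto
    qed simp
    have "norm (?p z - f z) < e" if z: "norm z \<le> R" for z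
    proof -
      have "norm (?p z - (\<Sum>k<n. t k * z ^ k)) \<le> (\<Sum>k<n. \<eta> * S ^ n)"
        unfolding sum_subtractf[symmetric]
      proof (rule order.trans[OF norm_sum], rule sum_mono)
        fix k assume "k \<in> {..<n}"
        have "norm z ^ k \<le> S ^ k" using z by (intro power_mono) (auto simp: S_def)
        also have "\<dots> \<le> S ^ n" using S \<open>k \<in> {..<n}\<close> by (intro power_increasing) auto
        finally have "norm (d k - t k) * norm z ^ k \<le> \<eta> * S ^ n"
          using d(2)[of k] \<eta> by (intro mult_mono) (auto simp: dist_norm)
        then show "norm (d k * z ^ k - t k * z ^ k) \<le> \<eta> * S ^ n"
          by (simp add: left_diff_distrib[symmetric] norm_mult norm_power)
      qed
      also have "\<dots> = real n * (\<eta> * S ^ n)" by simp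
      also have "\<dots> \<le> (real n + 1) * (\<eta> * S ^ n)" using \<eta> S by (intro mult_right_mono) auto
      also have "\<dots> = e / 2"
      proof -
        have cancel: "a * (e / (2 * a * b) * b) = e / 2" if "a \<noteq> 0" "b \<noteq> 0" for a b :: real
          using that by simp
        have "S ^ n \<noteq> 0" "real n + 1 \<noteq> 0" using S by auto
        then show ?thesis unfolding \<eta>_def by (intro cancel)
      qed
      finally show ?thesis
        using nt[OF z] norm_triangle_ineq4[of "?p z - (\<Sum>k<n. t k * z ^ k)" "f z - (\<Sum>k<n. t k * z ^ k)"] by simp
    qed
    then show ?thesis using p_in by (intro bexI[of _ ?p]) simp_all
  qed
  moreover have "countable \<P>" unfolding \<P>_def using D(1) by (intro countable_image countable_lists)
  moreover have "\<P> \<subseteq> entire"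
    unfolding \<P>_def entire_def by (auto intro!: holomorphic_intros)
  ultimately show ?thesis by (intro that[of \<P>] ballI allI impI) simp_all
qed

lemma seq_continuous_common_radius:
  assumes "finite A" "\<And>\<alpha>. \<alpha> \<in> A \<Longrightarrow> seq_continuous_at F (L \<alpha>)" "e > 0"
  shows "\<exists>n r. r > 0 \<and> (\<forall>H. entire_seq H \<longrightarrow> seq_close n r F H \<longrightarrow>
    (\<forall>\<alpha>\<in>A. close_on R e (L \<alpha> H) (L \<alpha> F)))"
  using assms(1,2)
proof (induction A rule: finite_induct)
  case empty
  show ?case by (rule exI[of _ 0], rule exI[of _ 1]) simp
next
  case (insert \<alpha> A)
  have "\<exists>n r. r > 0 \<and> (\<forall>H. entire_seq H \<longrightarrow> seq_close n r F H \<longrightarrow>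
      (\<forall>\<alpha>\<in>A. close_on R e (L \<alpha> H) (L \<alpha> F)))"
    by (rule insert.IH) (rule insert.prems, simp)
  then obtain n1 r1 where 1: "r1 > 0" "\<forall>H. entire_seq H \<longrightarrow> seq_close n1 r1 F H \<longrightarrow>
      (\<forall>\<alpha>\<in>A. close_on R e (L \<alpha> H) (L \<alpha> F))"
    by (elim exE conjE)
  obtain n2 r2 where 2: "r2 > 0" "\<forall>H. entire_seq H \<longrightarrow> seq_close n2 r2 F H \<longrightarrow>
      close_on R e (L \<alpha> H) (L \<alpha> F)"
    using seq_continuous_atD[OF insert.prems[OF insertI1] assms(3), of R] by (elim exE conjE)
  show ?case
  proof (rule exI[of _ "max n1 n2"], rule exI[of _ "min r1 r2"], intro conjI allI impI ballI)
    show "min r1 r2 > 0" using 1 2 by simp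
    fix H \<alpha>' and z :: complex
    assume H: "entire_seq H" "seq_close (max n1 n2) (min r1 r2) F H"
      and \<alpha>': "\<alpha>' \<in> insert \<alpha> A" and z: "norm z \<le> R"
    have close: "seq_close n1 r1 F H" "seq_close n2 r2 F H"
      using seq_close_mono[OF H(2), of n1 r1] seq_close_mono[OF H(2), of n2 r2] by simp_all
    show "norm (L \<alpha>' H z - L \<alpha>' F z) < e"
    proof (cases "\<alpha>' = \<alpha>")
      case True
      have "norm (L \<alpha> H z - L \<alpha> F z) < e"
        by (rule 2(2)[rule_format, OF _ close(2) z]) (use H(1) in blast)
      then show ?thesis using True by simp
    next
      case False
      then have "\<alpha>' \<in> A" using \<alpha>' by simp
      show ?thesis
        by (rule 1(2)[rule_format, OF _ close(1) \<open>\<alpha>' \<in> A\<close> z]) (use H(1) in blast)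
    qed
  qed
qed

text \<open>There are countably many requirements: that some \<open>F i\<close> be close to a given element of a countable dense
  set, and that for given \<open>n\<close>, \<open>N\<close> and \<open>\<beta>\<close> some power of the \<open>n\<close>-th operator take \<open>F\<^sup>\<beta>\<close> close to such an
  element and all monomials of smaller weight close to \<open>0\<close>. Requirements of the first kind can be met by
  changing one coordinate far out in the sequence, those of the second kind by
  \<open>simultaneous_transitivity\<close>.\<close>

lemma generic_sequence:
  fixes \<Phi> :: "nat \<Rightarrow> cfun"
  assumes arc: "\<And>n. unimodular_arc (\<Phi> n) (\<Gamma> n)" and \<Phi>: "\<And>n. exponential_type (\<Phi> n)"
  obtains F where "entire_seq F"
    "\<forall>f\<in>entire. \<forall>R. \<forall>e>0. \<exists>i. close_on R e (F i) f"
    "\<forall>n N. separates_monomials (conv_op (\<Phi> n)) N F"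
proof -
  let ?T = "\<lambda>n q. conv_op (\<Phi> n) ^^ q"
  obtain \<P> where \<P>: "countable \<P>" "\<P> \<subseteq> entire"
    "\<forall>f\<in>entire. \<forall>R. \<forall>e>0. \<exists>p\<in>\<P>. close_on R e p f"
    by (rule countable_dense_entire)
  define A where "A = (\<lambda>N \<beta>. {\<alpha> \<in> digits N. base_value N \<alpha> < base_value N \<beta>})"
  define visits :: "cfun \<Rightarrow> nat \<Rightarrow> (nat \<Rightarrow> cfun) \<Rightarrow> bool" where
    "visits = (\<lambda>p k H. \<exists>i. close_on (real k) (1 / (real k + 1)) (H i) p)"
  define singles_out :: "nat \<Rightarrow> nat \<Rightarrow> (nat \<Rightarrow> nat) \<Rightarrow> cfun \<Rightarrow> nat \<Rightarrow> (nat \<Rightarrow> cfun) \<Rightarrow> bool" where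
    "singles_out = (\<lambda>n N \<beta> p k H. \<exists>q.
       close_on (real k) (1 / (real k + 1)) (?T n q (monomial N \<beta> H)) p \<and>
       (\<forall>\<alpha>\<in>A N \<beta>. small_on (real k) (1 / (real k + 1)) (?T n q (monomial N \<alpha> H))))"
  define \<Q> where "\<Q> = (\<lambda>(p, k). visits p k) ` (\<P> \<times> UNIV) \<union>
     (\<lambda>(n, N, \<beta>, p, k). singles_out n N \<beta> p k) ` (SIGMA n:UNIV. SIGMA N:UNIV. (digits N - {\<lambda>_. 0}) \<times> \<P> \<times> UNIV)"
  have "countable \<Q>"
    unfolding \<Q>_def
    by (intro countable_Un countable_image countable_SIGMA \<P>(1) countableI_type countable_finite finite_Diff finite_digits)
  moreover have "\<exists>G n' r'. entire_seq G \<and> seq_close n0 r F G \<and> r' > 0 \<and>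
        (\<forall>H. entire_seq H \<longrightarrow> seq_close n' r' G H \<longrightarrow> Q H)"
    if Q: "Q \<in> \<Q>" and F: "entire_seq F" and r: "r > 0" for Q F n0 r
  proof -
    consider p k where "p \<in> \<P>" "Q = visits p k"
      | n N \<beta> p k where "\<beta> \<in> digits N" "\<beta> \<noteq> (\<lambda>_. 0)" "p \<in> \<P>" "Q = singles_out n N \<beta> p k"
    proof -
      from Q consider x where "x \<in> \<P> \<times> UNIV" "Q = (\<lambda>(p, k). visits p k) x"
        | x where "x \<in> (SIGMA n:UNIV. SIGMA N:UNIV. (digits N - {\<lambda>_. 0}) \<times> \<P> \<times> UNIV)"
            "Q = (\<lambda>(n, N, \<beta>, p, k). singles_out n N \<beta> p k) x"
        unfolding \<Q>_def by (elim UnE imageE)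
      then show ?thesis
      proof cases
        case (1 x)
        then show ?thesis using that(1)[of "fst x" "snd x"] by (cases x) simp
      next
        case (2 x)
        obtain n N \<beta> p k where "x = (n, N, \<beta>, p, k)" by (metis prod.collapse)
        then show ?thesis using 2 that(2)[of \<beta> N p n k] by simp
      qed
    qed
    then show ?thesis
    proof cases
      case (1 p k)
      define G where "G = F(n0 := p)"
      have "entire_seq G" using F 1(1) \<P>(2) by (auto simp: G_def)
      moreover have "seq_close n0 r F G" using r by (simp add: seq_close_def G_def)
      moreover have "Q H" if "seq_close (max (Suc n0) k) (1 / (real k + 1)) G H" for H
        unfolding 1(2) visits_def
      proof (intro exI[of _ n0] allI impI)
        fix z :: complex assume "norm z \<le> real k"
        then have "norm z \<le> real (max (Suc n0) k)" by simp
        then have "norm (H n0 z - G n0 z) < 1 / (real k + 1)"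
          using that unfolding seq_close_def by simp
        then show "norm (H n0 z - p z) < 1 / (real k + 1)" by (simp add: G_def)
      qed
      ultimately show ?thesis
        by (intro exI[of _ G] exI[of _ "max (Suc n0) k"] exI[of _ "1 / (real k + 1)"]) simp
    next
      case (2 n N \<beta> p k)
      interpret unimodular_arc "\<Phi> n" "\<Gamma> n" by (rule arc)
      define \<epsilon> where "\<epsilon> = 1 / (real k + 1) / 2"
      have \<epsilon>: "\<epsilon> > 0" "\<epsilon> + \<epsilon> = 1 / (real k + 1)"
        unfolding \<epsilon>_def by (simp, rule field_sum_of_halves)
      obtain i0 where i0: "i0 < N" "\<beta> i0 > 0"
      proof -
        obtain i where i: "\<beta> i \<noteq> 0" using 2(2) by auto
        have "i < N"
        proof (rule ccontr)
          assume "\<not> i < N"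
          then have "\<beta> i = 0" using 2(1) by (simp add: digits_def)
          then show False using i by simp
        qed
        then show ?thesis using that[of i] i by simp
      qed
      have w: "(N ^ i :: nat) > 0" if "i < N" for i using that by simp
      have fin: "finite (A N \<beta>)" using finite_digits by (simp add: A_def)
      have low: "(\<Sum>i<N. \<alpha> i * N ^ i) < (\<Sum>i<N. \<beta> i * N ^ i)" if "\<alpha> \<in> A N \<beta>" for \<alpha>
        using that by (simp add: A_def base_value_def)
      have p: "p \<in> entire" using 2(3) \<P>(2) by blast
      obtain G q where G: "entire_seq G" "\<forall>i z. norm z \<le> real n0 \<longrightarrow> norm (G i z - F i z) < r"
        "close_on (real k) \<epsilon> (?T n q (monomial N \<beta> G)) p"
        "\<forall>\<alpha>\<in>A N \<beta>. small_on (real k) \<epsilon> (?T n q (monomial N \<alpha> G))"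
        using simultaneous_transitivity[where F = F and w = "\<lambda>i. N ^ i" and N = N and \<rho> = "real n0" and R = "real k",
            OF \<Phi> F[rule_format] w i0 fin low r \<epsilon>(1) p] by metis
      have T: "local_operator (?T n q)"
        by (intro local_operator_funpow exponential_type_local_operator \<Phi>)
      have "seq_continuous_at G (\<lambda>H. ?T n q (monomial N \<alpha> H))" for \<alpha>
        using G(1) by (intro seq_continuous_at_operator[OF T] seq_continuous_at_monomial monomial_entire) auto
      then have "\<exists>n' r'. r' > 0 \<and> (\<forall>H. entire_seq H \<longrightarrow> seq_close n' r' G H \<longrightarrow>
          (\<forall>\<alpha>\<in>insert \<beta> (A N \<beta>). close_on (real k) \<epsilon> (?T n q (monomial N \<alpha> H)) (?T n q (monomial N \<alpha> G))))"
        by (intro seq_continuous_common_radius \<epsilon>(1) finite.insertI fin)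
      then obtain n' r' where nr: "r' > 0" "\<forall>H. entire_seq H \<longrightarrow> seq_close n' r' G H \<longrightarrow>
          (\<forall>\<alpha>\<in>insert \<beta> (A N \<beta>). close_on (real k) \<epsilon> (?T n q (monomial N \<alpha> H)) (?T n q (monomial N \<alpha> G)))"
        by (elim exE conjE)
      have "Q H" if H: "entire_seq H" "seq_close n' r' G H" for H
        unfolding 2(4) singles_out_def \<epsilon>(2)[symmetric]
      proof (intro exI[of _ q] conjI allI impI ballI)
        fix z :: complex assume z: "norm z \<le> real k"
        have near: "norm (?T n q (monomial N \<alpha> H) z - ?T n q (monomial N \<alpha> G) z) < \<epsilon>"
          if "\<alpha> \<in> insert \<beta> (A N \<beta>)" for \<alpha> using nr(2) H z that by blast
        show "norm (?T n q (monomial N \<beta> H) z - p z) < \<epsilon> + \<epsilon>"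
          using near[of \<beta>] G(3)[rule_format, OF z]
            norm_triangle_ineq[of "?T n q (monomial N \<beta> H) z - ?T n q (monomial N \<beta> G) z"
              "?T n q (monomial N \<beta> G) z - p z"] by simp
        fix \<alpha> assume "\<alpha> \<in> A N \<beta>"
        then show "norm (?T n q (monomial N \<alpha> H) z) < \<epsilon> + \<epsilon>"
          using near[of \<alpha>] G(4)[rule_format, OF _ z, of \<alpha>]
            norm_triangle_ineq[of "?T n q (monomial N \<alpha> H) z - ?T n q (monomial N \<alpha> G) z"
              "?T n q (monomial N \<alpha> G) z"] by simp
      qed
      moreover have "seq_close n0 r F G" using G(2) by (simp add: seq_close_def)
      ultimately show ?thesis using G(1) nr(1) by blast
    qed
  qed
  ultimately obtain F where F: "entire_seq F" "\<forall>Q\<in>\<Q>. Q F"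
    by (rule baire_entire_sequences)
  have precision: "\<exists>k. R \<le> real k \<and> 1 / (real k + 1) \<le> e / 2" if "e > 0" for R e :: real
  proof -
    obtain k where k: "max R (2 / e) \<le> real k" using real_arch_simple by blast
    then have "2 / e \<le> real k + 1" by simp
    then have "1 / (real k + 1) \<le> 1 / (2 / e)" using that by (intro divide_left_mono) auto
    then show ?thesis using k by auto
  qed
  show ?thesis
  proof (rule that[of F])
    show "entire_seq F" using F(1) by blast
    show "\<forall>f\<in>entire. \<forall>R. \<forall>e>0. \<exists>i. close_on R e (F i) f"
    proof (intro ballI allI impI)
      fix f and R e :: real assume f: "f \<in> entire" and e: "e > 0"
      then obtain k where k: "R \<le> real k" "1 / (real k + 1) \<le> e / 2" using precision by blast
      obtain p where p: "p \<in> \<P>" "close_on R (e / 2) p f"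
        using \<P>(3)[rule_format, OF f, of "e / 2" R] e by auto
      have "visits p k F" by (rule bspec[OF F(2)]) (use p(1) in \<open>auto simp: \<Q>_def\<close>)
      then obtain i where i: "close_on (real k) (1 / (real k + 1)) (F i) p"
        unfolding visits_def by blast
      have "norm (F i z - f z) < e" if z: "norm z \<le> R" for z
      proof -
        have "norm (F i z - p z) < e / 2" using i[rule_format, of z] z k by linarith
        then show ?thesis
          using p(2)[rule_format, OF z] norm_triangle_ineq[of "F i z - p z" "p z - f z"] by simp
      qed
      then show "\<exists>i. close_on R e (F i) f" by blast
    qed
    show "\<forall>n N. separates_monomials (conv_op (\<Phi> n)) N F"
    proof (intro ballI allI impI)
      fix n N \<beta> f and R e :: real
      assume \<beta>: "\<beta> \<in> digits N" "\<beta> \<noteq> (\<lambda>_. 0)" and f: "f \<in> entire" and e: "e > 0"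
      then obtain k where k: "R \<le> real k" "1 / (real k + 1) \<le> e / 2" using precision by blast
      obtain p where p: "p \<in> \<P>" "close_on R (e / 2) p f"
        using \<P>(3)[rule_format, OF f, of "e / 2" R] e by auto
      have "singles_out n N \<beta> p k \<in> \<Q>"
        unfolding \<Q>_def using \<beta> p(1) by (intro UnI2 image_eqI[of _ _ "(n, N, \<beta>, p, k)"]) auto
      from bspec[OF F(2) this] obtain q where q:
        "close_on (real k) (1 / (real k + 1)) (?T n q (monomial N \<beta> F)) p"
        "\<forall>\<alpha>\<in>A N \<beta>. small_on (real k) (1 / (real k + 1)) (?T n q (monomial N \<alpha> F))"
        unfolding singles_out_def by blast
      show "\<exists>q. close_on R e (?T n q (monomial N \<beta> F)) f \<and>
       (\<forall>\<alpha>\<in>digits N. base_value N \<alpha> < base_value N \<beta> \<longrightarrow>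
          small_on R e (?T n q (monomial N \<alpha> F)))"
      proof (intro exI[of _ q] conjI allI impI ballI)
        fix z :: complex assume z: "norm z \<le> R"
        then have zk: "norm z \<le> real k" using k(1) by linarith
        show "norm (?T n q (monomial N \<beta> F) z - f z) < e"
          using q(1)[rule_format, OF zk] k(2) p(2)[rule_format, OF z]
            norm_triangle_ineq[of "?T n q (monomial N \<beta> F) z - p z" "p z - f z"] by simp
        fix \<alpha> assume "\<alpha> \<in> digits N" "base_value N \<alpha> < base_value N \<beta>"
        then have "\<alpha> \<in> A N \<beta>" by (simp add: A_def)
        then show "norm (?T n q (monomial N \<alpha> F) z) < e"
          using q(2)[rule_format, OF _ zk] k(2) e by fastforce
      qed
    qed
  qed
qed

section \<open>The algebra generated by a generic sequence\<close>

text \<open>Let \<open>\<beta>\<close> have the largest weight among the exponents with non-zero coefficient. A power of \<open>T\<close> that takes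
  \<open>F\<^sup>\<beta>\<close> close to \<open>f / c \<beta>\<close> and all monomials of smaller weight close to \<open>0\<close> takes the combination close
  to \<open>f\<close>.\<close>

lemma combination_escapes:
  fixes F :: "nat \<Rightarrow> cfun"
  assumes T: "local_operator T" and F: "\<And>i. F i \<in> entire"
    and separates: "separates_monomials T N F"
    and C: "C \<subseteq> digits N" "(\<lambda>_. 0) \<notin> C" and c: "\<gamma> \<in> C" "c \<gamma> \<noteq> 0"
    and f: "f \<in> entire" and e: "e > 0"
  shows "\<exists>q. close_on R e (\<lambda>z. (T ^^ q) (\<lambda>z. \<Sum>\<alpha>\<in>C. c \<alpha> * monomial N \<alpha> F z) z) f"
proof -
  define C' where "C' = {\<alpha> \<in> C. c \<alpha> \<noteq> 0}"
  have finC: "finite C" using C(1) finite_digits by (rule finite_subset)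
  have fin: "finite C'" using finC by (simp add: C'_def)
  have "C' \<noteq> {}" using c by (auto simp: C'_def)
  define M where "M = Max (base_value N ` C')"
  have "M \<in> base_value N ` C'" unfolding M_def using fin \<open>C' \<noteq> {}\<close> by (intro Max_in) auto
  then obtain \<beta> where \<beta>: "\<beta> \<in> C'" "base_value N \<beta> = M" by blast
  have less: "base_value N \<alpha> < base_value N \<beta>" if "\<alpha> \<in> C' - {\<beta>}" for \<alpha>
  proof -
    have "base_value N \<alpha> \<le> M" unfolding M_def using fin that by (intro Max_ge) auto
    moreover have "base_value N \<alpha> \<noteq> base_value N \<beta>"
      using inj_onD[OF base_value_inj, of N \<alpha> \<beta>] that \<beta>(1) C(1) by (auto simp: C'_def)
    ultimately show ?thesis using \<beta>(2) by simp
  qed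
  have c\<beta>: "c \<beta> \<noteq> 0" and \<beta>_digits: "\<beta> \<in> digits N" and \<beta>_nz: "\<beta> \<noteq> (\<lambda>_. 0)"
    using \<beta>(1) C by (auto simp: C'_def)
  define S where "S = (\<Sum>\<alpha>\<in>C'. norm (c \<alpha>))"
  have S: "S \<ge> 0" by (simp add: S_def sum_nonneg)
  define \<epsilon> where "\<epsilon> = e / (S + 1)"
  have \<epsilon>: "\<epsilon> > 0" using e S by (simp add: \<epsilon>_def)
  have "(\<lambda>z. inverse (c \<beta>) * f z) \<in> entire" by (intro entire_mult entire_const f)
  from separates[rule_format, OF \<beta>_digits \<beta>_nz this \<epsilon>, of R] obtain q where
    q: "close_on R \<epsilon> ((T ^^ q) (monomial N \<beta> F)) (\<lambda>z. inverse (c \<beta>) * f z)"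
      "\<forall>\<alpha>\<in>digits N. base_value N \<alpha> < base_value N \<beta> \<longrightarrow>
          small_on R \<epsilon> ((T ^^ q) (monomial N \<alpha> F))"
    by (elim exE conjE)
  have "norm ((T ^^ q) (\<lambda>z. \<Sum>\<alpha>\<in>C. c \<alpha> * monomial N \<alpha> F z) z - f z) < e" if z: "norm z \<le> R" for z
  proof -
    have "(T ^^ q) (\<lambda>z. \<Sum>\<alpha>\<in>C. c \<alpha> * monomial N \<alpha> F z) z = (\<Sum>\<alpha>\<in>C. c \<alpha> * (T ^^ q) (monomial N \<alpha> F) z)"
      using local_operator_sum[OF local_operator_funpow[OF T] finC, of "\<lambda>\<alpha>. monomial N \<alpha> F" q c] monomial_entire F
      by simp
    also have "\<dots> = (\<Sum>\<alpha>\<in>C'. c \<alpha> * (T ^^ q) (monomial N \<alpha> F) z)"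
      unfolding C'_def using finC by (intro sum.mono_neutral_right) auto
    also have "\<dots> = c \<beta> * (T ^^ q) (monomial N \<beta> F) z + (\<Sum>\<alpha>\<in>C' - {\<beta>}. c \<alpha> * (T ^^ q) (monomial N \<alpha> F) z)"
      using fin \<beta>(1) by (rule sum.remove)
    finally have "(T ^^ q) (\<lambda>z. \<Sum>\<alpha>\<in>C. c \<alpha> * monomial N \<alpha> F z) z - f z
      = c \<beta> * ((T ^^ q) (monomial N \<beta> F) z - inverse (c \<beta>) * f z) + (\<Sum>\<alpha>\<in>C' - {\<beta>}. c \<alpha> * (T ^^ q) (monomial N \<alpha> F) z)"
      using c\<beta> by (simp add: right_diff_distrib)
    also have "norm \<dots> \<le> norm (c \<beta>) * \<epsilon> + (\<Sum>\<alpha>\<in>C' - {\<beta>}. norm (c \<alpha>) * \<epsilon>)"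
    proof (intro norm_triangle_le add_mono)
      show "norm (c \<beta> * ((T ^^ q) (monomial N \<beta> F) z - inverse (c \<beta>) * f z)) \<le> norm (c \<beta>) * \<epsilon>"
        unfolding norm_mult using q(1)[rule_format, OF z] by (intro mult_left_mono) auto
      show "norm (\<Sum>\<alpha>\<in>C' - {\<beta>}. c \<alpha> * (T ^^ q) (monomial N \<alpha> F) z) \<le> (\<Sum>\<alpha>\<in>C' - {\<beta>}. norm (c \<alpha>) * \<epsilon>)"
      proof (rule order.trans[OF norm_sum], rule sum_mono)
        fix \<alpha> assume \<alpha>: "\<alpha> \<in> C' - {\<beta>}"
        then have "\<alpha> \<in> digits N" using C(1) by (auto simp: C'_def)
        from q(2)[rule_format, OF this less[OF \<alpha>] z]
        show "norm (c \<alpha> * (T ^^ q) (monomial N \<alpha> F) z) \<le> norm (c \<alpha>) * \<epsilon>"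
          unfolding norm_mult by (intro mult_left_mono) auto
      qed
    qed
    also have "\<dots> = (\<Sum>\<alpha>\<in>C'. norm (c \<alpha>) * \<epsilon>)"
      using sum.remove[OF fin \<beta>(1), of "\<lambda>\<alpha>. norm (c \<alpha>) * \<epsilon>"] by simp
    also have "\<dots> = S * \<epsilon>" by (simp add: S_def sum_distrib_right)
    also have "\<dots> < (S + 1) * \<epsilon>" using \<epsilon> by simp
    also have "\<dots> = e" using S by (simp add: \<epsilon>_def)
    finally show ?thesis .
  qed
  then show ?thesis by blast
qed

abbreviation keys :: "('a \<Rightarrow>\<^sub>0 'b::zero) \<Rightarrow> 'a set" where "keys \<equiv> Poly_Mapping.keys"

abbreviation lookup :: "('a \<Rightarrow>\<^sub>0 'b::zero) \<Rightarrow> 'a \<Rightarrow> 'b" where "lookup \<equiv> Poly_Mapping.lookup"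

text \<open>The exponent vector obtained by substituting \<open>F (\<sigma> i)\<close> for the \<open>i\<close>-th indeterminate. If \<open>\<sigma>\<close> is not
  injective, several indeterminates contribute to one generator.\<close>

definition push_exponents :: "(nat \<Rightarrow> nat) \<Rightarrow> (nat \<Rightarrow>\<^sub>0 nat) \<Rightarrow> nat \<Rightarrow> nat" where
  "push_exponents \<sigma> m l = (\<Sum>i\<in>{i \<in> keys m. \<sigma> i = l}. lookup m i)"

lemma monomial_push_exponents:
  assumes "\<And>i. i \<in> keys m \<Longrightarrow> \<sigma> i < N"
  shows "monomial N (push_exponents \<sigma> m) F z
       = (\<Prod>i\<in>keys m. F (\<sigma> i) z ^ lookup m i)"
proof -
  have "monomial N (push_exponents \<sigma> m) F z
      = (\<Prod>l<N. \<Prod>i\<in>{i \<in> keys m. \<sigma> i = l}. F (\<sigma> i) z ^ lookup m i)"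
    unfolding monomial_def push_exponents_def power_sum by (intro prod.cong refl) auto
  also have "\<dots> = (\<Prod>i\<in>keys m. F (\<sigma> i) z ^ lookup m i)"
    by (rule prod.group) (use assms in auto)
  finally show ?thesis .
qed

lemma push_exponents_nonzero:
  assumes "m \<noteq> 0"
  shows "push_exponents \<sigma> m \<noteq> (\<lambda>_. 0)"
proof
  assume eq: "push_exponents \<sigma> m = (\<lambda>_. 0)"
  obtain i where i: "i \<in> keys m" using assms by (metis all_not_in_conv keys_eq_empty)
  have "lookup m i \<le> push_exponents \<sigma> m (\<sigma> i)"
    unfolding push_exponents_def using i by (intro member_le_sum) auto
  then show False using i eq by (simp add: in_keys_iff)
qed

lemma push_exponents_inj:
  assumes "inj_on \<sigma> {..<n}" "keys m \<subseteq> {..<n}" "keys m' \<subseteq> {..<n}"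
    and eq: "push_exponents \<sigma> m = push_exponents \<sigma> m'"
  shows "m = m'"
proof (rule poly_mapping_eqI)
  fix i
  have coeff: "lookup k i = push_exponents \<sigma> k (\<sigma> i)"
    if "keys k \<subseteq> {..<n}" "i < n" for k
  proof -
    have "j = i" if "j \<in> keys k" "\<sigma> j = \<sigma> i" for j
      by (rule inj_onD[OF assms(1) that(2)]) (use that(1) \<open>keys k \<subseteq> {..<n}\<close> \<open>i < n\<close> in auto)
    then have "{j \<in> keys k. \<sigma> j = \<sigma> i} = (if i \<in> keys k then {i} else {})"
      by auto
    then show ?thesis by (simp add: push_exponents_def in_keys_iff)
  qed
  show "lookup m i = lookup m' i"
  proof (cases "i < n")
    case True
    then show ?thesis using coeff assms(2-4) by simp
  next
    case False
    then have "i \<notin> keys m" "i \<notin> keys m'" using assms(2,3) by auto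
    then show ?thesis by (simp add: in_keys_iff)
  qed
qed

lemma push_exponents_digits:
  assumes "\<And>i. i \<in> keys m \<Longrightarrow> \<sigma> i < N"
    and "(\<Sum>i\<in>keys m. lookup m i) < N"
  shows "push_exponents \<sigma> m \<in> digits N"
proof -
  have "push_exponents \<sigma> m l \<le> (\<Sum>i\<in>keys m. lookup m i)" for l
    unfolding push_exponents_def by (intro sum_mono2) auto
  then have "push_exponents \<sigma> m l < N" for l using assms(2) by (rule le_less_trans)
  moreover have "push_exponents \<sigma> m l = 0" if "\<not> l < N" for l
  proof -
    have "{i \<in> keys m. \<sigma> i = l} = {}" using assms(1) that by auto
    then show ?thesis by (simp only: push_exponents_def sum.empty)
  qed
  ultimately show ?thesis by (simp add: digits_def)
qed

lemma zero_not_in_keys: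
  assumes "mpoly_eval P (\<lambda>_. 0) = 0"
  shows "0 \<notin> keys P"
proof
  assume zero: "0 \<in> keys P"
  have "(\<Prod>i\<in>keys m. 0 ^ lookup m i) = (0 :: complex)" if nz: "m \<noteq> 0" for m :: "nat \<Rightarrow>\<^sub>0 nat"
  proof -
    obtain i where "i \<in> keys m" using nz by (metis all_not_in_conv keys_eq_empty)
    then show ?thesis by (intro prod_zero bexI[of _ i]) (auto simp: in_keys_iff)
  qed
  then have "mpoly_eval P (\<lambda>_. 0) = (\<Sum>m\<in>keys P. if m = 0 then lookup P 0 else 0)"
    unfolding mpoly_eval_def by (intro sum.cong refl) auto
  also have "\<dots> = lookup P 0" using zero by (simp add: sum.delta)
  finally show False using assms zero by (simp add: in_keys_iff)
qed

text \<open>Collecting the terms of \<open>P\<close> with the same exponents after substitution. For injective \<open>\<sigma>\<close> nothing is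
  merged, so the coefficients are those of \<open>P\<close>.\<close>

lemma mpoly_eval_fun_combination:
  assumes P: "P \<in> mpolys n" and P0: "mpoly_eval P (\<lambda>_. 0) = 0"
    and y: "\<And>i. i < n \<Longrightarrow> y i = F (\<sigma> i)"
  obtains N and C :: "(nat \<Rightarrow> nat) set" and c :: "(nat \<Rightarrow> nat) \<Rightarrow> complex" where "C \<subseteq> digits N" "(\<lambda>_. 0) \<notin> C"
    "mpoly_eval_fun P y = (\<lambda>z. \<Sum>\<alpha>\<in>C. c \<alpha> * monomial N \<alpha> F z)"
    "inj_on \<sigma> {..<n} \<and> P \<noteq> 0 \<longrightarrow> (\<exists>\<alpha>\<in>C. c \<alpha> \<noteq> 0)"
proof -
  let ?K = "keys P"
  define N where "N = Suc ((\<Sum>i<n. \<sigma> i) + (\<Sum>m\<in>?K. \<Sum>i\<in>keys m. lookup m i))"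
  have bounded: "keys m \<subseteq> {..<n}" if "m \<in> ?K" for m
    using P that by (auto simp: mpolys_def)
  have \<sigma>: "\<sigma> i < N" if "i < n" for i
  proof -
    have "\<sigma> i \<le> (\<Sum>i<n. \<sigma> i)" using that by (intro member_le_sum) auto
    then show ?thesis by (simp add: N_def)
  qed
  have deg: "(\<Sum>i\<in>keys m. lookup m i) < N" if "m \<in> ?K" for m
  proof -
    have "(\<Sum>i\<in>keys m. lookup m i)
        \<le> (\<Sum>m\<in>?K. \<Sum>i\<in>keys m. lookup m i)"
      using that by (intro member_le_sum) auto
    then show ?thesis by (simp add: N_def)
  qed
  define C where "C = push_exponents \<sigma> ` ?K"
  define c where "c = (\<lambda>\<alpha>. \<Sum>m\<in>{m \<in> ?K. push_exponents \<sigma> m = \<alpha>}. lookup P m)"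
  show ?thesis
  proof (rule that[of C N c])
    show "C \<subseteq> digits N"
      unfolding C_def
    proof (rule image_subsetI)
      fix m assume "m \<in> ?K"
      then show "push_exponents \<sigma> m \<in> digits N"
        using bounded[of m] \<sigma> by (intro push_exponents_digits deg) auto
    qed
    show "(\<lambda>_. 0) \<notin> C"
    proof
      assume "(\<lambda>_. 0) \<in> C"
      then obtain m where "m \<in> ?K" "push_exponents \<sigma> m = (\<lambda>_. 0)" unfolding C_def by auto
      then show False using push_exponents_nonzero[of m \<sigma>] zero_not_in_keys[OF P0] by metis
    qed
    show "mpoly_eval_fun P y = (\<lambda>z. \<Sum>\<alpha>\<in>C. c \<alpha> * monomial N \<alpha> F z)"
    proof
      fix z
      have "mpoly_eval_fun P y z = (\<Sum>m\<in>?K. lookup P m * monomial N (push_exponents \<sigma> m) F z)"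
        unfolding mpoly_eval_fun_def mpoly_eval_def
      proof (intro sum.cong refl)
        fix m assume m: "m \<in> ?K"
        have "monomial N (push_exponents \<sigma> m) F z = (\<Prod>i\<in>keys m. F (\<sigma> i) z ^ lookup m i)"
          using bounded[OF m] \<sigma> by (intro monomial_push_exponents) auto
        also have "\<dots> = (\<Prod>i\<in>keys m. y i z ^ lookup m i)"
          using bounded[OF m] y by (intro prod.cong refl) auto
        finally show "lookup P m * (\<Prod>i\<in>keys m. y i z ^ lookup m i)
          = lookup P m * monomial N (push_exponents \<sigma> m) F z" by simp
      qed
      also have "\<dots> = (\<Sum>\<alpha>\<in>C. \<Sum>m\<in>{m \<in> ?K. push_exponents \<sigma> m = \<alpha>}.
          lookup P m * monomial N (push_exponents \<sigma> m) F z)"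
        unfolding C_def by (rule sum.image_gen) simp
      also have "\<dots> = (\<Sum>\<alpha>\<in>C. c \<alpha> * monomial N \<alpha> F z)"
        unfolding c_def sum_distrib_right by (intro sum.cong refl) auto
      finally show "mpoly_eval_fun P y z = (\<Sum>\<alpha>\<in>C. c \<alpha> * monomial N \<alpha> F z)" .
    qed
    show "inj_on \<sigma> {..<n} \<and> P \<noteq> 0 \<longrightarrow> (\<exists>\<alpha>\<in>C. c \<alpha> \<noteq> 0)"
    proof (intro impI, elim conjE)
      assume inj: "inj_on \<sigma> {..<n}" and "P \<noteq> 0"
      then obtain m where m: "m \<in> ?K" by (metis all_not_in_conv keys_eq_empty)
      have "{m' \<in> ?K. push_exponents \<sigma> m' = push_exponents \<sigma> m} = {m}"
        using m bounded push_exponents_inj[OF inj] by blast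
      then have "c (push_exponents \<sigma> m) = lookup P m" by (simp add: c_def)
      then show "\<exists>\<alpha>\<in>C. c \<alpha> \<noteq> 0"
        using m by (intro bexI[of _ "push_exponents \<sigma> m"]) (auto simp: C_def in_keys_iff)
    qed
  qed
qed

lemma hypercyclic_vectorI:
  assumes T: "local_operator T" and g: "g \<in> entire"
    and orbit: "\<And>f R e. f \<in> entire \<Longrightarrow> (e :: real) > 0 \<Longrightarrow> \<exists>q. close_on R e ((T ^^ q) g) f"
  shows "hypercyclic_vector entire_topology T g"
  unfolding hypercyclic_vector_def topspace_entire_topology
proof (rule conjI[OF g], rule dense_in_entire_topologyI)
  show "{(T ^^ n) g |n. True} \<subseteq> entire"
    using local_operator_entire[OF local_operator_funpow[OF T] g] by auto
  fix f and R e :: real assume "f \<in> entire" "e > 0"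
  from orbit[OF this, of R] show "\<exists>h\<in>{(T ^^ n) g |n. True}. close_on R e h f"
    by auto
qed

text \<open>The members of a generic sequence are the free generators. They are pairwise distinct since the
  difference of two of them is a combination of monomials with non-zero coefficients.\<close>

theorem common_hypercyclic_vectors_algebrable:
  fixes \<Phi> :: "nat \<Rightarrow> cfun"
  assumes arc: "\<And>n. unimodular_arc (\<Phi> n) (\<Gamma> n)" and \<Phi>: "\<And>n. exponential_type (\<Phi> n)"
  shows "densely_strongly_algebrable entire_topology
    (common_hypercyclic_vectors entire_topology {conv_op (\<Phi> n) |n. True})"
proof -
  let ?E = "common_hypercyclic_vectors entire_topology {conv_op (\<Phi> n) |n. True}"
  have T: "local_operator (conv_op (\<Phi> n))" for n
    by (intro exponential_type_local_operator \<Phi>)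
  obtain F where F: "entire_seq F"
    and F_dense: "\<forall>f\<in>entire. \<forall>R. \<forall>e>0. \<exists>i. close_on R e (F i) f"
    and F_transitive: "\<forall>n N. separates_monomials (conv_op (\<Phi> n)) N F"
    by (rule generic_sequence[OF arc \<Phi>])
  have combination: "(\<lambda>z. \<Sum>\<alpha>\<in>C. c \<alpha> * monomial N \<alpha> F z) \<in> ?E \<and> (\<lambda>z. \<Sum>\<alpha>\<in>C. c \<alpha> * monomial N \<alpha> F z) \<noteq> (\<lambda>_. 0)"
    if C: "C \<subseteq> digits N" "(\<lambda>_. 0) \<notin> C" and c: "\<gamma> \<in> C" "c \<gamma> \<noteq> 0" for N C c \<gamma>
  proof -
    let ?g = "\<lambda>z. \<Sum>\<alpha>\<in>C. c \<alpha> * monomial N \<alpha> F z"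
    have g: "?g \<in> entire" using F by (intro entire_sum entire_mult entire_const monomial_entire) auto
    have escape: "\<exists>q. close_on R e ((conv_op (\<Phi> n) ^^ q) ?g) f"
      if "f \<in> entire" "e > 0" for n f and R e :: real
    proof (rule combination_escapes[where N = N and \<gamma> = \<gamma>])
      show "local_operator (conv_op (\<Phi> n))" by (rule T)
      show "F i \<in> entire" for i using F by blast
    qed (use C c that F_transitive in simp_all)
    have "hypercyclic_vector entire_topology (conv_op (\<Phi> n)) ?g" for n
      by (rule hypercyclic_vectorI[OF T g escape])
    then have "?g \<in> ?E"
      using g unfolding common_hypercyclic_vectors_def topspace_entire_topology by blast
    moreover have "?g \<noteq> (\<lambda>_. 0)"
    proof
      assume "?g = (\<lambda>_. 0)"
      with escape[of "\<lambda>_. 1" 1 1 0] obtain q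
        where "close_on 1 1 ((conv_op (\<Phi> 0) ^^ q) (\<lambda>_. 0)) (\<lambda>z. 1)"
        using entire_const by auto
      then have "norm ((conv_op (\<Phi> 0) ^^ q) (\<lambda>_. 0) 0 - 1) < 1" by simp
      then show False by (simp add: local_operator_zero[OF local_operator_funpow[OF T]])
    qed
    ultimately show ?thesis by blast
  qed
  have inj: "inj F"
  proof (rule injI, rule ccontr)
    fix i j assume eq: "F i = F j" and ne: "i \<noteq> j"
    define unit :: "nat \<Rightarrow> nat \<Rightarrow> nat" where "unit = (\<lambda>i l. if l = i then 1 else 0)"
    define N where "N = i + j + 2"
    have unit_monomial: "monomial N (unit k) F z = F k z" if "k < N" for k z
    proof -
      have "monomial N (unit k) F z = (\<Prod>l<N. if l = k then F l z else 1)"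
        unfolding monomial_def unit_def by (intro prod.cong refl) auto
      then show ?thesis using that by (simp add: prod.delta)
    qed
    have unit_ne: "unit i \<noteq> unit j" using ne by (auto simp: unit_def fun_eq_iff)
    have unit_nz: "unit k \<noteq> (\<lambda>_. 0)" for k by (auto simp: unit_def fun_eq_iff)
    define c :: "(nat \<Rightarrow> nat) \<Rightarrow> complex" where "c = (\<lambda>\<alpha>. if \<alpha> = unit i then 1 else - 1)"
    have "(\<lambda>z. \<Sum>\<alpha>\<in>{unit i, unit j}. c \<alpha> * monomial N \<alpha> F z) \<noteq> (\<lambda>_. 0)"
    proof (rule conjunct2[OF combination[where \<gamma> = "unit i"]])
      show "{unit i, unit j} \<subseteq> digits N" by (auto simp: digits_def unit_def N_def)
      show "(\<lambda>_. 0) \<notin> {unit i, unit j}" using unit_nz by (metis insertE singletonD)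
      show "c (unit i) \<noteq> 0" by (simp add: c_def)
    qed simp
    moreover have "(\<Sum>\<alpha>\<in>{unit i, unit j}. c \<alpha> * monomial N \<alpha> F z) = 0" for z
    proof -
      have "(\<Sum>\<alpha>\<in>{unit i, unit j}. c \<alpha> * monomial N \<alpha> F z) = F i z - F j z"
      proof -
        have "monomial N (unit i) F z = F i z" "monomial N (unit j) F z = F j z"
          by (rule unit_monomial, simp add: N_def)+
        then show ?thesis using unit_ne by (simp add: c_def)
      qed
      then show ?thesis using eq by simp
    qed
    ultimately show False by simp
  qed
  have choose_indices: "\<exists>\<sigma>. \<forall>i<n. y i = F (\<sigma> i)" if "y ` {..<n} \<subseteq> range F" for y :: "nat \<Rightarrow> cfun" and n
  proof -
    have "\<forall>i\<in>{..<n}. \<exists>s. y i = F s" using that by (auto simp: image_subset_iff)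
    then obtain \<sigma> where "\<forall>i\<in>{..<n}. y i = F (\<sigma> i)" by (rule bchoice[THEN exE])
    then show ?thesis by auto
  qed
  have generated: "generated_subalgebra (range F) \<subseteq> ?E \<union> {\<lambda>_. 0}"
  proof
    fix g assume "g \<in> generated_subalgebra (range F)"
    then obtain P y n where g: "g = mpoly_eval_fun P y" and P: "P \<in> mpolys n"
      and y: "y ` {..<n} \<subseteq> range F" and P0: "mpoly_eval P (\<lambda>_. 0) = 0"
      unfolding generated_subalgebra_def by blast
    obtain \<sigma> where \<sigma>: "\<forall>i<n. y i = F (\<sigma> i)" using choose_indices[OF y] by (elim exE)
    obtain N and C :: "(nat \<Rightarrow> nat) set" and c :: "(nat \<Rightarrow> nat) \<Rightarrow> complex"
      where C: "C \<subseteq> digits N" "(\<lambda>_. 0) \<notin> C"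
      and eval: "mpoly_eval_fun P y = (\<lambda>z. \<Sum>\<alpha>\<in>C. c \<alpha> * monomial N \<alpha> F z)"
      and "inj_on \<sigma> {..<n} \<and> P \<noteq> 0 \<longrightarrow> (\<exists>\<alpha>\<in>C. c \<alpha> \<noteq> 0)"
      by (rule mpoly_eval_fun_combination[where F = F and \<sigma> = \<sigma> and y = y, OF P P0 \<sigma>[rule_format]])
    show "g \<in> ?E \<union> {\<lambda>_. 0}"
    proof (cases "\<exists>\<gamma>\<in>C. c \<gamma> \<noteq> 0")
      case True
      then obtain \<gamma> where "\<gamma> \<in> C" "c \<gamma> \<noteq> 0" by blast
      from conjunct1[OF combination[where N = N and C = C and c = c and \<gamma> = \<gamma>, OF C this]] show ?thesis unfolding g eval by (rule UnI1)
    next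
      case False
      then have "g = (\<lambda>_. 0)" unfolding g eval by (intro ext sum.neutral) auto
      then show ?thesis by simp
    qed
  qed
  have independent: "algebraically_independent (range F)"
    unfolding algebraically_independent_def
  proof (intro allI ballI impI, elim conjE)
    fix n y P assume P: "P \<in> mpolys n" and y: "y ` {..<n} \<subseteq> range F" and y_inj: "inj_on y {..<n}"
      and "P \<noteq> 0" and P0: "mpoly_eval P (\<lambda>_. 0) = 0"
    obtain \<sigma> where \<sigma>: "\<forall>i<n. y i = F (\<sigma> i)" using choose_indices[OF y] by (elim exE)
    have "inj_on \<sigma> {..<n}"
    proof (rule inj_onI)
      fix i j assume "i \<in> {..<n}" "j \<in> {..<n}" "\<sigma> i = \<sigma> j"
      then show "i = j" using inj_onD[OF y_inj, of i j] \<sigma> by simp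
    qed
    obtain N and C :: "(nat \<Rightarrow> nat) set" and c :: "(nat \<Rightarrow> nat) \<Rightarrow> complex"
      where C: "C \<subseteq> digits N" "(\<lambda>_. 0) \<notin> C"
      and eval: "mpoly_eval_fun P y = (\<lambda>z. \<Sum>\<alpha>\<in>C. c \<alpha> * monomial N \<alpha> F z)"
      and nz: "inj_on \<sigma> {..<n} \<and> P \<noteq> 0 \<longrightarrow> (\<exists>\<alpha>\<in>C. c \<alpha> \<noteq> 0)"
      by (rule mpoly_eval_fun_combination[where F = F and \<sigma> = \<sigma> and y = y, OF P P0 \<sigma>[rule_format]])
    obtain \<gamma> where "\<gamma> \<in> C" "c \<gamma> \<noteq> 0" using nz \<open>inj_on \<sigma> {..<n}\<close> \<open>P \<noteq> 0\<close> by blast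
    from conjunct2[OF combination[where N = N and C = C and c = c and \<gamma> = \<gamma>, OF C this]] show "mpoly_eval_fun P y \<noteq> (\<lambda>_. 0)" unfolding eval .
  qed
  have generators: "F i \<in> generated_subalgebra (range F)" for i
  proof -
    define P :: mpoly where "P = Poly_Mapping.single (Poly_Mapping.single 0 1) 1"
    have eval: "mpoly_eval P x = x 0" for x by (simp add: P_def mpoly_eval_def)
    have "F i = mpoly_eval_fun P (\<lambda>_. F i)" by (simp add: mpoly_eval_fun_def eval)
    moreover have "P \<in> mpolys 1" by (simp add: P_def mpolys_def)
    moreover have "mpoly_eval P (\<lambda>_. 0) = 0" by (simp add: eval)
    moreover have "(\<lambda>_. F i) ` {..<1::nat} \<subseteq> range F" by auto
    ultimately show ?thesis unfolding generated_subalgebra_def by blast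
  qed
  have "dense_in entire_topology (generated_subalgebra (range F))"
  proof (rule dense_in_entire_topologyI)
    have "?E \<subseteq> entire" by (auto simp: common_hypercyclic_vectors_def topspace_entire_topology)
    then show "generated_subalgebra (range F) \<subseteq> entire" using generated entire_const[of 0] by blast
    fix f and R e :: real assume "f \<in> entire" "e > 0"
    then obtain i where "close_on R e (F i) f" using F_dense by blast
    then show "\<exists>g\<in>generated_subalgebra (range F). close_on R e g f"
      using generators by (intro bexI[of _ "F i"])
  qed
  moreover have "infinite (range F)" using inj by (rule range_inj_infinite)
  moreover have "range F \<subseteq> topspace entire_topology" using F by (auto simp: topspace_entire_topology)
  ultimately show ?thesis
    unfolding densely_strongly_algebrable_def using independent generated by blast
qed

section \<open>The sine family\<close>

text \<open>Each derivative shifts the argument by \<open>\<pi>/2\<close>.\<close>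

lemma higher_deriv_sin:
  "(deriv ^^ n) (\<lambda>z. sin (c * z)) = (\<lambda>z :: complex. c ^ n * sin (c * z + of_real (real n * (pi / 2))))"
proof (induction n)
  case (Suc n)
  have shift: "sin (w + of_real (real (Suc n) * (pi / 2))) = cos (w + of_real (real n * (pi / 2)))" for w :: complex
  proof -
    have "w + of_real (real (Suc n) * (pi / 2)) = (w + of_real (real n * (pi / 2))) + of_real (pi / 2)"
      by (simp add: algebra_simps add_divide_distrib)
    then show ?thesis
      by (simp only: sin_add cos_of_real sin_of_real cos_pi_half sin_pi_half) simp
  qed
  have "deriv (\<lambda>z. c ^ n * sin (c * z + of_real (real n * (pi / 2)))) z
      = c ^ n * (cos (c * z + of_real (real n * (pi / 2))) * c)" for z
    by (rule DERIV_imp_deriv) (auto intro!: derivative_eq_intros)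
  then have "deriv (\<lambda>z. c ^ n * sin (c * z + of_real (real n * (pi / 2))))
      = (\<lambda>z. c ^ Suc n * sin (c * z + of_real (real (Suc n) * (pi / 2))))"
    unfolding shift by (intro ext) simp
  then show ?case unfolding Suc[symmetric] by (simp only: funpow.simps comp_def)
qed simp

lemma exponential_type_sin:
  assumes "k \<ge> 1"
  shows "exponential_type (\<lambda>z. sin (of_nat k * z))"
  unfolding exponential_type_def
proof
  show "(\<lambda>z. sin (of_nat k * z)) \<in> entire"
    by (auto simp: entire_def intro!: holomorphic_intros)
  have "norm (taylor_coeff (\<lambda>z. sin (of_nat k * z)) n) \<le> 1 * real k ^ n / fact n" for n
  proof -
    have "norm (sin (complex_of_real (real n * (pi / 2)))) \<le> 1"
      unfolding sin_of_real norm_of_real by simp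
    then have "norm ((of_nat k :: complex) ^ n * sin (of_real (real n * (pi / 2)))) \<le> real k ^ n * 1"
      unfolding norm_mult norm_power norm_of_nat by (intro mult_left_mono) auto
    then show ?thesis
      by (simp add: taylor_coeff_def higher_deriv_sin norm_divide divide_right_mono)
  qed
  moreover have "real k > 0" using assms by simp
  ultimately show "\<exists>M>0. \<exists>R>0. \<forall>n. norm (taylor_coeff (\<lambda>z. sin (of_nat k * z)) n) \<le> M * R ^ n / fact n"
    by (meson zero_less_one)
qed

text \<open>The mean value theorem on both sides of the dividing point shows that the slope to the left of it is
  smaller than the slope to the right.\<close>

lemma strictly_increasing_deriv_imp_below_chord:
  fixes f f' :: "real \<Rightarrow> real"
  assumes "a < b" and deriv: "\<And>x. a \<le> x \<Longrightarrow> x \<le> b \<Longrightarrow> (f has_real_derivative f' x) (at x)"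
    and mono: "\<And>x y. a \<le> x \<Longrightarrow> x < y \<Longrightarrow> y \<le> b \<Longrightarrow> f' x < f' y"
    and t: "0 < t" "t < 1"
  shows "f ((1 - t) * a + t * b) < (1 - t) * f a + t * f b"
proof -
  define c where "c = (1 - t) * a + t * b"
  have ca: "c - a = t * (b - a)" and bc: "b - c = (1 - t) * (b - a)"
    by (simp_all add: c_def algebra_simps)
  have "c - a > 0" "b - c > 0" unfolding ca bc using t \<open>a < b\<close> by simp_all
  then have ac: "a < c" "c < b" by simp_all
  obtain \<xi> where \<xi>: "a < \<xi>" "\<xi> < c" "f c - f a = (c - a) * f' \<xi>"
    using MVT2[OF ac(1), of f f'] deriv ac by auto
  obtain \<eta> where \<eta>: "c < \<eta>" "\<eta> < b" "f b - f c = (b - c) * f' \<eta>"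
    using MVT2[OF ac(2), of f f'] deriv ac by auto
  have "f' \<xi> < f' \<eta>" using \<xi> \<eta> by (intro mono) auto
  moreover have "t * (1 - t) * (b - a) > 0" using t \<open>a < b\<close> by simp
  ultimately have "t * (1 - t) * (b - a) * f' \<xi> < t * (1 - t) * (b - a) * f' \<eta>"
    by (intro mult_strict_left_mono)
  moreover have "(1 - t) * (f c - f a) = t * (1 - t) * (b - a) * f' \<xi>" unfolding \<xi>(3) ca by simp
  moreover have "t * (f b - f c) = t * (1 - t) * (b - a) * f' \<eta>" unfolding \<eta>(3) bc by simp
  ultimately have "(1 - t) * (f c - f a) < t * (f b - f c)" by (simp only:)
  then show ?thesis by (simp add: c_def algebra_simps)
qed

lemma below_chord:
  fixes f f' :: "real \<Rightarrow> real"
  assumes deriv: "\<And>x. l \<le> x \<Longrightarrow> x \<le> u \<Longrightarrow> (f has_real_derivative f' x) (at x)"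
    and mono: "\<And>x y. l \<le> x \<Longrightarrow> x < y \<Longrightarrow> y \<le> u \<Longrightarrow> f' x < f' y"
    and t: "0 < t" "t < 1" and ab: "l \<le> a" "a \<le> u" "l \<le> b" "b \<le> u" "a \<noteq> b"
  shows "f ((1 - t) * a + t * b) < (1 - t) * f a + t * f b"
proof (cases "a < b")
  case True
  show ?thesis
    by (rule strictly_increasing_deriv_imp_below_chord[OF True _ _ t, of f f'])
       (use deriv mono ab in auto)
next
  case False
  then have "b < a" using ab by simp
  have "f ((1 - (1 - t)) * b + (1 - t) * a) < (1 - (1 - t)) * f b + (1 - t) * f a"
    by (rule strictly_increasing_deriv_imp_below_chord[OF \<open>b < a\<close>, of f f'])
       (use deriv mono ab t in auto)
  then show ?thesis by (simp add: add.commute)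
qed

lemma sinh_below_chord:
  fixes a b :: real
  assumes "0 \<le> a" "0 \<le> b" "a \<noteq> b" "0 < t" "t < 1"
  shows "sinh ((1 - t) * a + t * b) < (1 - t) * sinh a + t * sinh b"
proof (rule below_chord[of 0 "max a b" sinh cosh])
  show "(sinh has_real_derivative cosh x) (at x)" for x :: real
    by (auto intro!: derivative_eq_intros)
  show "cosh x < cosh y" if "0 \<le> x" "x < y" for x y :: real
    using that by (simp add: cosh_real_strict_mono)
qed (use assms in auto)

lemma neg_cos_below_chord:
  fixes a b :: real
  assumes "0 \<le> a" "a \<le> 1" "0 \<le> b" "b \<le> 1" "a \<noteq> b" "0 < t" "t < 1"
  shows "- cos ((1 - t) * a + t * b) < (1 - t) * (- cos a) + t * (- cos b)"
proof (rule below_chord[of 0 1 "\<lambda>x. - cos x" sin])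
  show "((\<lambda>x. - cos x) has_real_derivative sin x) (at x)" for x :: real
    by (auto intro!: derivative_eq_intros)
  show "sin x < sin y" if "0 \<le> x" "x < y" "y \<le> 1" for x y :: real
    using that pi_gt3 by (intro sin_monotone_2pi) auto
qed (use assms in auto)

text \<open>The zero set is the curve \<open>sinh y = cos x\<close>. By \<open>norm_sin_squared_sinh\<close> it is where \<open>|sin w| = 1\<close>, as
  long as \<open>cos x\<close> and \<open>y\<close> are non-negative.\<close>

definition sine_level :: "complex \<Rightarrow> real" where
  "sine_level w = sinh (Im w) - cos (Re w)"

text \<open>On this set \<open>sine_level\<close> is strictly convex, as \<open>sinh\<close> is on the positive axis and \<open>- cos\<close> on \<open>[0, 1]\<close>.\<close>

definition sine_strip :: "complex set" where
  "sine_strip = {w. 0 \<le> Re w \<and> Re w \<le> 1 \<and> 0 \<le> Im w}"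

lemma convex_sine_strip: "convex sine_strip"
proof -
  have strip: "sine_strip = {w. 0 \<le> Re w} \<inter> {w. Re w \<le> 1} \<inter> {w. 0 \<le> Im w}"
    by (auto simp: sine_strip_def)
  show ?thesis
    unfolding strip
    by (intro convex_Int convex_halfspace_Re_ge convex_halfspace_Re_le convex_halfspace_Im_ge)
qed

lemma sine_level_below_chord:
  assumes w: "w1 \<in> sine_strip" "w2 \<in> sine_strip" "w1 \<noteq> w2" and t: "0 < t" "t < 1"
  shows "sine_level ((1 - t) *\<^sub>R w1 + t *\<^sub>R w2) < (1 - t) * sine_level w1 + t * sine_level w2"
proof -
  have combo: "(1 - t) * x + t * x = x" for x :: real by (simp add: algebra_simps)
  have Re: "- cos ((1 - t) * Re w1 + t * Re w2) \<le> (1 - t) * (- cos (Re w1)) + t * (- cos (Re w2))"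
    and Re': "Re w1 \<noteq> Re w2 \<Longrightarrow>
      - cos ((1 - t) * Re w1 + t * Re w2) < (1 - t) * (- cos (Re w1)) + t * (- cos (Re w2))"
    using neg_cos_below_chord[OF _ _ _ _ _ t, of "Re w1" "Re w2"] w combo[of "Re w1"] combo[of "- cos (Re w1)"]
    by (cases "Re w1 = Re w2"; simp add: sine_strip_def)+
  have Im: "sinh ((1 - t) * Im w1 + t * Im w2) \<le> (1 - t) * sinh (Im w1) + t * sinh (Im w2)"
    and Im': "Im w1 \<noteq> Im w2 \<Longrightarrow>
      sinh ((1 - t) * Im w1 + t * Im w2) < (1 - t) * sinh (Im w1) + t * sinh (Im w2)"
    using sinh_below_chord[OF _ _ _ t, of "Im w1" "Im w2"] w combo[of "Im w1"] combo[of "sinh (Im w1)"]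
    by (cases "Im w1 = Im w2"; simp add: sine_strip_def)+
  have "Re w1 \<noteq> Re w2 \<or> Im w1 \<noteq> Im w2" using w(3) by (auto simp: complex_eq_iff)
  then have "sinh ((1 - t) * Im w1 + t * Im w2) + - cos ((1 - t) * Re w1 + t * Re w2)
      < ((1 - t) * sinh (Im w1) + t * sinh (Im w2)) + ((1 - t) * (- cos (Re w1)) + t * (- cos (Re w2)))"
    using Re Re' Im Im' by (elim disjE) (auto intro: add_le_less_mono add_less_le_mono)
  then show ?thesis by (simp add: sine_level_def algebra_simps)
qed

lemma norm_sin_squared_sinh: "(norm (sin w))\<^sup>2 = (sin (Re w))\<^sup>2 + (sinh (Im w))\<^sup>2"
proof -
  have "Re (sin w) = sin (Re w) * cosh (Im w)" "Im (sin w) = cos (Re w) * sinh (Im w)"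
    by (simp_all add: Re_sin Im_sin cosh_def sinh_def)
  then have "(norm (sin w))\<^sup>2 = (sin (Re w))\<^sup>2 * (cosh (Im w))\<^sup>2 + (cos (Re w))\<^sup>2 * (sinh (Im w))\<^sup>2"
    by (simp add: cmod_power2 power_mult_distrib)
  also have "\<dots> = (sin (Re w))\<^sup>2 * (1 + (sinh (Im w))\<^sup>2) + (1 - (sin (Re w))\<^sup>2) * (sinh (Im w))\<^sup>2"
    by (simp add: cosh_square_eq cos_squared_eq add.commute)
  finally show ?thesis by (simp add: algebra_simps)
qed

lemma norm_sin_on_level:
  assumes "sine_level w = 0"
  shows "norm (sin w) = 1"
proof -
  have "(norm (sin w))\<^sup>2 = 1\<^sup>2" using assms by (simp add: norm_sin_squared_sinh sine_level_def)
  then show ?thesis by (rule power2_eq_imp_eq) simp_all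
qed

lemma norm_sin_below_level:
  assumes "w \<in> sine_strip" "sine_level w < 0"
  shows "norm (sin w) < 1"
proof -
  have "0 \<le> sinh (Im w)" "sinh (Im w) < cos (Re w)"
    using assms by (auto simp: sine_strip_def sine_level_def)
  then have "(sinh (Im w))\<^sup>2 < (cos (Re w))\<^sup>2" by (intro power_strict_mono) auto
  then have "(norm (sin w))\<^sup>2 < 1\<^sup>2" by (simp add: norm_sin_squared_sinh cos_squared_eq)
  then show ?thesis by (rule power_less_imp_less_base) simp
qed

definition sine_arc :: "nat \<Rightarrow> complex set" where
  "sine_arc k = {z. of_nat k * z \<in> sine_strip \<and> sine_level (of_nat k * z) = 0}"

lemma scale_segment: "of_nat k * ((1 - t) *\<^sub>R x + t *\<^sub>R y) = (1 - t) *\<^sub>R (of_nat k * x) + t *\<^sub>R (of_nat k * (y :: complex))"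
  by (simp add: scaleR_conv_of_real algebra_simps)

lemma nontrivial_sine_arc:
  assumes "k \<ge> 1"
  shows "nontrivial_arc (sine_arc k)"
proof -
  define g :: "real \<Rightarrow> complex" where "g = (\<lambda>t. (of_real t + \<i> * of_real (arsinh (cos t))) / of_nat k)"
  have kg: "of_nat k * g t = of_real t + \<i> * of_real (arsinh (cos t))" for t
    using assms by (simp add: g_def)
  have "continuous_on {0..1} g" unfolding g_def using assms by (intro continuous_intros) auto
  moreover have "inj_on g {0..1}"
  proof (rule inj_onI)
    fix s t assume "g s = g t"
    then have "Re (of_nat k * g s) = Re (of_nat k * g t)" by simp
    then show "s = t" unfolding kg by simp
  qed
  ultimately have "arc g" by (simp add: arc_def path_def)
  moreover have "path_image g = sine_arc k"
    unfolding path_image_def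
  proof (intro equalityI subsetI)
    fix z assume "z \<in> g ` {0..1}"
    then obtain t where t: "0 \<le> t" "t \<le> 1" "z = g t" by auto
    have "cos t > 0" using t pi_gt3 by (intro cos_gt_zero_pi) auto
    then have "sinh (arsinh (cos t)) > 0" by (simp only: sinh_arsinh_real)
    then have nonneg: "0 \<le> arsinh (cos t)" by (simp only: sinh_real_pos_iff less_imp_le)
    show "z \<in> sine_arc k"
      using t(1,2) nonneg unfolding sine_arc_def mem_Collect_eq t(3) kg sine_strip_def sine_level_def by simp
  next
    fix z assume z: "z \<in> sine_arc k"
    define t where "t = Re (of_nat k * z)"
    have t: "0 \<le> t" "t \<le> 1" "sinh (Im (of_nat k * z)) = cos t"
      using z by (auto simp: sine_arc_def sine_strip_def sine_level_def t_def)
    have "Im (of_nat k * z) = arsinh (cos t)" unfolding t(3)[symmetric] by (simp only: arsinh_sinh_real)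
    then have "of_nat k * z = of_nat k * g t" unfolding kg by (simp add: complex_eq_iff t_def)
    then have "z = g t" using assms by simp
    then show "z \<in> g ` {0..1}" using t by auto
  qed
  ultimately show ?thesis unfolding nontrivial_arc_def by blast
qed

text \<open>Strictly inside a chord between two zeros, the strictly convex function \<open>sine_level\<close> is negative.\<close>

lemma strictly_convex_sine_arc:
  assumes "k \<ge> 1"
  shows "strictly_convex_arc (sine_arc k)"
  unfolding strictly_convex_arc_def
proof (intro ballI equalityI subsetI)
  fix x y p assume x: "x \<in> sine_arc k" and y: "y \<in> sine_arc k" and p: "p \<in> closed_segment x y \<inter> sine_arc k"
  then obtain t where t: "0 \<le> t" "t \<le> 1" "p = (1 - t) *\<^sub>R x + t *\<^sub>R y" by (auto simp: closed_segment_def)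
  show "p \<in> {x, y}"
  proof (rule ccontr)
    assume np: "p \<notin> {x, y}"
    have "t \<noteq> 0" "t \<noteq> 1" using np t(3) by auto
    then have t': "0 < t" "t < 1" using t by auto
    have "x \<noteq> y"
    proof
      assume "x = y"
      then have "p = x" unfolding t(3) by (simp add: scaleR_left_distrib[symmetric])
      then show False using np by simp
    qed
    then have "of_nat k * x \<noteq> of_nat k * y" using assms by simp
    from sine_level_below_chord[OF _ _ this t'] have "sine_level (of_nat k * p) < 0"
      using x y unfolding t(3) scale_segment by (simp add: sine_arc_def)
    then show False using p by (simp add: sine_arc_def)
  qed
qed auto

text \<open>Sublevel sets of the convex function \<open>sine_level\<close> are convex.\<close>

lemma hull_sine_arc:
  assumes "k \<ge> 1" and z: "z \<in> convex hull (sine_arc k \<union> {0})"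
  shows "of_nat k * z \<in> sine_strip" "sine_level (of_nat k * z) \<le> 0"
proof -
  define S where "S = {z. of_nat k * z \<in> sine_strip \<and> sine_level (of_nat k * z) \<le> 0}"
  have "convex S"
    unfolding convex_alt
  proof (intro ballI allI impI)
    fix x y :: complex and t :: real assume xy: "x \<in> S" "y \<in> S" and t: "0 \<le> t \<and> t \<le> 1"
    show "(1 - t) *\<^sub>R x + t *\<^sub>R y \<in> S"
    proof (cases "t = 0 \<or> t = 1 \<or> x = y")
      case True
      then show ?thesis using xy by (auto simp: scaleR_left_distrib[symmetric])
    next
      case False
      then have t': "0 < t" "t < 1" and ne: "of_nat k * x \<noteq> of_nat k * y" using t assms(1) by auto
      have strip: "of_nat k * x \<in> sine_strip" "of_nat k * y \<in> sine_strip" using xy by (auto simp: S_def)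
      have "(1 - t) * sine_level (of_nat k * x) + t * sine_level (of_nat k * y) \<le> 0"
        using xy t by (intro add_nonpos_nonpos mult_nonneg_nonpos) (auto simp: S_def)
      then have "sine_level (of_nat k * ((1 - t) *\<^sub>R x + t *\<^sub>R y)) \<le> 0"
        using sine_level_below_chord[OF strip ne t'] unfolding scale_segment by simp
      moreover have "of_nat k * ((1 - t) *\<^sub>R x + t *\<^sub>R y) \<in> sine_strip"
        unfolding scale_segment using convex_sine_strip strip t by (simp add: convex_alt)
      ultimately show ?thesis by (simp add: S_def)
    qed
  qed
  moreover have "sine_arc k \<union> {0} \<subseteq> S" by (auto simp: S_def sine_arc_def sine_strip_def sine_level_def)
  ultimately have "z \<in> S" using z hull_minimal[of "sine_arc k \<union> {0}" S convex] by blast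
  then show "of_nat k * z \<in> sine_strip" "sine_level (of_nat k * z) \<le> 0" by (auto simp: S_def)
qed

lemma unimodular_arc_sin:
  assumes "k \<ge> 1"
  shows "unimodular_arc (\<lambda>z. sin (of_nat k * z)) (sine_arc k)"
proof
  show "(\<lambda>z. sin (of_nat k * z)) \<in> entire"
    using exponential_type_sin[OF assms] by (simp add: exponential_type_def)
  show "nontrivial_arc (sine_arc k)" "strictly_convex_arc (sine_arc k)"
    using nontrivial_sine_arc strictly_convex_sine_arc assms by auto
  show "norm (sin (of_nat k * z)) = 1" if "z \<in> sine_arc k" for z
    using that by (intro norm_sin_on_level) (simp add: sine_arc_def)
  show "norm (sin (of_nat k * z)) < 1" if "z \<in> convex hull (sine_arc k \<union> {0})" "z \<notin> sine_arc k" for z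
    using hull_sine_arc[OF assms that(1)] that(2)
    by (intro norm_sin_below_level) (auto simp: sine_arc_def)
qed simp

section \<open>Common hypercyclic algebras\<close>

theorem corollary1p4:
  shows "densely_strongly_algebrable entire_topology
           (common_hypercyclic_vectors entire_topology
             {conv_op (\<lambda>z. sin (of_nat k * z)) |k :: nat. k \<ge> 1})
       \<and> (\<forall>\<Phi> :: nat \<Rightarrow> complex \<Rightarrow> complex.
           (\<forall>n. exponential_type (\<Phi> n)
              \<and> hypercyclic entire_topology (conv_op (\<Phi> n))
              \<and> \<Phi> n 0 \<in> ball 0 1
              \<and> (\<exists>\<Gamma>. nontrivial_arc \<Gamma> \<and> strictly_convex_arc \<Gamma>
                    \<and> \<Gamma> \<subseteq> \<Phi> n -` sphere 0 1
                    \<and> convex hull (\<Gamma> \<union> {0}) - \<Gamma> \<subseteq> \<Phi> n -` ball 0 1))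
           \<longrightarrow> densely_strongly_algebrable entire_topology
                 (common_hypercyclic_vectors entire_topology {conv_op (\<Phi> n) |n. True}))"
proof (intro conjI allI impI)
  have "\<exists>n. k = Suc n" if "k \<ge> 1" for k :: nat
    using that by (intro exI[of _ "k - 1"]) simp
  then have family: "{conv_op (\<lambda>z. sin (of_nat k * z)) |k :: nat. k \<ge> 1}
      = {conv_op (\<lambda>z. sin (of_nat (Suc n) * z)) |n. True}"
    by (intro Collect_cong) (metis Suc_le_mono One_nat_def le0)
  show "densely_strongly_algebrable entire_topology
      (common_hypercyclic_vectors entire_topology {conv_op (\<lambda>z. sin (of_nat k * z)) |k :: nat. k \<ge> 1})"
    unfolding family
    by (rule common_hypercyclic_vectors_algebrable[where \<Gamma> = "\<lambda>n. sine_arc (Suc n)"])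
       (intro unimodular_arc_sin exponential_type_sin, simp)+
next
  fix \<Phi> :: "nat \<Rightarrow> complex \<Rightarrow> complex"
  assume hyp: "\<forall>n. exponential_type (\<Phi> n)
              \<and> hypercyclic entire_topology (conv_op (\<Phi> n))
              \<and> \<Phi> n 0 \<in> ball 0 1
              \<and> (\<exists>\<Gamma>. nontrivial_arc \<Gamma> \<and> strictly_convex_arc \<Gamma>
                    \<and> \<Gamma> \<subseteq> \<Phi> n -` sphere 0 1
                    \<and> convex hull (\<Gamma> \<union> {0}) - \<Gamma> \<subseteq> \<Phi> n -` ball 0 1)"
  then obtain \<Gamma> where \<Gamma>: "\<forall>n. nontrivial_arc (\<Gamma> n) \<and> strictly_convex_arc (\<Gamma> n)
      \<and> \<Gamma> n \<subseteq> \<Phi> n -` sphere 0 1 \<and> convex hull (\<Gamma> n \<union> {0}) - \<Gamma> n \<subseteq> \<Phi> n -` ball 0 1"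
    by metis
  have "unimodular_arc (\<Phi> n) (\<Gamma> n)" for n
  proof
    have arcs: "\<Gamma> n \<subseteq> \<Phi> n -` sphere 0 1" "convex hull (\<Gamma> n \<union> {0}) - \<Gamma> n \<subseteq> \<Phi> n -` ball 0 1"
      using \<Gamma> by blast+
    show "\<Phi> n \<in> entire" using hyp by (simp add: exponential_type_def)
    show "norm (\<Phi> n 0) < 1" using hyp by simp
    show "nontrivial_arc (\<Gamma> n)" "strictly_convex_arc (\<Gamma> n)" using \<Gamma> by blast+
    show "norm (\<Phi> n z) = 1" if "z \<in> \<Gamma> n" for z using subsetD[OF arcs(1) that] by simp
    show "norm (\<Phi> n z) < 1" if "z \<in> convex hull (\<Gamma> n \<union> {0})" "z \<notin> \<Gamma> n" for z
      using subsetD[OF arcs(2), of z] that by simp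
  qed
  then show "densely_strongly_algebrable entire_topology
      (common_hypercyclic_vectors entire_topology {conv_op (\<Phi> n) |n. True})"
    by (rule common_hypercyclic_vectors_algebrable) (use hyp in blast)
qed

end
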